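(* Let $d\in\mathbb{N}$, let $\mathcal{Z}$ be a bounded subset of $M_d(\mathbb{R})\times M_d(\mathbb{R})$, and let $\tau\ge 0$. Assume that $\lambda(\Sigma_{\mathcal{Z},\tau})<+\infty$. Then $$\lambda(\Sigma_{\mathcal{Z},\tau})=\max\Big\{\sup_{(Z_1,Z_2)\in\mathcal{Z}}\alpha(Z_1),\ \sup_{Z\in\mathcal{S}_{\mathcal{Z},\tau},\ k\in\Theta^\star(Z)}\frac{\log(\rho(\Phi_Z(t_k,0)))}{t_k}\Big\},$$ where, for each $Z\in \mathcal{S}_{\mathcal{Z},\tau}$, $(t_k)_{k\in\Theta^\star(Z)}=(t_k(Z))_{k\in\Theta^\star(Z)}$ are the switching times of $Z$.
   Context: $\mathbb{N}$ is the set of positive integers. $M_d(\mathbb{R})$ is the set of $d\times d$ real matrices, $|\cdot|$ the Euclidean norm on $\mathbb{R}^d$, $\|\cdot\|$ the induced operator norm. For a square matrix $M$, $\rho(M)$ is its spectral radius and $\alpha(M)$ its spectral abscissa (maximal real part of its eigenvalues). Conventions: $\log 0=-\infty$, $\sup\emptyset=-\infty$. Switching signals. $\mathcal{S}_{\mathcal{Z}}$ is the set of right-continuous piecewise-constant functions $Z=(Z_1(\cdot),Z_2(\cdot)):[0,+\infty)\to\mathcal{Z}$, each given together with a strictly increasing sequence of switching times $(t_k)_{k\in\Theta^\star(Z)}$ in $(0,+\infty)$ having no finite accumulation point, where $\Theta^\star(Z)$ is $\emptyset$, $\{1,\dots,N\}$ for some $N\in\mathbb{N}$, or $\mathbb{N}$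 (no, $N$, or infinitely many switchings). Set $t_0=0$ and, if $\Theta^\star(Z)$ is finite with cardinality $N$, $t_{N+1}=+\infty$. Let $\Theta(Z)=\{0\}\cup\Theta^\star(Z)$. The function $Z$ is constant on $[t_k,t_{k+1})$ for every $k\in\Theta(Z)$; it is allowed that $Z$ takes the same value on two consecutive intervals. For $\tau\ge0$, $\mathcal{S}_{\mathcal{Z},\tau}\subset \mathcal{S}_{\mathcal{Z}}$ is the set of signals with $t_{k+1}\ge t_k+\tau$ for all $k\in\Theta(Z)$ (so $\mathcal{S}_{\mathcal{Z},0}=\mathcal{S}_{\mathcal{Z}}$). Impulsive switched system. $\Sigma_{\mathcal{Z},\tau}$ is the system in $\mathbb{R}^d$ $$\dot x(t)=Z_1(t_k)x(t),\ t\in[t_k,t_{k+1}),\ k\in\Theta(Z);\qquad x(t_k)=Z_2(t_{k-1})\lim_{t\nearrow t_k}x(t),\ k\in\Theta^\star(Z),$$ for $Z\in\mathcal{S}_{\mathcal{Z},\tau}$. $\Phi_Z(t,0)$ is the matrix mapping $x(0)$ to $x(t)$ for the solution associated with $Z$ (so $\Phi_Z(t_k,0)$ includes the jump at $t_k$). The maximal Lyapunov exponent is $$\lambda(\Sigma_{\mathcal{Z},\tau})=\limsup_{t\to+\infty}\frac1t\sup_{Z\in\mathcal{S}_{\mathcal{Z},\tau}}\log(\|\Phi_Z(t,0)\|).$$ *)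

theory Defs
  imports "HOL-Analysis.Analysis" "HOL-Library.Extended_Nat"
begin

text \<open>Eigenvalues of a real matrix are its complex ones.\<close>

definition eigenvalues :: "real ^ 'n ^ 'n \<Rightarrow> complex set" where
  "eigenvalues M =
     {\<mu>. \<exists>v :: complex ^ 'n. v \<noteq> 0 \<and> (\<chi> i j. complex_of_real (M $ i $ j)) *v v = \<mu> *s v}"

definition spectral_radius :: "real ^ 'n ^ 'n \<Rightarrow> real" where
  "spectral_radius M = Max (cmod ` eigenvalues M)"

definition spectral_abscissa :: "real ^ 'n ^ 'n \<Rightarrow> real" where
  "spectral_abscissa M = Max (Re ` eigenvalues M)"

text \<open>Logarithm on the nonnegative reals with the convention \<open>log 0 = -\<infinity>\<close>.\<close>

definition elog :: "real \<Rightarrow> ereal" where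
  "elog x = (if x = 0 then -\<infinity> else ereal (ln x))"

text \<open>
  A switching signal is a function together with its switching times. Only the restriction of
  \<open>signal_at\<close> to \<open>[0, \<infinity>)\<close> and of \<open>switch_time\<close> to \<open>Theta\<close> is meaningful;
  \<open>switch_time Z 0\<close> is the initial time 0, and \<open>num_switches Z = \<infinity>\<close> stands for infinitely
  many switchings.
\<close>

record 'a switching_signal =
  signal_at :: "real \<Rightarrow> 'a"
  num_switches :: enat
  switch_time :: "nat \<Rightarrow> real"

definition Theta_star :: "'a switching_signal \<Rightarrow> nat set" where
  "Theta_star Z = {k. 1 \<le> k \<and> enat k \<le> num_switches Z}"

definition Theta :: "'a switching_signal \<Rightarrow> nat set" where
  "Theta Z = insert 0 (Theta_star Z)"

text \<open>The time \<open>t\<^sub>k\<^sub>+\<^sub>1\<close>, which is \<open>\<infinity>\<close> after the last switching.\<close>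

definition next_time :: "'a switching_signal \<Rightarrow> nat \<Rightarrow> ereal" where
  "next_time Z k =
     (if Suc k \<in> Theta_star Z then ereal (switch_time Z (Suc k)) else \<infinity>)"

definition switch_interval :: "'a switching_signal \<Rightarrow> nat \<Rightarrow> real set" where
  "switch_interval Z k = {t. switch_time Z k \<le> t \<and> ereal t < next_time Z k}"

text \<open>
  Constancy on each half-open interval \<open>[t\<^sub>k, t\<^sub>k\<^sub>+\<^sub>1)\<close> makes the signal right-continuous and
  piecewise constant; equal values on consecutive intervals are allowed.
\<close>

definition signals :: "'a set \<Rightarrow> 'a switching_signal set" where
  "signals \<Z> = {Z.
     switch_time Z 0 = 0 \<and>
     (\<forall>k\<in>Theta Z. ereal (switch_time Z k) < next_time Z k) \<and>
     (\<forall>t. \<not> t islimpt (switch_time Z ` Theta_star Z)) \<and>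
     (\<forall>k\<in>Theta Z. signal_at Z constant_on switch_interval Z k) \<and>
     (\<forall>t\<ge>0. signal_at Z t \<in> \<Z>)}"

definition dwell_signals :: "'a set \<Rightarrow> real \<Rightarrow> 'a switching_signal set" where
  "dwell_signals \<Z> \<tau> =
     {Z \<in> signals \<Z>. \<forall>k\<in>Theta Z. next_time Z k \<ge> ereal (switch_time Z k) + ereal \<tau>}"

text \<open>The derivative at the left end point \<open>t\<^sub>k\<close> of a switching interval is the right derivative.\<close>

definition is_solution ::
  "((real ^ 'n ^ 'n) \<times> (real ^ 'n ^ 'n)) switching_signal \<Rightarrow> (real \<Rightarrow> real ^ 'n) \<Rightarrow> bool" where
  "is_solution Z x \<longleftrightarrow>
     (\<forall>k\<in>Theta Z. \<forall>t\<in>switch_interval Z k.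
        (x has_vector_derivative fst (signal_at Z (switch_time Z k)) *v x t)
          (at t within switch_interval Z k)) \<and>
     (\<forall>k\<in>Theta_star Z. \<exists>l.
        (x \<longlongrightarrow> l) (at_left (switch_time Z k)) \<and>
        x (switch_time Z k) = snd (signal_at Z (switch_time Z (k - 1))) *v l)"

definition flow_matrix ::
  "((real ^ 'n ^ 'n) \<times> (real ^ 'n ^ 'n)) switching_signal \<Rightarrow> real \<Rightarrow> real ^ 'n ^ 'n" where
  "flow_matrix Z t = (THE M. \<forall>x. is_solution Z x \<longrightarrow> x t = M *v x 0)"

definition max_lyapunov_exponent ::
  "((real ^ 'n ^ 'n) \<times> (real ^ 'n ^ 'n)) set \<Rightarrow> real \<Rightarrow> ereal" where
  "max_lyapunov_exponent \<Z> \<tau> =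
     Limsup at_top (\<lambda>t :: real. ereal (1 / t) *
       (SUP Z\<in>dwell_signals \<Z> \<tau>. elog (onorm (\<lambda>x. flow_matrix Z t *v x))))"

end

theory Submission
  imports Defs "HOL-Computational_Algebra.Fundamental_Theorem_Algebra"
begin

text \<open>
  That the maximum \<open>M\<close> is at most the Lyapunov exponent is seen on particular signals. The signal
  without switchings has flow \<open>exp (t Z1)\<close>, which grows like \<open>exp (t \<alpha>(Z1))\<close> on an eigenvector, and
  a signal can be cut at a switching time \<open>t\<^sub>k\<close> and repeated periodically, so that powers of
  \<open>\<Phi>(t\<^sub>k)\<close> are flows as well.

  The converse is a Berger--Wang formula for products with durations. A trajectory up to a switching
  time is a word of steps ``flow with \<open>Z1\<close> for a time \<open>s\<close>, then jump with \<open>Z2\<close>'', and every word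
  of steps that respect the dwell time comes from a signal (\<open>flow_matrix_word\<close>, \<open>word_flow_matrix\<close>).
  Given \<open>\<epsilon> > 0\<close>, each step of duration \<open>s\<close> is multiplied by \<open>exp (- (M + \<epsilon>) s)\<close>. After that the
  powers of every word decay with a rate \<open>\<delta> = \<epsilon> / 2\<close> to spare, by the spectral radii; every
  single step decays at rate \<open>\<delta>\<close> in its duration, by the spectral abscissas; and words are
  exponentially bounded, because the Lyapunov exponent is finite (\<open>word_growth\<close>). These three
  properties imply that all words decay uniformly (\<open>stable_system_imp_decays\<close>), and undoing the
  rescaling bounds all flows by a multiple of \<open>exp ((M + \<epsilon>) t)\<close>.

  Uniform decay is proved by induction on the dimension of an invariant subspace \<open>W\<close>. The system is
  rescaled by its best growth exponent, if that is positive, and thus grows subexponentially. Let \<open>X\<close>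
  be the subspace of vectors with bounded orbits. If \<open>X\<close> is neither zero nor \<open>W\<close>, then the restriction
  to \<open>X\<close> and the quotient by \<open>X\<close> decay by induction, hence so does the block triangular system
  (\<open>decays_from_blocks\<close>). If \<open>X\<close> is zero, compactness of the sphere forces exponential growth
  (\<open>unbounded_orbits_imp_trivial\<close>). If \<open>X\<close> is \<open>W\<close>, then words are uniformly bounded, and failure of
  decay produces a long word that almost fixes a vector. This contradicts the stability of the word
  (\<open>bounded_imp_decays\<close>), quantitatively: the powers of a matrix obey a growth bound that depends
  only on its norm, its spectral radius and the dimension (\<open>uniform_power_bound\<close>).

  The last bound and its analogue for the matrix exponential (\<open>uniform_mexp_bound\<close>) come from a
  product of factors \<open>M - a\<close> over eigenvalues \<open>a\<close> that annihilates the matrix, of a length bounded by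
  the dimension (\<open>annihilating_eigenvalue_list\<close>).
\<close>

section \<open>Eigenvalues and complexification\<close>

definition re_vec :: "complex ^ 'n \<Rightarrow> real ^ 'n" where
  "re_vec v = (\<chi> i. Re (v $ i))"

definition im_vec :: "complex ^ 'n \<Rightarrow> real ^ 'n" where
  "im_vec v = (\<chi> i. Im (v $ i))"

definition cvec :: "real ^ 'n \<Rightarrow> real ^ 'n \<Rightarrow> complex ^ 'n" where
  "cvec p q = (\<chi> i. Complex (p $ i) (q $ i))"

text \<open>
  Eigenvectors are complex while flows and their bounds are real. The complex-linear extension of a
  real operator connects the two.
\<close>

definition complexify :: "(real ^ 'n \<Rightarrow> real ^ 'n) \<Rightarrow> complex ^ 'n \<Rightarrow> complex ^ 'n" where
  "complexify f v = cvec (f (re_vec v)) (f (im_vec v))"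

lemma re_vec_cvec [simp]: "re_vec (cvec p q) = p"
  and im_vec_cvec [simp]: "im_vec (cvec p q) = q"
  and cvec_re_im [simp]: "cvec (re_vec v) (im_vec v) = v"
  by (simp_all add: re_vec_def im_vec_def cvec_def vec_eq_iff)

lemma norm_cvec_sq: "(norm (cvec p q))\<^sup>2 = (norm p)\<^sup>2 + (norm q)\<^sup>2"
proof -
  have *: "(norm v)\<^sup>2 = (\<Sum>i\<in>UNIV. (norm (v $ i))\<^sup>2)" for v :: "('b::real_normed_vector) ^ 'c"
    by (simp add: norm_vec_def L2_set_def sum_nonneg)
  show ?thesis
    unfolding * by (simp add: cvec_def cmod_power2 sum.distrib)
qed

lemma norm_cvec_0 [simp]: "norm (cvec p 0) = norm p"
  using norm_cvec_sq[of p 0] by (simp add: power2_eq_iff_nonneg)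

lemma norm_sq_re_im: "(norm v)\<^sup>2 = (norm (re_vec v))\<^sup>2 + (norm (im_vec v))\<^sup>2"
  using norm_cvec_sq[of "re_vec v" "im_vec v"] by simp

text \<open>By Pythagoras for real and imaginary parts, the extension has the same norm bound.\<close>

lemma complexify_bound:
  assumes "\<And>x. norm (f x) \<le> b * norm x" "b \<ge> 0"
  shows "norm (complexify f v) \<le> b * norm v"
proof (rule power2_le_imp_le)
  have "(norm (complexify f v))\<^sup>2 = (norm (f (re_vec v)))\<^sup>2 + (norm (f (im_vec v)))\<^sup>2"
    by (simp add: complexify_def norm_cvec_sq)
  also have "\<dots> \<le> (b * norm (re_vec v))\<^sup>2 + (b * norm (im_vec v))\<^sup>2"
    by (intro add_mono power_mono assms) auto
  also have "\<dots> = (b * norm v)\<^sup>2"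
    by (simp add: power_mult_distrib norm_sq_re_im[of v] algebra_simps)
  finally show "(norm (complexify f v))\<^sup>2 \<le> (b * norm v)\<^sup>2" .
qed (use assms in auto)

lemma complexify_matrix:
  "(\<chi> i j. complex_of_real (M $ i $ j)) *v v = complexify ((*v) M) v"
  by (simp add: vec_eq_iff complexify_def cvec_def matrix_vector_mult_def re_vec_def im_vec_def
      complex_eq_iff)

lemma complexify_scale:
  assumes "linear f"
  shows "complexify f (a *s v) = a *s complexify f v"
proof -
  have re: "re_vec (a *s v) = Re a *\<^sub>R re_vec v - Im a *\<^sub>R im_vec v"
    and im: "im_vec (a *s v) = Re a *\<^sub>R im_vec v + Im a *\<^sub>R re_vec v"
    by (simp_all add: vec_eq_iff re_vec_def im_vec_def)
  show ?thesis
    unfolding complexify_def re im linear_diff[OF assms] linear_add[OF assms] linear_cmul[OF assms]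
    by (simp add: vec_eq_iff cvec_def complex_eq_iff)
qed

lemma complexify_add:
  assumes "linear f"
  shows "complexify f (u + v) = complexify f u + complexify f v"
proof -
  have re: "re_vec (u + v) = re_vec u + re_vec v" and im: "im_vec (u + v) = im_vec u + im_vec v"
    by (simp_all add: vec_eq_iff re_vec_def im_vec_def)
  show ?thesis
    unfolding complexify_def re im linear_add[OF assms]
    by (simp add: vec_eq_iff cvec_def complex_eq_iff)
qed

lemma complexify_funpow: "(complexify f ^^ n) v = complexify (f ^^ n) v"
  by (induction n) (auto simp: complexify_def)

lemma eigenvalues_iff:
  "\<mu> \<in> eigenvalues M \<longleftrightarrow> (\<exists>v. v \<noteq> 0 \<and> complexify ((*v) M) v = \<mu> *s v)"
  by (simp add: eigenvalues_def complexify_matrix)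

lemma norm_vec_scale: "norm (a *s (v :: complex ^ 'n)) = cmod a * norm v"
  by (simp add: norm_vec_def L2_set_def norm_mult power_mult_distrib real_sqrt_mult
        flip: sum_distrib_left)

lemma eigenvalue_le_bound:
  assumes "\<mu> \<in> eigenvalues M" "\<And>x. norm (M *v x) \<le> b * norm x" "b \<ge> 0"
  shows "cmod \<mu> \<le> b"
proof -
  obtain v where v: "v \<noteq> 0" "complexify ((*v) M) v = \<mu> *s v"
    using assms(1) by (auto simp: eigenvalues_iff)
  have "cmod \<mu> * norm v = norm (\<mu> *s v)" by (simp add: norm_vec_scale)
  also have "\<dots> \<le> b * norm v"
    using complexify_bound[of "(*v) M" b v] assms v by simp
  finally show ?thesis using v by simp
qed

subsection \<open>Polynomials in an operator\<close>

definition complex_linear :: "(complex ^ 'n \<Rightarrow> complex ^ 'n) \<Rightarrow> bool" where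
  "complex_linear F \<longleftrightarrow> (\<forall>u v. F (u + v) = F u + F v) \<and> (\<forall>a v. F (a *s v) = a *s F v)"

lemma complex_linear_complexify: "linear f \<Longrightarrow> complex_linear (complexify f)"
  by (simp add: complex_linear_def complexify_add complexify_scale)

lemma complex_linear_diff: "complex_linear F \<Longrightarrow> F (u - v) = F u - F v"
  unfolding complex_linear_def by (metis add_diff_cancel diff_add_cancel)

lemma complex_linear_zero: "complex_linear F \<Longrightarrow> F 0 = 0"
  using complex_linear_diff[of F 0 0] by simp

definition shifts :: "(complex ^ 'n \<Rightarrow> complex ^ 'n) \<Rightarrow> complex list \<Rightarrow> complex ^ 'n \<Rightarrow> complex ^ 'n" where
  "shifts F as = fold (\<lambda>a v. F v - a *s v) as"

lemma shifts_simps [simp]: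
  "shifts F [] v = v" "shifts F (a # as) v = shifts F as (F v - a *s v)"
  by (simp_all add: shifts_def)

definition op_poly :: "(complex ^ 'n \<Rightarrow> complex ^ 'n) \<Rightarrow> complex poly \<Rightarrow> complex ^ 'n \<Rightarrow> complex ^ 'n" where
  "op_poly F p v = (\<Sum>i\<le>degree p. coeff p i *s (F ^^ i) v)"

lemma op_poly_bound:
  assumes "degree p \<le> N"
  shows "op_poly F p v = (\<Sum>i\<le>N. coeff p i *s (F ^^ i) v)"
  unfolding op_poly_def
  by (rule sum.mono_neutral_left) (use assms in \<open>auto simp: coeff_eq_0\<close>)

lemma op_poly_root_factor:
  assumes "complex_linear F"
  shows "op_poly F ([:-a, 1:] * q) v = op_poly F q (F v - a *s v)"
proof -
  let ?N = "degree q"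
  have pow_diff: "(F ^^ i) (u - w) = (F ^^ i) u - (F ^^ i) w" for i u w
    by (induction i) (auto simp: complex_linear_diff[OF assms])
  have pow_scale: "(F ^^ i) (c *s w) = c *s (F ^^ i) w" for i c w
    using assms by (induction i) (auto simp: complex_linear_def)
  have "degree ([:-a, 1:] * q) \<le> Suc ?N"
    using degree_mult_le[of "[:-a, 1:]" q] by simp
  then have "op_poly F ([:-a, 1:] * q) v = (\<Sum>i\<le>Suc ?N. coeff ([:-a, 1:] * q) i *s (F ^^ i) v)"
    by (rule op_poly_bound)
  also have "\<dots> = (\<Sum>i\<le>Suc ?N. coeff (pCons 0 q) i *s (F ^^ i) v)
                - (\<Sum>i\<le>Suc ?N. (a * coeff q i) *s (F ^^ i) v)"
    by (simp add: mult_pCons_left sum_subtractf[symmetric] algebra_simps vec.scale_left_diff_distrib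
        del: sum.atMost_Suc)
  also have "(\<Sum>i\<le>Suc ?N. coeff (pCons 0 q) i *s (F ^^ i) v)
           = (\<Sum>i\<le>?N. coeff q i *s (F ^^ i) (F v))"
    by (simp add: sum.atMost_Suc_shift funpow_swap1 del: sum.atMost_Suc)
  also have "(\<Sum>i\<le>Suc ?N. (a * coeff q i) *s (F ^^ i) v) = (\<Sum>i\<le>?N. (a * coeff q i) *s (F ^^ i) v)"
    by (simp add: coeff_eq_0)
  finally show ?thesis
    by (simp add: op_poly_def pow_diff pow_scale sum_subtractf[symmetric]
        vec.scale_right_diff_distrib mult.commute)
qed

lemma op_poly_zero_imp_shifts_zero:
  assumes "complex_linear F" "p \<noteq> 0"
  obtains as where "length as = degree p" "\<And>v. op_poly F p v = 0 \<Longrightarrow> shifts F as v = 0"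
proof -
  have "\<exists>as. length as = degree p \<and> (\<forall>v. op_poly F p v = 0 \<longrightarrow> shifts F as v = 0)"
    using assms(2)
  proof (induction "degree p" arbitrary: p)
    case 0
    then obtain c where "p = [:c:]" "c \<noteq> 0" by (metis degree_eq_zeroE pCons_0_0)
    then show ?case by (auto simp: op_poly_def)
  next
    case (Suc n)
    then have "\<not> constant (poly p)" by (simp add: constant_degree)
    then obtain a where "poly p a = 0" using fundamental_theorem_of_algebra by blast
    then obtain q where q: "p = [:-a, 1:] * q" by (auto simp: poly_eq_0_iff_dvd)
    then have "q \<noteq> 0" using Suc by auto
    have "degree ([:-a, 1:] * q) = degree [:-a, 1:] + degree q"
      using \<open>q \<noteq> 0\<close> by (intro degree_mult_eq) auto
    then have "degree q = n" using Suc(2) q by simp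
    with Suc(1)[of q] \<open>q \<noteq> 0\<close> obtain as where
      as: "length as = degree q" "\<forall>v. op_poly F q v = 0 \<longrightarrow> shifts F as v = 0" by auto
    show ?case
      by (rule exI[of _ "a # as"])
        (use as \<open>degree q = n\<close> Suc(2) in \<open>auto simp: q op_poly_root_factor[OF assms(1)] simp del: mult_pCons_left\<close>)
  qed
  then show thesis using that by blast
qed

lemma shifts_commute:
  assumes "complex_linear F"
  shows "shifts F as (F v - a *s v) = F (shifts F as v) - a *s shifts F as v"
proof (induction as arbitrary: v)
  case (Cons b as)
  have "F (F v - a *s v) - b *s (F v - a *s v) = F (F v - b *s v) - a *s (F v - b *s v)"
    using assms
    by (simp add: complex_linear_diff complex_linear_def vec.scale_right_diff_distrib algebra_simps)
  then show ?case by (simp only: shifts_simps Cons flip: Cons)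
qed simp

text \<open>A factor \<open>F - a\<close> with \<open>a\<close> not an eigenvalue is injective and can be cancelled.\<close>

lemma shifts_zero_filter:
  assumes "complex_linear F" "shifts F as v = 0"
    and inj: "\<And>a w. a \<notin> E \<Longrightarrow> F w = a *s w \<Longrightarrow> w = 0"
  shows "shifts F (filter (\<lambda>a. a \<in> E) as) v = 0"
  using assms(2)
proof (induction as arbitrary: v)
  case (Cons a as)
  show ?case
  proof (cases "a \<in> E")
    case False
    have "shifts F (filter (\<lambda>a. a \<in> E) as) (F v - a *s v) = 0" using Cons by auto
    then show ?thesis using inj[OF False] False by (simp add: shifts_commute[OF assms(1)])
  qed (use Cons in auto)
qed simp

text \<open>
  Dependence is stated for an indexed family, not for the set of its values, because powers of a matrix
  may coincide.
\<close>

lemma linear_dependent_sequence: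
  fixes y :: "nat \<Rightarrow> 'b :: euclidean_space"
  obtains c :: "nat \<Rightarrow> real" and k where
    "k \<le> DIM('b)" "c k \<noteq> 0" "(\<Sum>i\<le>DIM('b). c i *\<^sub>R y i) = 0"
proof (cases "inj_on y {..DIM('b)}")
  case True
  have "card (y ` {..DIM('b)}) > DIM('b)" by (simp add: card_image[OF True])
  then have "dependent (y ` {..DIM('b)})" by (intro dependent_biggerset) auto
  then obtain u v where u: "v \<in> y ` {..DIM('b)}" "u v \<noteq> 0" "(\<Sum>v\<in>y ` {..DIM('b)}. u v *\<^sub>R v) = 0"
    by (auto simp: dependent_finite)
  then obtain k where "k \<le> DIM('b)" "v = y k" by auto
  with u that[of k "\<lambda>i. u (y i)"] show thesis by (simp add: sum.reindex[OF True])
next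
  case False
  then obtain i j where ij: "i \<le> DIM('b)" "j \<le> DIM('b)" "i \<noteq> j" "y i = y j"
    by (auto simp: inj_on_def)
  let ?c = "\<lambda>k. if k = i then 1 else if k = j then -1 else (0::real)"
  have "(\<Sum>k\<le>DIM('b). ?c k *\<^sub>R y k) = (\<Sum>k\<in>{i, j}. ?c k *\<^sub>R y k)"
    by (rule sum.mono_neutral_right) (use ij in auto)
  also have "\<dots> = 0" using ij by simp
  finally show thesis using that[of i ?c] ij by auto
qed

text \<open>
  The powers \<open>M\<^sup>0, \<dots>, M\<^sup>D\<close> of a matrix are linearly dependent for dimension reasons, so some nonzero
  polynomial annihilates \<open>M\<close>. Splitting it over the complex numbers and cancelling the factors that
  are injective leaves a product over eigenvalues only, whose length has a bound that does not depend
  on \<open>M\<close>. The list takes the place of the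
  characteristic polynomial in the Cayley--Hamilton theorem.
\<close>

lemma annihilating_eigenvalue_list:
  fixes M :: "real ^ 'n ^ 'n"
  obtains as where "length as \<le> DIM(real ^ 'n ^ 'n)" "set as = eigenvalues M"
    "\<And>v. shifts (complexify ((*v) M)) as v = 0"
proof -
  let ?D = "DIM(real ^ 'n ^ 'n)" and ?F = "complexify ((*v) M)"
  define y where "y i = matrix ((*v) M ^^ i)" for i
  have lin: "linear ((*v) M ^^ i)" for i
    proof (induction i)
    case (Suc i)
    from linear_compose[OF Suc matrix_vector_mul_linear, of M] show ?case by (simp add: o_def)
  qed (simp add: linear_iff)
  have y: "y i *v x = ((*v) M ^^ i) x" for i x
    unfolding y_def matrix_vector_mul(2)[OF lin] ..
  have complex_linear: "complex_linear ?F" by (intro complex_linear_complexify matrix_vector_mul_linear)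
  obtain c k where c: "k \<le> ?D" "c k \<noteq> 0" "(\<Sum>i\<le>?D. c i *\<^sub>R y i) = 0"
    by (rule linear_dependent_sequence[of y])
  have zero: "(\<Sum>i\<le>?D. c i *\<^sub>R ((*v) M ^^ i) x) = 0" for x
  proof -
    have "(\<Sum>i\<le>?D. c i *\<^sub>R ((*v) M ^^ i) x) = (\<Sum>i\<le>?D. (c i *\<^sub>R y i) *v x)"
      by (simp only: scaleR_matrix_vector_assoc[symmetric] y)
    also have "\<dots> = (\<Sum>i\<le>?D. c i *\<^sub>R y i) *v x"
    proof -
      have "(\<Sum>i\<le>n. (c i *\<^sub>R y i) *v x) = (\<Sum>i\<le>n. c i *\<^sub>R y i) *v x" for n
        by (induction n) (auto simp: matrix_vector_mult_add_rdistrib)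
      then show ?thesis .
    qed
    finally show ?thesis by (simp only: c) simp
  qed
  define p where "p = (\<Sum>i\<le>?D. monom (complex_of_real (c i)) i)"
  have coeff_p: "coeff p i = (if i \<le> ?D then complex_of_real (c i) else 0)" for i
    by (auto simp: p_def coeff_sum if_distrib cong: if_cong)
  have "p \<noteq> 0" using c coeff_p[of k] by (metis coeff_0 of_real_eq_0_iff)
  have deg: "degree p \<le> ?D" by (rule degree_le) (simp add: coeff_p)
  have op0: "op_poly ?F p v = 0" for v
  proof -
    have "op_poly ?F p v = (\<Sum>i\<le>?D. complex_of_real (c i) *s cvec (((*v) M ^^ i) (re_vec v)) (((*v) M ^^ i) (im_vec v)))"
      by (simp add: op_poly_bound[OF deg] coeff_p complexify_funpow complexify_def)
    also have "\<dots> = cvec (\<Sum>i\<le>?D. c i *\<^sub>R ((*v) M ^^ i) (re_vec v)) (\<Sum>i\<le>?D. c i *\<^sub>R ((*v) M ^^ i) (im_vec v))"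
      by (simp add: vec_eq_iff cvec_def complex_eq_iff sum_component del: sum.atMost_Suc)
    also have "\<dots> = 0" unfolding zero by (simp add: vec_eq_iff cvec_def complex_eq_iff)
    finally show ?thesis .
  qed
  obtain as where as: "length as = degree p" "\<And>v. shifts ?F as v = 0"
    using op_poly_zero_imp_shifts_zero[OF complex_linear \<open>p \<noteq> 0\<close>] op0 by metis
  have inj: "a \<notin> eigenvalues M \<Longrightarrow> ?F w = a *s w \<Longrightarrow> w = 0" for a w
    by (auto simp: eigenvalues_iff)
  let ?as = "filter (\<lambda>a. a \<in> eigenvalues M) as"
  have ann: "shifts ?F ?as v = 0" for v
    by (rule shifts_zero_filter[OF complex_linear as(2) inj])
  have "\<mu> \<in> set ?as" if "\<mu> \<in> eigenvalues M" for \<mu>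
  proof -
    obtain v where v: "v \<noteq> 0" "?F v = \<mu> *s v" using \<open>\<mu> \<in> eigenvalues M\<close> by (auto simp: eigenvalues_iff)
    have "shifts ?F bs (b *s v) = 0 \<Longrightarrow> b \<noteq> 0 \<Longrightarrow> \<mu> \<in> set bs" for bs b
    proof (induction bs arbitrary: b)
      case (Cons d bs)
      have "?F (b *s v) - d *s (b *s v) = (b * (\<mu> - d)) *s v"
        using v complex_linear by (simp add: complex_linear_def vec.scale_left_diff_distrib algebra_simps)
      with Cons.prems Cons.IH[of "b * (\<mu> - d)"] show ?case by auto
    qed (use v in auto)
    from this[of ?as 1] ann show ?thesis by simp
  qed
  moreover have "length ?as \<le> ?D" using as(1) deg by (metis length_filter_le le_trans)
  ultimately show thesis using that[of ?as] ann by auto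
qed

lemma finite_eigenvalues: "finite (eigenvalues M)"
  by (metis annihilating_eigenvalue_list List.finite_set)

lemma eigenvalues_nonempty: "eigenvalues (M :: real ^ 'n ^ 'n) \<noteq> {}"
proof
  assume "eigenvalues M = {}"
  then obtain as where "set as = {}" "\<And>v. shifts (complexify ((*v) M)) as v = 0"
    by (metis annihilating_eigenvalue_list)
  then have "(1 :: complex ^ 'n) = 0" by (metis shifts_simps(1) set_empty)
  then show False by (simp add: vec_eq_iff)
qed

lemma spectral_radius_ge: "\<mu> \<in> eigenvalues M \<Longrightarrow> cmod \<mu> \<le> spectral_radius M"
  by (simp add: spectral_radius_def finite_eigenvalues)

lemma spectral_abscissa_ge: "\<mu> \<in> eigenvalues M \<Longrightarrow> Re \<mu> \<le> spectral_abscissa M"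
  by (simp add: spectral_abscissa_def finite_eigenvalues)

lemma spectral_radius_attained: obtains \<mu> where "\<mu> \<in> eigenvalues M" "cmod \<mu> = spectral_radius M"
proof -
  have "spectral_radius M \<in> cmod ` eigenvalues M"
    unfolding spectral_radius_def by (intro Max_in) (simp_all add: finite_eigenvalues eigenvalues_nonempty)
  then show thesis using that by auto
qed

lemma spectral_abscissa_attained: obtains \<mu> where "\<mu> \<in> eigenvalues M" "Re \<mu> = spectral_abscissa M"
proof -
  have "spectral_abscissa M \<in> Re ` eigenvalues M"
    unfolding spectral_abscissa_def by (intro Max_in) (simp_all add: finite_eigenvalues eigenvalues_nonempty)
  then show thesis using that by auto
qed

section \<open>Uniform growth of powers\<close>

text \<open>
  Induction on the annihilating list: if \<open>w = F v - a v\<close> already has controlled powers, then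
  \<open>F\<^sup>n\<^sup>+\<^sup>1 v = a F\<^sup>n v + F\<^sup>n w\<close> is a scalar recursion with \<open>\<bar>a\<bar> \<le> r < s\<close>.
\<close>

lemma shifts_zero_power_bound:
  assumes "complex_linear F" and b: "\<And>v. norm (F v) \<le> b * norm v" and "0 \<le> b" "0 \<le> r" "r < s"
  shows "shifts F as v = 0 \<Longrightarrow> (\<forall>a\<in>set as. cmod a \<le> r) \<Longrightarrow>
    norm ((F ^^ n) v) \<le> (((\<lambda>C. 1 + C * (b + r) / (s - r)) ^^ length as) 0) * s ^ n * norm v"
proof (induction as arbitrary: v n)
  case Nil
  have "(F ^^ n) 0 = 0" by (induction n) (auto simp: complex_linear_zero[OF assms(1)])
  with Nil show ?case by simp
next
  case (Cons a as)
  define C where "C = ((\<lambda>C. 1 + C * (b + r) / (s - r)) ^^ length as) 0"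
  have "C \<ge> 0" unfolding C_def using assms by (induction as) auto
  define C' where "C' = 1 + C * (b + r) / (s - r)"
  have C': "r * C' + C * (b + r) \<le> s * C'"
  proof -
    have "(s - r) * C' = (s - r) + C * (b + r)" using assms by (simp add: C'_def field_simps)
    then show ?thesis using assms by (simp add: algebra_simps)
  qed
  have "C' \<ge> 1" using assms \<open>C \<ge> 0\<close> by (simp add: C'_def)
  define w where "w = F v - a *s v"
  have a: "cmod a \<le> r" using Cons by simp
  have w: "norm w \<le> (b + r) * norm v"
  proof -
    have "norm w \<le> norm (F v) + cmod a * norm v"
      unfolding w_def using norm_triangle_ineq4[of "F v" "a *s v"] by (simp add: norm_vec_scale)
    also have "\<dots> \<le> b * norm v + r * norm v" by (intro add_mono b mult_right_mono a) auto
    finally show ?thesis by (simp add: algebra_simps)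
  qed
  have IH: "norm ((F ^^ n) w) \<le> C * s ^ n * norm w" for n
    unfolding C_def by (rule Cons.IH) (use Cons.prems in \<open>auto simp: w_def\<close>)
  have "norm ((F ^^ n) v) \<le> C' * s ^ n * norm v" for n
  proof (induction n)
    case 0
    show ?case using \<open>C' \<ge> 1\<close> mult_right_mono[of 1 C' "norm v"] by simp
  next
    case (Suc n)
    have pow: "(F ^^ n) (u + a *s x) = (F ^^ n) u + a *s (F ^^ n) x" for u x
      using assms(1) by (induction n) (auto simp: complex_linear_def)
    have "(F ^^ Suc n) v = (F ^^ n) (w + a *s v)" by (simp add: w_def funpow_swap1)
    also have "norm \<dots> \<le> norm ((F ^^ n) w) + cmod a * norm ((F ^^ n) v)"
      unfolding pow by (metis norm_triangle_ineq norm_vec_scale)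
    also have "\<dots> \<le> C * s ^ n * ((b + r) * norm v) + r * (C' * s ^ n * norm v)"
      by (intro add_mono order_trans[OF IH] mult_mono mult_left_mono a w Suc)
        (use \<open>C \<ge> 0\<close> assms in auto)
    also have "\<dots> = (r * C' + C * (b + r)) * (s ^ n * norm v)" by (simp add: algebra_simps)
    also have "\<dots> \<le> s * C' * (s ^ n * norm v)"
      by (rule mult_right_mono[OF C']) (use assms in auto)
    finally show ?case by (simp add: algebra_simps)
  qed
  then show ?case by (simp add: C'_def C_def)
qed

text \<open>
  The constant of the previous bound depends on the matrix only through the length of the list, which
  is bounded in terms of the dimension.
\<close>

lemma uniform_power_bound:
  assumes "0 \<le> b" "0 \<le> r" "r < s"
  obtains C where "C \<ge> 0" "\<And>(M :: real ^ 'n ^ 'n) n x.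
     \<lbrakk>\<And>x. norm (M *v x) \<le> b * norm x; \<And>\<mu>. \<mu> \<in> eigenvalues M \<Longrightarrow> cmod \<mu> \<le> r\<rbrakk>
     \<Longrightarrow> norm (((*v) M ^^ n) x) \<le> C * s ^ n * norm x"
proof -
  define C where "C k = ((\<lambda>C. 1 + C * (b + r) / (s - r)) ^^ k) 0" for k
  have C0: "C k \<ge> 0" for k unfolding C_def using assms by (induction k) auto
  define C1 where "C1 = Max (C ` {..DIM(real ^ 'n ^ 'n)})"
  have C1: "k \<le> DIM(real ^ 'n ^ 'n) \<Longrightarrow> C k \<le> C1" for k
    unfolding C1_def by (intro Max_ge) auto
  show thesis
  proof (rule that[of C1])
    show "C1 \<ge> 0" using C1[of 0] C0[of 0] by simp
    fix M :: "real ^ 'n ^ 'n" and n x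
    assume M: "\<And>x. norm (M *v x) \<le> b * norm x" and ev: "\<And>\<mu>. \<mu> \<in> eigenvalues M \<Longrightarrow> cmod \<mu> \<le> r"
    let ?F = "complexify ((*v) M)"
    obtain as where as: "length as \<le> DIM(real ^ 'n ^ 'n)" "set as = eigenvalues M"
      "\<And>v. shifts ?F as v = 0" using annihilating_eigenvalue_list[of M] by metis
    have "norm ((?F ^^ n) (cvec x 0)) \<le> C (length as) * s ^ n * norm (cvec x 0)"
      unfolding C_def
    proof (rule shifts_zero_power_bound)
      show "complex_linear ?F" by (intro complex_linear_complexify matrix_vector_mul_linear)
      show "norm (?F v) \<le> b * norm v" for v by (rule complexify_bound[OF M \<open>0 \<le> b\<close>])
    qed (use as assms ev in auto)
    moreover have "((*v) M ^^ n) 0 = 0" by (induction n) auto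
    then have "(?F ^^ n) (cvec x 0) = cvec (((*v) M ^^ n) x) 0"
      by (simp add: complexify_funpow complexify_def)
    ultimately have "norm (((*v) M ^^ n) x) \<le> C (length as) * (s ^ n * norm x)" by (simp add: mult.assoc)
    also have "\<dots> \<le> C1 * (s ^ n * norm x)"
      by (intro mult_right_mono C1 as) (use assms in auto)
    finally show "norm (((*v) M ^^ n) x) \<le> C1 * s ^ n * norm x" by (simp add: mult.assoc)
  qed
qed

text \<open>On an eigenvector the powers act by \<open>\<mu>\<^sup>n\<close>, which must tend to zero.\<close>

lemma stable_imp_eigenvalues_le_1:
  assumes stable: "\<And>x. (\<lambda>n. ((*v) M ^^ n) x) \<longlonglongrightarrow> 0" and "\<mu> \<in> eigenvalues M"
  shows "cmod \<mu> \<le> 1"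
proof (rule ccontr)
  assume "\<not> cmod \<mu> \<le> 1"
  obtain v where v: "v \<noteq> 0" "complexify ((*v) M) v = \<mu> *s v"
    using assms(2) by (auto simp: eigenvalues_iff)
  have eq: "(norm (((*v) M ^^ n) (re_vec v)))\<^sup>2 + (norm (((*v) M ^^ n) (im_vec v)))\<^sup>2
      = (cmod \<mu> ^ n * norm v)\<^sup>2" for n
  proof -
    have "(complexify ((*v) M) ^^ n) v = (\<mu> ^ n) *s v"
      by (induction n) (auto simp: v complexify_scale matrix_vector_mul_linear mult.commute)
    then show ?thesis
      unfolding complexify_funpow complexify_def
      by (metis norm_cvec_sq norm_vec_scale norm_power)
  qed
  have "(\<lambda>n. (norm (((*v) M ^^ n) (re_vec v)))\<^sup>2 + (norm (((*v) M ^^ n) (im_vec v)))\<^sup>2) \<longlonglongrightarrow> 0\<^sup>2 + 0\<^sup>2"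
    by (intro tendsto_intros tendsto_norm_zero stable)
  then have "(\<lambda>n. (cmod \<mu> ^ n * norm v)\<^sup>2) \<longlonglongrightarrow> 0" unfolding eq by simp
  then have "eventually (\<lambda>n. (cmod \<mu> ^ n * norm v)\<^sup>2 < (norm v)\<^sup>2) sequentially"
    by (rule order_tendstoD(2)) (use v in auto)
  then obtain n where "(cmod \<mu> ^ n * norm v)\<^sup>2 < (norm v)\<^sup>2"
    by (auto simp: eventually_sequentially)
  moreover have "norm v \<le> cmod \<mu> ^ n * norm v"
    using one_le_power[of "cmod \<mu>" n] \<open>\<not> cmod \<mu> \<le> 1\<close> mult_right_mono[of 1 "cmod \<mu> ^ n" "norm v"] by simp
  ultimately show False by (meson norm_ge_zero not_less power_mono)
qed

section \<open>The matrix exponential and its uniform growth\<close>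

text \<open>
  A copy of the bounded operators in which multiplication is composition, so that the exponential
  function of Banach algebras becomes the matrix exponential.
\<close>

typedef (overloaded) ('a :: euclidean_space) endo = "UNIV :: ('a \<Rightarrow>\<^sub>L 'a) set"
  morphisms blinfun_of_endo Endo by simp

setup_lifting type_definition_endo

instantiation endo :: (euclidean_space) real_normed_algebra_1
begin

lift_definition zero_endo :: "'a endo" is 0 .
lift_definition one_endo :: "'a endo" is id_blinfun .
lift_definition plus_endo :: "'a endo \<Rightarrow> 'a endo \<Rightarrow> 'a endo" is "(+)" .
lift_definition minus_endo :: "'a endo \<Rightarrow> 'a endo \<Rightarrow> 'a endo" is "(-)" .
lift_definition uminus_endo :: "'a endo \<Rightarrow> 'a endo" is uminus .
lift_definition times_endo :: "'a endo \<Rightarrow> 'a endo \<Rightarrow> 'a endo" is "(o\<^sub>L)" .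
lift_definition scaleR_endo :: "real \<Rightarrow> 'a endo \<Rightarrow> 'a endo" is scaleR .
lift_definition norm_endo :: "'a endo \<Rightarrow> real" is norm .

definition dist_endo :: "'a endo \<Rightarrow> 'a endo \<Rightarrow> real" where
  "dist_endo a b = norm (a - b)"
definition uniformity_endo :: "('a endo \<times> 'a endo) filter" where
  "uniformity_endo = (INF e\<in>{0 <..}. principal {(x, y). dist x y < e})"
definition open_endo :: "'a endo set \<Rightarrow> bool" where
  "open_endo S = (\<forall>x\<in>S. \<forall>\<^sub>F (x', y) in uniformity. x' = x \<longrightarrow> y \<in> S)"
definition sgn_endo :: "'a endo \<Rightarrow> 'a endo" where
  "sgn_endo x = scaleR (inverse (norm x)) x"

instance
proof
  show "dist x y = norm (x - y)" for x y :: "'a endo" by (rule dist_endo_def)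
  show "sgn x = scaleR (inverse (norm x)) x" for x :: "'a endo" by (rule sgn_endo_def)
  show "(uniformity :: ('a endo \<times> 'a endo) filter) = (INF e\<in>{0 <..}. principal {(x, y). dist x y < e})"
    by (rule uniformity_endo_def)
  show "open U = (\<forall>x\<in>U. \<forall>\<^sub>F (x', y) in uniformity. x' = x \<longrightarrow> y \<in> U)" for U :: "'a endo set"
    by (rule open_endo_def)
  show "(0 :: 'a endo) \<noteq> 1"
    by transfer (metis norm_blinfun_id norm_zero zero_neq_one)
  show "norm (1 :: 'a endo) = 1"
    by transfer (rule norm_blinfun_id)
  show "norm (x * y) \<le> norm x * norm y" for x y :: "'a endo"
    by transfer (rule norm_blinfun_compose)
  show "norm (x + y) \<le> norm x + norm y" for x y :: "'a endo"
    by transfer (rule norm_triangle_ineq)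
qed (transfer; (rule blinfun_eqI)?; simp add: blinfun.bilinear_simps algebra_simps)+

end

instance endo :: (euclidean_space) banach
proof
  fix X :: "nat \<Rightarrow> 'a endo"
  have dist_eq: "dist (Endo f) (Endo g) = dist f g" for f g :: "'a \<Rightarrow>\<^sub>L 'a"
    unfolding dist_norm by (metis Endo_inverse UNIV_I minus_endo.abs_eq norm_endo.abs_eq)
  have X: "Endo (blinfun_of_endo (X n)) = X n" for n by (rule blinfun_of_endo_inverse)
  assume "Cauchy X"
  then have "Cauchy (\<lambda>n. blinfun_of_endo (X n))"
    unfolding Cauchy_def by (metis X dist_eq)
  then obtain L where "(\<lambda>n. blinfun_of_endo (X n)) \<longlonglongrightarrow> L"
    using Cauchy_convergent convergent_def by blast
  then have "X \<longlonglongrightarrow> Endo L"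
    unfolding lim_sequentially by (metis X dist_eq)
  then show "convergent X" by (rule convergentI)
qed

lift_definition endo_app :: "'a::euclidean_space endo \<Rightarrow> 'a \<Rightarrow> 'a" is blinfun_apply .

lemma bounded_bilinear_endo_app: "bounded_bilinear endo_app"
proof
  show "\<exists>K. \<forall>a b :: 'a. norm (endo_app a b) \<le> norm a * norm b * K"
    by (rule exI[of _ 1]) (transfer, simp add: norm_blinfun)
qed (transfer, simp add: blinfun.bilinear_simps)+

interpretation endo_app: bounded_bilinear endo_app by (rule bounded_bilinear_endo_app)

lemma endo_app_times: "endo_app (A * B) x = endo_app A (endo_app B x)"
  by transfer simp

lemma endo_app_one [simp]: "endo_app 1 x = x"
  by transfer simp

lemma norm_endo_app: "norm (endo_app A x) \<le> norm A * norm x"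
  by transfer (rule norm_blinfun)

definition endo_of_matrix :: "real ^ 'n ^ 'n \<Rightarrow> (real ^ 'n) endo" where
  "endo_of_matrix Z = Endo (Blinfun ((*v) Z))"

lemma endo_app_matrix [simp]: "endo_app (endo_of_matrix Z) x = Z *v x"
  by (simp add: endo_of_matrix_def endo_app.abs_eq bounded_linear_Blinfun_apply
      matrix_vector_mul_bounded_linear)

lemma norm_endo_of_matrix_le:
  assumes "\<And>x. norm (Z *v x) \<le> b * norm x" "0 \<le> b"
  shows "norm (endo_of_matrix Z) \<le> b"
  unfolding endo_of_matrix_def norm_endo.abs_eq
  by (rule norm_blinfun_bound)
    (use assms in \<open>auto simp: bounded_linear_Blinfun_apply matrix_vector_mul_bounded_linear\<close>)

definition mexp :: "real ^ 'n ^ 'n \<Rightarrow> real \<Rightarrow> real ^ 'n \<Rightarrow> real ^ 'n" where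
  "mexp Z s = endo_app (exp (s *\<^sub>R endo_of_matrix Z))"

lemma linear_mexp: "linear (mexp Z s)"
  unfolding mexp_def using endo_app.bounded_linear_right bounded_linear.linear by blast

lemma mexp_0 [simp]: "mexp Z 0 x = x"
  by (simp add: mexp_def)

lemma mexp_add: "mexp Z (s + t) x = mexp Z s (mexp Z t x)"
proof -
  have "exp (s *\<^sub>R A + t *\<^sub>R A) = exp (s *\<^sub>R A) * exp (t *\<^sub>R A)" for A :: "(real ^ 'n) endo"
    by (rule exp_add_commuting) simp
  from this[of "endo_of_matrix Z"] show ?thesis
    by (simp only: mexp_def scaleR_add_left endo_app_times)
qed

lemma mexp_minus [simp]: "mexp Z (-s) (mexp Z s x) = x"
  by (simp flip: mexp_add)

lemma mexp_commute: "mexp Z s (Z *v x) = Z *v mexp Z s x"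
  using exp_times_scaleR_commute[of s "endo_of_matrix Z"]
  by (metis endo_app_matrix endo_app_times mexp_def)

lemma mexp_has_vector_derivative:
  "((\<lambda>t. mexp Z t x) has_vector_derivative Z *v mexp Z t x) (at t within S)"
  unfolding mexp_def
  using bounded_linear.has_vector_derivative[OF endo_app.bounded_linear_left
      has_vector_derivative_at_within[OF exp_scaleR_has_vector_derivative_left[of "endo_of_matrix Z" t]], of x S]
  by (simp add: endo_app_times)

lemma norm_mexp_le:
  assumes "\<And>x. norm (Z *v x) \<le> b * norm x" "0 \<le> b"
  shows "norm (mexp Z s x) \<le> exp (b * \<bar>s\<bar>) * norm x"
proof -
  have "norm (exp (s *\<^sub>R endo_of_matrix Z)) \<le> exp (norm (s *\<^sub>R endo_of_matrix Z))"
    by (rule norm_exp)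
  also have "\<dots> \<le> exp (b * \<bar>s\<bar>)"
    using mult_left_mono[OF norm_endo_of_matrix_le[OF assms], of "\<bar>s\<bar>"] by (simp add: mult.commute)
  finally show ?thesis
    unfolding mexp_def
    by (meson norm_endo_app order_trans mult_right_mono norm_ge_zero)
qed

text \<open>
  Along a solution \<open>x\<close> of \<open>x' = Z x\<close> the vector \<open>exp (-(t - a) Z) (x t)\<close> has derivative zero.
\<close>

lemma linear_ode_unique:
  assumes "convex I" "a \<in> I" "t \<in> I"
    and deriv: "\<And>s. s \<in> I \<Longrightarrow> (x has_vector_derivative Z *v x s) (at s within I)"
  shows "x t = mexp Z (t - a) (x a)"
proof -
  let ?A = "endo_of_matrix Z"
  define y where "y s = mexp Z (- (s - a)) (x s)" for s
  have "(y has_vector_derivative 0) (at s within I)" if "s \<in> I" for s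
  proof -
    have "((\<lambda>s. exp ((a - s) *\<^sub>R ?A)) has_vector_derivative ((-1) *\<^sub>R (?A * exp ((a - s) *\<^sub>R ?A)))) (at s within I)"
      by (rule vector_diff_chain_within[where f = "\<lambda>s. a - s" and g = "\<lambda>r. exp (r *\<^sub>R ?A)", unfolded o_def])
        (auto intro!: derivative_eq_intros
            has_vector_derivative_at_within[OF exp_scaleR_has_vector_derivative_left])
    from endo_app.has_vector_derivative[OF this deriv[OF that]]
    have "(y has_vector_derivative
        endo_app (exp ((a - s) *\<^sub>R ?A)) (Z *v x s) + endo_app ((-1) *\<^sub>R (?A * exp ((a - s) *\<^sub>R ?A))) (x s)) (at s within I)"
      by (simp add: y_def[abs_def] mexp_def)
    moreover have "endo_app (exp ((a - s) *\<^sub>R ?A)) (Z *v x s) = Z *v endo_app (exp ((a - s) *\<^sub>R ?A)) (x s)"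
      using mexp_commute[of Z "a - s" "x s"] by (simp add: mexp_def)
    moreover have "endo_app ((-1) *\<^sub>R (?A * exp ((a - s) *\<^sub>R ?A))) (x s) = - (Z *v endo_app (exp ((a - s) *\<^sub>R ?A)) (x s))"
      by (simp add: endo_app.minus_left endo_app_times)
    ultimately show ?thesis by simp
  qed
  then obtain c where "\<And>s. s \<in> I \<Longrightarrow> y s = c"
    using has_vector_derivative_zero_constant[OF assms(1)] by blast
  then have "y t = y a" using assms by metis
  then have "mexp Z (- (t - a)) (x t) = x a" by (simp add: y_def)
  then have "mexp Z (t - a) (x a) = mexp Z (t - a) (mexp Z (- (t - a)) (x t))" by simp
  also have "\<dots> = x t" by (simp flip: mexp_add)
  finally show ?thesis ..
qed

lemma bounded_linear_cvec_left: "bounded_linear (\<lambda>p. cvec p 0)"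
  and bounded_linear_cvec_right: "bounded_linear (\<lambda>q. cvec 0 q)"
  by (auto intro!: linearI simp: cvec_def vec_eq_iff complex_eq_iff simp flip: linear_conv_bounded_linear)

lemma cvec_add: "cvec p q = cvec p 0 + cvec 0 q"
  by (simp add: cvec_def vec_eq_iff complex_eq_iff)

lemma complexify_mexp_has_vector_derivative:
  "((\<lambda>t. complexify (mexp Z t) v) has_vector_derivative
     complexify (mexp Z t) (complexify ((*v) Z) v)) (at t within S)"
proof -
  have "((\<lambda>t. cvec (mexp Z t (re_vec v)) 0 + cvec 0 (mexp Z t (im_vec v))) has_vector_derivative
     cvec (Z *v mexp Z t (re_vec v)) 0 + cvec 0 (Z *v mexp Z t (im_vec v))) (at t within S)"
    by (intro has_vector_derivative_add bounded_linear.has_vector_derivative[OF bounded_linear_cvec_left]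
        bounded_linear.has_vector_derivative[OF bounded_linear_cvec_right] mexp_has_vector_derivative)
  then show ?thesis
    by (simp add: complexify_def mexp_commute flip: cvec_add)
qed

text \<open>
  This is variation of constants for \<open>x' = a x + w\<close> in differentiated form, where the factor
  \<open>Z - a\<close> produces the inhomogeneity \<open>w\<close>. If it annihilates \<open>v\<close>, the left-hand side is constant.
\<close>

lemma complexify_mexp_shift_derivative:
  fixes Z :: "real ^ 'n ^ 'n"
  defines "F \<equiv> complexify ((*v) Z)"
  shows "((\<lambda>t. exp (- (of_real t * a)) *s complexify (mexp Z t) v) has_vector_derivative
     exp (- (of_real t * a)) *s complexify (mexp Z t) (F v - a *s v)) (at t within S)"
proof -
  have bil: "bounded_bilinear ((*s) :: complex \<Rightarrow> complex ^ 'n \<Rightarrow> complex ^ 'n)"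
  proof
    show "\<exists>K. \<forall>a (b :: complex ^ 'n). norm (a *s b) \<le> norm a * norm b * K"
      by (rule exI[of _ 1]) (simp add: norm_vec_scale)
  qed (simp_all add: vec_eq_iff algebra_simps)
  have e: "((\<lambda>t. exp (- (of_real t * a))) has_vector_derivative - a * exp (- (of_real t * a))) (at t within S)"
    by (rule has_vector_derivative_real_field) (auto intro!: derivative_eq_intros)
  have "complex_linear (complexify (mexp Z t))" by (intro complex_linear_complexify linear_mexp)
  then have split: "complexify (mexp Z t) (F v - a *s v) = complexify (mexp Z t) (F v) - a *s complexify (mexp Z t) v"
    by (simp add: complex_linear_diff complex_linear_def)
  have eq: "e *s u + (- a * e) *s w = e *s (u - a *s w)" for e and u w :: "complex ^ 'n"
    by (simp add: vec_eq_iff algebra_simps)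
  show ?thesis
    using bounded_bilinear.has_vector_derivative[OF bil e complexify_mexp_has_vector_derivative[of Z v t S]]
    unfolding split unfolding F_def eq .
qed

lemma complexify_mexp_eigenvector:
  assumes "complexify ((*v) Z) v = a *s v"
  shows "complexify (mexp Z t) v = exp (of_real t * a) *s v"
proof -
  have z: "complexify (mexp Z t) (complexify ((*v) Z) v - a *s v) = 0" for t
    unfolding assms diff_self by (rule complex_linear_zero[OF complex_linear_complexify[OF linear_mexp]])
  have "((\<lambda>t. exp (- (of_real t * a)) *s complexify (mexp Z t) v) has_vector_derivative 0) (at t within UNIV)" for t
    using complexify_mexp_shift_derivative[of a Z v t UNIV] unfolding z vec.scale_zero_right .
  from has_vector_derivative_zero_constant[OF convex_UNIV this]
  obtain c where c: "\<And>t. exp (- (of_real t * a)) *s complexify (mexp Z t) v = c"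
    by auto
  have "c = v" using c[of 0] by (simp add: complexify_def)
  have "complexify (mexp Z t) v = exp (of_real t * a) *s (exp (- (of_real t * a)) *s complexify (mexp Z t) v)"
    unfolding vec.scale_scale mult_exp_exp by simp
  then show ?thesis unfolding c \<open>c = v\<close> .
qed

text \<open>
  Continuous counterpart of the bound on powers. Induction on the annihilating list controls the
  flow of \<open>w = Z v - a v\<close>, and integrating the derivative above controls the flow of \<open>v\<close>.
\<close>

lemma shifts_zero_mexp_bound:
  fixes Z :: "real ^ 'n ^ 'n"
  defines "F \<equiv> complexify ((*v) Z)"
  assumes b: "\<And>x. norm (Z *v x) \<le> b * norm x" and "0 \<le> b" "\<alpha> < \<sigma>" "0 \<le> t"
  shows "shifts F as v = 0 \<Longrightarrow> (\<forall>a\<in>set as. Re a \<le> \<alpha> \<and> cmod a \<le> b) \<Longrightarrow>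
    norm (complexify (mexp Z t) v) \<le> (((\<lambda>C. 1 + C * (2 * b) / (\<sigma> - \<alpha>)) ^^ length as) 0) * exp (\<sigma> * t) * norm v"
  using \<open>0 \<le> t\<close>
proof (induction as arbitrary: v t)
  case Nil
  then show ?case using complex_linear_zero[OF complex_linear_complexify[OF linear_mexp[of Z t]]] by simp
next
  case (Cons a as)
  define C where "C = ((\<lambda>C. 1 + C * (2 * b) / (\<sigma> - \<alpha>)) ^^ length as) 0"
  have "C \<ge> 0" unfolding C_def using \<open>0 \<le> b\<close> \<open>\<alpha> < \<sigma>\<close> by (induction as) auto
  have a: "Re a \<le> \<alpha>" "cmod a \<le> b" using Cons by auto
  define w where "w = F v - a *s v"
  have w: "norm w \<le> 2 * b * norm v"
  proof -
    have "norm w \<le> norm (F v) + cmod a * norm v"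
      unfolding w_def using norm_triangle_ineq4[of "F v" "a *s v"] by (simp add: norm_vec_scale)
    also have "\<dots> \<le> b * norm v + b * norm v"
      unfolding F_def by (intro add_mono complexify_bound b \<open>0 \<le> b\<close> mult_right_mono a) auto
    finally show ?thesis by (simp add: algebra_simps)
  qed
  define f where "f t = exp (- (of_real t * a)) *s complexify (mexp Z t) v" for t
  define B where "B = C * (2 * b) * norm v"
  have "B \<ge> 0" using \<open>C \<ge> 0\<close> \<open>0 \<le> b\<close> by (simp add: B_def)
  have ra: "\<sigma> - Re a > 0" using a \<open>\<alpha> < \<sigma>\<close> by simp
  define \<phi> where "\<phi> t = B / (\<sigma> - Re a) * exp ((\<sigma> - Re a) * t)" for t
  have "0 \<le> t" using Cons.prems by simp
  have bound: "norm (f t) \<le> norm v + \<phi> t"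
  proof (cases "t = 0")
    case True
    then show ?thesis using \<open>B \<ge> 0\<close> ra by (simp add: f_def \<phi>_def complexify_def)
  next
    case False
    then have "0 < t" using Cons.prems by simp
    define f' where "f' x = exp (- (of_real x * a)) *s complexify (mexp Z x) w" for x
    have f: "(f has_vector_derivative f' x) (at x within S)" for x S
      unfolding f_def f'_def w_def F_def by (rule complexify_mexp_shift_derivative)
    have "(\<phi> has_real_derivative B * exp ((\<sigma> - Re a) * x)) (at x within S)" for x S
    proof -
      have "((\<lambda>t. exp ((\<sigma> - Re a) * t)) has_real_derivative exp ((\<sigma> - Re a) * x) * (\<sigma> - Re a)) (at x within S)"
        by (auto intro!: derivative_eq_intros)
      moreover have "B / (\<sigma> - Re a) * (exp ((\<sigma> - Re a) * x) * (\<sigma> - Re a)) = B * exp ((\<sigma> - Re a) * x)"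
        using ra by simp
      ultimately show ?thesis
        unfolding \<phi>_def using DERIV_cmult[of "\<lambda>t. exp ((\<sigma> - Re a) * t)" _ x S "B / (\<sigma> - Re a)"] by metis
    qed
    then have \<phi>: "(\<phi> has_vector_derivative B * exp ((\<sigma> - Re a) * x)) (at x within S)" for x S
      by (simp only: has_real_derivative_iff_has_vector_derivative)
    have "norm (f t - f 0) \<le> \<phi> t - \<phi> 0"
    proof (rule differentiable_bound_general[OF \<open>0 < t\<close> _ _ f \<phi>])
      show "continuous_on {0..t} f" "continuous_on {0..t} \<phi>"
        by (rule continuous_on_vector_derivative, rule f, rule continuous_on_vector_derivative, rule \<phi>)
      fix x :: real assume "0 < x"
      have "norm (f' x) = exp (- (x * Re a)) * norm (complexify (mexp Z x) w)"
        by (simp add: f'_def norm_vec_scale)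
      also have "\<dots> \<le> exp (- (x * Re a)) * (C * exp (\<sigma> * x) * norm w)"
        unfolding C_def
        by (intro mult_left_mono Cons.IH) (use Cons.prems \<open>0 < x\<close> in \<open>auto simp: w_def\<close>)
      also have "\<dots> \<le> exp (- (x * Re a)) * (C * exp (\<sigma> * x) * (2 * b * norm v))"
        by (intro mult_left_mono w) (use \<open>C \<ge> 0\<close> in auto)
      also have "\<dots> = B * exp ((\<sigma> - Re a) * x)"
        by (simp add: B_def mult_exp_exp algebra_simps exp_diff exp_minus divide_simps)
      finally show "norm (f' x) \<le> B * exp ((\<sigma> - Re a) * x)" .
    qed
    moreover have "f 0 = v" by (simp add: f_def complexify_def)
    moreover have "\<phi> 0 \<ge> 0" using \<open>B \<ge> 0\<close> ra by (simp add: \<phi>_def)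
    ultimately show ?thesis using norm_triangle_ineq2[of "f t" v] by simp
  qed
  have "norm (complexify (mexp Z t) v) = exp (Re a * t) * norm (f t)"
    by (simp add: f_def norm_vec_scale mult.commute mult_exp_exp)
  also have "\<dots> \<le> exp (Re a * t) * (norm v + \<phi> t)" by (intro mult_left_mono bound) auto
  also have "\<dots> = exp (Re a * t) * norm v + B / (\<sigma> - Re a) * exp (\<sigma> * t)"
    by (simp add: \<phi>_def algebra_simps mult_exp_exp)
  also have "\<dots> \<le> exp (\<sigma> * t) * norm v + B / (\<sigma> - \<alpha>) * exp (\<sigma> * t)"
    by (intro add_mono mult_right_mono divide_left_mono)
      (use a \<open>\<alpha> < \<sigma>\<close> \<open>0 \<le> t\<close> \<open>B \<ge> 0\<close> ra in \<open>auto intro!: mult_right_mono\<close>)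
  also have "\<dots> = (1 + C * (2 * b) / (\<sigma> - \<alpha>)) * exp (\<sigma> * t) * norm v"
    by (simp add: B_def algebra_simps)
  finally show ?case by (simp add: C_def)
qed

lemma uniform_mexp_bound:
  assumes "0 \<le> b" "\<alpha> < \<sigma>"
  obtains C where "C \<ge> 0" "\<And>(Z :: real ^ 'n ^ 'n) t x.
     \<lbrakk>\<And>x. norm (Z *v x) \<le> b * norm x; \<And>a. a \<in> eigenvalues Z \<Longrightarrow> Re a \<le> \<alpha>; 0 \<le> t\<rbrakk>
     \<Longrightarrow> norm (mexp Z t x) \<le> C * exp (\<sigma> * t) * norm x"
proof -
  define C where "C k = ((\<lambda>C. 1 + C * (2 * b) / (\<sigma> - \<alpha>)) ^^ k) 0" for k
  have C0: "C k \<ge> 0" for k unfolding C_def using assms by (induction k) auto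
  define C1 where "C1 = Max (C ` {..DIM(real ^ 'n ^ 'n)})"
  have C1: "k \<le> DIM(real ^ 'n ^ 'n) \<Longrightarrow> C k \<le> C1" for k
    unfolding C1_def by (intro Max_ge) auto
  show thesis
  proof (rule that[of C1])
    show "C1 \<ge> 0" using C1[of 0] C0[of 0] by simp
    fix Z :: "real ^ 'n ^ 'n" and t :: real and x
    assume Z: "\<And>x. norm (Z *v x) \<le> b * norm x" and ev: "\<And>a. a \<in> eigenvalues Z \<Longrightarrow> Re a \<le> \<alpha>"
      and "0 \<le> t"
    obtain as where as: "length as \<le> DIM(real ^ 'n ^ 'n)" "set as = eigenvalues Z"
      "\<And>v. shifts (complexify ((*v) Z)) as v = 0" using annihilating_eigenvalue_list[of Z] by metis
    have "norm (complexify (mexp Z t) (cvec x 0)) \<le> C (length as) * exp (\<sigma> * t) * norm (cvec x 0)"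
      unfolding C_def
      by (rule shifts_zero_mexp_bound[OF Z \<open>0 \<le> b\<close> \<open>\<alpha> < \<sigma>\<close> \<open>0 \<le> t\<close>])
        (use as ev eigenvalue_le_bound[OF _ Z \<open>0 \<le> b\<close>] in auto)
    moreover have "complexify (mexp Z t) (cvec x 0) = cvec (mexp Z t x) 0"
      by (simp add: complexify_def linear_0[OF linear_mexp])
    ultimately have "norm (mexp Z t x) \<le> C (length as) * (exp (\<sigma> * t) * norm x)" by (simp add: mult.assoc)
    also have "\<dots> \<le> C1 * (exp (\<sigma> * t) * norm x)" by (intro mult_right_mono C1 as) auto
    finally show "norm (mexp Z t x) \<le> C1 * exp (\<sigma> * t) * norm x" by (simp add: mult.assoc)
  qed
qed

section \<open>Words of steps with durations\<close>

lemma subspace_orthogonal_projection: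
  fixes X :: "('a :: euclidean_space) set"
  assumes "subspace X"
  obtains P where "linear P" "\<And>x. P x \<in> X" "\<And>x. x \<in> X \<Longrightarrow> P x = x"
    "\<And>x. norm (P x) \<le> norm x" "\<And>x. norm (x - P x) \<le> norm x"
proof -
  obtain B where B: "B \<subseteq> X" "pairwise orthogonal B" "\<And>x. x \<in> B \<Longrightarrow> norm x = 1"
    "independent B" "span B = X"
    using orthonormal_basis_subspace[OF assms] by metis
  have fin: "finite B" using B(4) by (rule independent_imp_finite)
  define P where "P x = (\<Sum>b\<in>B. (b \<bullet> x) *\<^sub>R b)" for x
  have lin: "linear P"
    by (auto intro!: linearI simp: P_def inner_add_right scaleR_add_left sum.distrib scaleR_sum_right)
  have PX: "P x \<in> X" for x
    unfolding P_def using B(1) assms by (auto intro!: subspace_sum subspace_scale)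
  have P_id: "P x = x" if "x \<in> X" for x
    unfolding P_def using orthonormal_basis_expand[OF B(2) B(3) _ fin, of x] that B(5) by (simp add: inner_commute)
  have "(x - P x) \<bullet> b = 0" if "b \<in> B" for x b
  proof -
    have "P x \<bullet> b = (\<Sum>b'\<in>B. (b' \<bullet> x) * (b' \<bullet> b))" by (simp add: P_def inner_sum_left)
    also have "\<dots> = (\<Sum>b'\<in>B. if b' = b then b \<bullet> x else 0)"
    proof (rule sum.cong[OF refl])
      fix b' assume "b' \<in> B"
      show "(b' \<bullet> x) * (b' \<bullet> b) = (if b' = b then b \<bullet> x else 0)"
        using B(2) B(3)[OF that] \<open>b' \<in> B\<close> that
        by (auto simp: pairwise_def orthogonal_def dot_square_norm)
    qed
    also have "\<dots> = x \<bullet> b" using fin that by (simp add: inner_commute)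
    finally show ?thesis by (simp add: inner_diff_left)
  qed
  then have orth: "(x - P x) \<bullet> P x = 0" for x
    by (subst (2) P_def) (simp add: inner_sum_right)
  have pyth: "(norm x)\<^sup>2 = (norm (P x))\<^sup>2 + (norm (x - P x))\<^sup>2" for x
  proof -
    have "x \<bullet> x = (P x + (x - P x)) \<bullet> (P x + (x - P x))" by simp
    also have "\<dots> = P x \<bullet> P x + (x - P x) \<bullet> (x - P x)"
      using orth[of x] by (simp only: inner_add_left inner_add_right inner_commute[of "P x" "x - P x"])
    finally show ?thesis by (simp add: dot_square_norm)
  qed
  have "(norm (P x))\<^sup>2 \<le> (norm x)\<^sup>2" "(norm (x - P x))\<^sup>2 \<le> (norm x)\<^sup>2" for x
    unfolding pyth[of x] by simp_all
  then have "norm (P x) \<le> norm x" "norm (x - P x) \<le> norm x" for x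
    by (auto intro: power2_le_imp_le)
  with that[of P] lin PX P_id show thesis by blast
qed

locale switched_words =
  fixes G :: "'g set" and len :: "'g \<Rightarrow> real" and \<delta> :: real
  assumes len_pos: "g \<in> G \<Longrightarrow> 0 < len g" and \<delta>_pos: "0 < \<delta>"
begin

definition duration :: "'g list \<Rightarrow> real" where
  "duration l = sum_list (map len l)"

lemma duration_simps [simp]:
  "duration [] = 0" "duration (g # l) = len g + duration l" "duration (l @ l') = duration l + duration l'"
  by (simp_all add: duration_def)

lemma duration_nonneg: "l \<in> lists G \<Longrightarrow> 0 \<le> duration l"
proof (induction l)
  case (Cons g l)
  then show ?case using len_pos[of g] by auto
qed simp

definition word_power :: "nat \<Rightarrow> 'g list \<Rightarrow> 'g list" where
  "word_power n l = concat (replicate n l)"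

lemma word_power_simps [simp]:
  "word_power 0 l = []" "word_power (Suc n) l = l @ word_power n l"
  by (simp_all add: word_power_def)

lemma word_power_in: "l \<in> lists G \<Longrightarrow> word_power n l \<in> lists G"
  by (induction n) auto

lemma duration_word_power: "duration (word_power n l) = real n * duration l"
  by (induction n) (auto simp: algebra_simps)

lemma fold_word_power: "fold T (word_power n l) = fold T l ^^ n"
  by (induction n) (auto simp: fun_eq_iff funpow_swap1)

text \<open>
  Stability of a word is expressed by the convergence of its powers, with the rate \<open>\<delta>\<close> to spare,
  and not by eigenvalues, because in this form it passes to invariant subspaces and to quotients.
  The bound on a single step decays with its duration. It makes up for the fact that a long step
  cannot be cut into shorter ones.
\<close>

definition stable_system :: "(real ^ 'n) set \<Rightarrow> ('g \<Rightarrow> real ^ 'n \<Rightarrow> real ^ 'n) \<Rightarrow> bool" where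
  "stable_system W T \<longleftrightarrow>
     subspace W \<and>
     (\<forall>g\<in>G. linear (T g) \<and> T g ` W \<subseteq> W) \<and>
     (\<exists>C\<ge>0. \<forall>g\<in>G. \<forall>x\<in>W. norm (T g x) \<le> C * exp (- \<delta> * len g) * norm x) \<and>
     (\<exists>K\<ge>0. \<exists>c\<ge>0. \<forall>l\<in>lists G. \<forall>x\<in>W. norm (fold T l x) \<le> K * exp (c * duration l) * norm x) \<and>
     (\<forall>l\<in>lists G. l \<noteq> [] \<longrightarrow> (\<forall>x\<in>W.
        (\<lambda>n. exp (\<delta> * (real n * duration l)) *\<^sub>R fold T (word_power n l) x) \<longlonglongrightarrow> 0))"

definition decays :: "(real ^ 'n) set \<Rightarrow> ('g \<Rightarrow> real ^ 'n \<Rightarrow> real ^ 'n) \<Rightarrow> bool" where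
  "decays W T \<longleftrightarrow>
     (\<exists>K\<ge>0. \<exists>\<gamma>>0. \<forall>l\<in>lists G. \<forall>x\<in>W. norm (fold T l x) \<le> K * exp (- \<gamma> * duration l) * norm x)"

lemma fold_in: "stable_system W T \<Longrightarrow> l \<in> lists G \<Longrightarrow> x \<in> W \<Longrightarrow> fold T l x \<in> W"
  by (induction l arbitrary: x) (auto simp: stable_system_def image_subset_iff)

lemma linear_fold_words:
  assumes "\<forall>g\<in>G. linear (T g)" "l \<in> lists G"
  shows "linear (fold T l)"
  using assms(2)
proof (induction l)
  case (Cons g l)
  then show ?case using linear_compose[of "T g" "fold T l"] assms(1) by (simp add: o_def)
qed (simp add: linear_iff)

lemma linear_fold: "stable_system W T \<Longrightarrow> l \<in> lists G \<Longrightarrow> linear (fold T l)"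
  by (rule linear_fold_words) (auto simp: stable_system_def)

lemma stable_system_linear: "stable_system W T \<Longrightarrow> \<forall>g\<in>G. linear (T g)"
  by (simp add: stable_system_def)

lemma stable_systemD:
  assumes "stable_system W T"
  shows "subspace W" "\<And>g. g \<in> G \<Longrightarrow> linear (T g)" "\<And>g x. g \<in> G \<Longrightarrow> x \<in> W \<Longrightarrow> T g x \<in> W"
    "\<exists>C\<ge>0. \<forall>g\<in>G. \<forall>x\<in>W. norm (T g x) \<le> C * exp (- \<delta> * len g) * norm x"
    "\<exists>K\<ge>0. \<exists>c\<ge>0. \<forall>l\<in>lists G. \<forall>x\<in>W. norm (fold T l x) \<le> K * exp (c * duration l) * norm x"
    "\<And>l x. l \<in> lists G \<Longrightarrow> l \<noteq> [] \<Longrightarrow> x \<in> W \<Longrightarrow>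
        (\<lambda>n. exp (\<delta> * (real n * duration l)) *\<^sub>R fold T (word_power n l) x) \<longlonglongrightarrow> 0"
  using assms unfolding stable_system_def by (auto simp only: image_subset_iff)

text \<open>
  A piece consists of a word of duration less than \<open>T0\<close> followed by one step of any duration. Its
  short part costs a constant and its last step decays.
\<close>

lemma piece_bound:
  assumes "stable_system W T" "0 < T0"
  shows "\<exists>A>0. \<forall>l\<in>lists G. \<forall>g\<in>G. \<forall>x\<in>W. duration l < T0 \<longrightarrow>
     norm (fold T (l @ [g]) x) \<le> A * exp (- \<delta> * duration (l @ [g])) * norm x"
proof -
  obtain C where "0 \<le> C" and C: "\<And>g x. g \<in> G \<Longrightarrow> x \<in> W \<Longrightarrow> norm (T g x) \<le> C * exp (- \<delta> * len g) * norm x"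
    using stable_systemD(4)[OF assms(1)] by blast
  obtain K c where "0 \<le> K" "0 \<le> c"
    and K: "\<And>l x. l \<in> lists G \<Longrightarrow> x \<in> W \<Longrightarrow> norm (fold T l x) \<le> K * exp (c * duration l) * norm x"
    using stable_systemD(5)[OF assms(1)] by blast
  note CK = \<open>0 \<le> C\<close> \<open>0 \<le> K\<close> \<open>0 \<le> c\<close>
  define A where "A = C * K * exp (c * T0 + \<delta> * T0) + 1"
  have "norm (fold T (l @ [g]) x) \<le> A * exp (- \<delta> * duration (l @ [g])) * norm x"
    if "l \<in> lists G" "g \<in> G" "duration l < T0" "x \<in> W" for l g x
  proof -
    have "norm (fold T (l @ [g]) x) = norm (T g (fold T l x))" by simp
    also have "\<dots> \<le> C * exp (- \<delta> * len g) * norm (fold T l x)"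
      using C fold_in[OF assms(1)] that by blast
    also have "\<dots> \<le> C * exp (- \<delta> * len g) * (K * exp (c * duration l) * norm x)"
      by (intro mult_left_mono K that mult_nonneg_nonneg CK) auto
    also have "\<dots> = C * K * (exp (- \<delta> * len g) * exp (c * duration l)) * norm x"
      by simp
    also have "exp (- \<delta> * len g) * exp (c * duration l)
        = exp (c * duration l + \<delta> * duration l) * exp (- \<delta> * duration (l @ [g]))"
      unfolding mult_exp_exp by (simp add: algebra_simps)
    also have "C * K * (exp (c * duration l + \<delta> * duration l) * exp (- \<delta> * duration (l @ [g]))) * norm x
        = C * K * exp (c * duration l + \<delta> * duration l) * exp (- \<delta> * duration (l @ [g])) * norm x"
      by simp
    also have "\<dots> \<le> A * exp (- \<delta> * duration (l @ [g])) * norm x"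
    proof (intro mult_right_mono)
      have "exp (c * duration l + \<delta> * duration l) \<le> exp (c * T0 + \<delta> * T0)"
        using that \<delta>_pos CK by (auto intro!: add_mono mult_left_mono)
      then have "C * K * exp (c * duration l + \<delta> * duration l) \<le> C * K * exp (c * T0 + \<delta> * T0)"
        by (intro mult_left_mono) (use CK in auto)
      then show "C * K * exp (c * duration l + \<delta> * duration l) \<le> A" by (simp add: A_def)
    qed auto
    finally show ?thesis .
  qed
  moreover have "A > 0" using CK by (simp add: A_def add_nonneg_pos)
  ultimately show ?thesis by blast
qed

text \<open>
  Every word is a product of pieces of duration at least \<open>T0\<close> and a rest shorter than \<open>T0\<close>.
  Contraction of a piece by one half means exponential decay as long as the piece is short, and a long
  piece decays by the bound on its last step.
\<close>

lemma decays_if_pieces_contract: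
  assumes sys: "stable_system W T" and T0: "0 < T0"
    and c: "0 < c1" "0 < c2" "\<And>x. x \<in> W \<Longrightarrow> c1 * norm x \<le> N x" "\<And>x. x \<in> W \<Longrightarrow> N x \<le> c2 * norm x"
    and half: "\<And>l g x. \<lbrakk>l \<in> lists G; g \<in> G; duration l < T0; T0 \<le> duration (l @ [g]); x \<in> W\<rbrakk>
      \<Longrightarrow> N (fold T (l @ [g]) x) \<le> N x / 2"
  shows "decays W T"
proof -
  obtain K c where CK: "0 \<le> K" "0 \<le> c"
    and K: "\<And>l x. l \<in> lists G \<Longrightarrow> x \<in> W \<Longrightarrow> norm (fold T l x) \<le> K * exp (c * duration l) * norm x"
    using stable_systemD(5)[OF sys] by blast
  obtain A where "A > 0" and A: "\<And>l g x. \<lbrakk>l \<in> lists G; g \<in> G; duration l < T0; x \<in> W\<rbrakk>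
     \<Longrightarrow> norm (fold T (l @ [g]) x) \<le> A * exp (- \<delta> * duration (l @ [g])) * norm x"
    using piece_bound[OF sys T0] by blast
  have norm_le_N: "norm x \<le> N x / c1" if "x \<in> W" for x
    using c(1) c(3)[OF that] by (simp add: field_simps)
  have N0: "0 \<le> N x" if "x \<in> W" for x
    using order_trans[OF _ c(3)[OF that], of 0] c(1) by simp
  define B where "B = c2 * A / c1"
  have "B > 0" using \<open>A > 0\<close> c(1,2) by (simp add: B_def)
  \<comment> \<open>From \<open>t0\<close> on, half of the decay rate \<open>\<delta>\<close> absorbs the constant \<open>B\<close>.\<close>
  define t0 where "t0 = max 1 (2 * ln (B + 1) / \<delta>)"
  define \<gamma> where "\<gamma> = min (\<delta> / 2) (ln 2 / t0)"
  have "t0 \<ge> 1" by (simp add: t0_def)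
  then have \<gamma>: "0 < \<gamma>" "\<gamma> \<le> \<delta> / 2" "\<gamma> * t0 \<le> ln 2"
    using \<delta>_pos by (auto simp: \<gamma>_def min_def field_simps)
  have piece: "N (fold T (l @ [g]) x) \<le> exp (- \<gamma> * duration (l @ [g])) * N x"
    if l: "l \<in> lists G" "g \<in> G" "duration l < T0" "T0 \<le> duration (l @ [g])" "x \<in> W" for l g x
  proof -
    define t where "t = duration (l @ [g])"
    have lg: "l @ [g] \<in> lists G" using l by simp
    have t: "0 \<le> t" unfolding t_def by (rule duration_nonneg[OF lg])
    have "N (fold T (l @ [g]) x) \<le> exp (- \<gamma> * t) * N x"
    proof (cases "t \<le> t0")
      case True
      have "\<gamma> * t \<le> \<gamma> * t0" using \<gamma>(1) True by simp
      then have "\<gamma> * t \<le> ln 2" using \<gamma>(3) by simp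
      then have "exp (- ln 2) \<le> exp (- (\<gamma> * t))" by simp
      then have "1 / 2 \<le> exp (- \<gamma> * t)" by (simp add: exp_minus)
      then have "1 / 2 * N x \<le> exp (- \<gamma> * t) * N x" by (rule mult_right_mono[OF _ N0[OF l(5)]])
      with half[OF l] show ?thesis by linarith
    next
      case False
      then have "2 * ln (B + 1) / \<delta> \<le> t" by (auto simp: t0_def)
      then have "ln (B + 1) \<le> \<delta> * t / 2" using \<delta>_pos by (simp add: field_simps)
      then have "exp (ln (B + 1)) \<le> exp (\<delta> * t / 2)" by simp
      then have B: "B \<le> exp (\<delta> * t / 2)" using \<open>B > 0\<close> by simp
      have "N (fold T (l @ [g]) x) \<le> c2 * norm (fold T (l @ [g]) x)"
        by (rule c(4)[OF fold_in[OF sys lg l(5)]])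
      also have "\<dots> \<le> c2 * (A * exp (- \<delta> * t) * norm x)"
        unfolding t_def using A[OF l(1,2,3,5)] c(2) by (rule mult_left_mono[OF _ less_imp_le])
      also have "\<dots> \<le> c2 * (A * exp (- \<delta> * t) * (N x / c1))"
        using norm_le_N[OF l(5)] c(2) \<open>A > 0\<close> by (intro mult_left_mono) auto
      also have "\<dots> = B * exp (- \<delta> * t) * N x" by (simp add: B_def)
      also have "\<dots> \<le> exp (\<delta> * t / 2) * exp (- \<delta> * t) * N x"
        using B N0[OF l(5)] by (intro mult_right_mono) auto
      also have "exp (\<delta> * t / 2) * exp (- \<delta> * t) = exp (- (\<delta> / 2 * t))"
        unfolding mult_exp_exp by simp
      also have "exp (- (\<delta> / 2 * t)) * N x \<le> exp (- \<gamma> * t) * N x"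
        using mult_right_mono[OF \<gamma>(2) t] N0[OF l(5)] by (intro mult_right_mono) auto
      finally show ?thesis .
    qed
    then show ?thesis by (simp only: t_def)
  qed
  define R where "R = c2 * K * exp ((c + \<gamma>) * T0) / c1"
  have "R \<ge> 0" using c(1,2) CK by (simp add: R_def)
  have main: "N (fold T l x) \<le> R * exp (- \<gamma> * duration l) * N x" if "l \<in> lists G" "x \<in> W" for l x
    using that
  proof (induction l arbitrary: x rule: length_induct)
    case (1 l)
    have lG: "l \<in> lists G" and xW: "x \<in> W" using 1 by auto
    show ?case
    proof (cases "duration l < T0")
      case True
      have "N (fold T l x) \<le> c2 * norm (fold T l x)"
        by (rule c(4)[OF fold_in[OF sys lG xW]])
      also have "\<dots> \<le> c2 * (K * exp (c * duration l) * norm x)"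
        using K[OF lG xW] c(2) by (rule mult_left_mono[OF _ less_imp_le])
      also have "\<dots> \<le> c2 * (K * exp (c * duration l) * (N x / c1))"
        using norm_le_N[OF xW] c(2) CK by (intro mult_left_mono) auto
      also have "\<dots> = c2 * K * (exp (c * duration l)) / c1 * N x" by simp
      also have "exp (c * duration l) = exp ((c + \<gamma>) * duration l) * exp (- \<gamma> * duration l)"
        unfolding mult_exp_exp by (simp add: algebra_simps)
      also have "c2 * K * (exp ((c + \<gamma>) * duration l) * exp (- \<gamma> * duration l)) / c1 * N x
          = c2 * K * exp ((c + \<gamma>) * duration l) / c1 * exp (- \<gamma> * duration l) * N x" by simp
      also have "\<dots> \<le> R * exp (- \<gamma> * duration l) * N x"
      proof -
        have "(c + \<gamma>) * duration l \<le> (c + \<gamma>) * T0"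
          using True CK \<gamma>(1) by (intro mult_left_mono) auto
        then show ?thesis
          unfolding R_def using N0[OF xW] c(1,2) CK
          by (intro mult_right_mono divide_right_mono mult_left_mono) auto
      qed
      finally show ?thesis .
    next
      case False
      \<comment> \<open>The shortest prefix of duration at least \<open>T0\<close> is a piece.\<close>
      define n where "n = (LEAST n. T0 \<le> duration (take n l))"
      have ex: "T0 \<le> duration (take (length l) l)" using False by simp
      have n: "T0 \<le> duration (take n l)" unfolding n_def by (rule LeastI[of _ "length l"]) (rule ex)
      have "n \<le> length l" unfolding n_def by (rule Least_le) (rule ex)
      have "n \<noteq> 0" using n T0 by (cases n) auto
      then obtain m where m: "n = Suc m" by (cases n) auto
      have lt: "duration (take m l) < T0"
        using not_less_Least[of m "\<lambda>n. T0 \<le> duration (take n l)"] m by (simp add: n_def)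
      have "m < length l" using \<open>n \<le> length l\<close> m by simp
      then have tk: "take n l = take m l @ [l ! m]" by (simp add: m take_Suc_conv_app_nth)
      have inG: "set l \<subseteq> G" using lG by auto
      have tm: "take m l \<in> lists G" "l ! m \<in> G" "drop n l \<in> lists G"
        using inG \<open>m < length l\<close> by (auto dest!: in_set_takeD in_set_dropD)
      have p: "N (fold T (take n l) x) \<le> exp (- \<gamma> * duration (take n l)) * N x" "fold T (take n l) x \<in> W"
        using piece[OF tm(1,2) lt _ xW] n fold_in[OF sys _ xW, of "take n l"] tm unfolding tk by auto
      have "fold T l x = fold T (drop n l) (fold T (take n l) x)"
        by (metis append_take_drop_id comp_apply fold_append)
      also have "N \<dots> \<le> R * exp (- \<gamma> * duration (drop n l)) * N (fold T (take n l) x)"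
      proof -
        have "length (drop n l) < length l" using \<open>n \<noteq> 0\<close> \<open>m < length l\<close> by simp
        with 1(1) tm(3) p(2) show ?thesis by blast
      qed
      also have "\<dots> \<le> R * exp (- \<gamma> * duration (drop n l)) * (exp (- \<gamma> * duration (take n l)) * N x)"
        using p(1) \<open>R \<ge> 0\<close> by (intro mult_left_mono) auto
      also have "\<dots> = R * (exp (- \<gamma> * duration (drop n l)) * exp (- \<gamma> * duration (take n l))) * N x"
        by (simp only: mult.assoc)
      also have "exp (- \<gamma> * duration (drop n l)) * exp (- \<gamma> * duration (take n l)) = exp (- \<gamma> * duration (take n l @ drop n l))"
        unfolding mult_exp_exp duration_simps by (simp add: algebra_simps)
      finally show ?thesis by simp
    qed
  qed
  have "norm (fold T l x) \<le> (R * c2 / c1) * exp (- \<gamma> * duration l) * norm x" if l: "l \<in> lists G" "x \<in> W" for l x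
  proof -
    have "norm (fold T l x) \<le> N (fold T l x) / c1" by (rule norm_le_N[OF fold_in[OF sys l]])
    also have "\<dots> \<le> R * exp (- \<gamma> * duration l) * N x / c1"
      using main[OF l] c(1) by (intro divide_right_mono) auto
    also have "\<dots> \<le> R * exp (- \<gamma> * duration l) * (c2 * norm x) / c1"
      using c(4)[OF l(2)] c(1) \<open>R \<ge> 0\<close> by (intro divide_right_mono mult_left_mono) auto
    finally show ?thesis by (simp add: algebra_simps)
  qed
  moreover have "R * c2 / c1 \<ge> 0" using \<open>R \<ge> 0\<close> c(1,2) by simp
  ultimately show ?thesis unfolding decays_def using \<gamma>(1) by blast
qed

lemma stable_system_subspace:
  assumes "stable_system W T" "subspace X" "X \<subseteq> W" "\<And>g x. g \<in> G \<Longrightarrow> x \<in> X \<Longrightarrow> T g x \<in> X"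
  shows "stable_system X T"
proof -
  have "\<exists>C\<ge>0. \<forall>g\<in>G. \<forall>x\<in>X. norm (T g x) \<le> C * exp (- \<delta> * len g) * norm x"
    using stable_systemD(4)[OF assms(1)] assms(3) by blast
  moreover have "\<exists>K\<ge>0. \<exists>c\<ge>0. \<forall>l\<in>lists G. \<forall>x\<in>X. norm (fold T l x) \<le> K * exp (c * duration l) * norm x"
    using stable_systemD(5)[OF assms(1)] assms(3) by blast
  moreover have "\<forall>g\<in>G. linear (T g) \<and> T g ` X \<subseteq> X"
    using stable_systemD(2)[OF assms(1)] assms(4) by auto
  moreover have "\<forall>l\<in>lists G. l \<noteq> [] \<longrightarrow> (\<forall>x\<in>X.
      (\<lambda>n. exp (\<delta> * (real n * duration l)) *\<^sub>R fold T (word_power n l) x) \<longlonglongrightarrow> 0)"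
    using stable_systemD(6)[OF assms(1)] assms(3) by blast
  ultimately show ?thesis unfolding stable_system_def using assms(2) by simp
qed

section \<open>Block triangular systems\<close>

text \<open>
  The quotient of \<open>W\<close> by an invariant subspace \<open>X\<close> is realised on the kernel in \<open>W\<close> of the
  projection \<open>P\<close> onto \<open>X\<close>, so that the induction stays within one ambient space.
\<close>

lemma
  assumes sys: "stable_system W T" and X: "subspace X" "X \<subseteq> W" "\<And>g x. g \<in> G \<Longrightarrow> x \<in> X \<Longrightarrow> T g x \<in> X"
    and P: "linear P" "\<And>x. P x \<in> X" "\<And>x. x \<in> X \<Longrightarrow> P x = x" "\<And>x. norm (x - P x) \<le> norm x"
  defines "T' \<equiv> \<lambda>g x. T g x - P (T g x)"
  shows fold_quotient: "\<And>l w. l \<in> lists G \<Longrightarrow> w \<in> W \<Longrightarrow> fold T' l (w - P w) = fold T l w - P (fold T l w)"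
    and stable_system_quotient: "stable_system {y \<in> W. P y = 0} T'"
proof -
  let ?Y = "{y \<in> W. P y = 0}"
  have W: "subspace W" by (rule stable_systemD(1)[OF sys])
  have P0: "P (x - P x) = 0" for x by (simp add: linear_diff[OF P(1)] P(3)[OF P(2)])
  show fold: "fold T' l (w - P w) = fold T l w - P (fold T l w)" if "l \<in> lists G" "w \<in> W" for l w
    using that
  proof (induction l arbitrary: w)
    case (Cons g l)
    then have g: "g \<in> G" by simp
    have "P (T g (P w)) = T g (P w)" by (rule P(3)[OF X(3)[OF g P(2)]])
    then have "T' g (w - P w) = T g w - P (T g w)"
      by (simp add: T'_def linear_diff[OF stable_systemD(2)[OF sys g]] linear_diff[OF P(1)])
    with Cons stable_systemD(3)[OF sys g] show ?case by simp
  qed simp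
  have fold_Y: "fold T' l y = fold T l y - P (fold T l y)" if "l \<in> lists G" "y \<in> ?Y" for l y
    using fold[OF that(1), of y] that(2) by simp
  have "subspace ?Y"
    using W by (auto simp: subspace_def linear_0[OF P(1)] linear_add[OF P(1)] linear_cmul[OF P(1)])
  moreover have "linear (T' g)" if "g \<in> G" for g
    unfolding T'_def
    using linear_compose_sub[OF stable_systemD(2)[OF sys that] linear_compose[OF stable_systemD(2)[OF sys that] P(1)]]
    by (simp add: o_def)
  moreover have "T' g ` ?Y \<subseteq> ?Y" if "g \<in> G" for g
    using stable_systemD(3)[OF sys that] P(2) X(2) W P0 by (auto simp: T'_def intro!: subspace_diff)
  moreover have "\<exists>C\<ge>0. \<forall>g\<in>G. \<forall>x\<in>?Y. norm (T' g x) \<le> C * exp (- \<delta> * len g) * norm x"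
  proof -
    obtain C where "0 \<le> C" and C: "\<And>g x. g \<in> G \<Longrightarrow> x \<in> W \<Longrightarrow> norm (T g x) \<le> C * exp (- \<delta> * len g) * norm x"
      using stable_systemD(4)[OF sys] by blast
    have "norm (T' g x) \<le> C * exp (- \<delta> * len g) * norm x" if "g \<in> G" "x \<in> ?Y" for g x
      using order_trans[OF P(4) C[OF that(1), of x]] that by (simp add: T'_def)
    with \<open>0 \<le> C\<close> show ?thesis by blast
  qed
  moreover have "\<exists>K\<ge>0. \<exists>c\<ge>0. \<forall>l\<in>lists G. \<forall>x\<in>?Y. norm (fold T' l x) \<le> K * exp (c * duration l) * norm x"
  proof -
    obtain K c where "0 \<le> K" "0 \<le> c"
      and K: "\<And>l x. l \<in> lists G \<Longrightarrow> x \<in> W \<Longrightarrow> norm (fold T l x) \<le> K * exp (c * duration l) * norm x"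
      using stable_systemD(5)[OF sys] by blast
    have "norm (fold T' l x) \<le> K * exp (c * duration l) * norm x" if "l \<in> lists G" "x \<in> ?Y" for l x
      unfolding fold_Y[OF that] using order_trans[OF P(4) K[OF that(1), of x]] that by simp
    with \<open>0 \<le> K\<close> \<open>0 \<le> c\<close> show ?thesis by blast
  qed
  moreover have "(\<lambda>n. exp (\<delta> * (real n * duration l)) *\<^sub>R fold T' (word_power n l) x) \<longlonglongrightarrow> 0"
    if "l \<in> lists G" "l \<noteq> []" "x \<in> ?Y" for l x
  proof (rule Lim_null_comparison)
    have x: "x \<in> W" using that by simp
    show "(\<lambda>n. norm (exp (\<delta> * (real n * duration l)) *\<^sub>R fold T (word_power n l) x)) \<longlonglongrightarrow> 0"
      by (rule tendsto_norm_zero[OF stable_systemD(6)[OF sys that(1,2) x]])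
    show "\<forall>\<^sub>F n in sequentially. norm (exp (\<delta> * (real n * duration l)) *\<^sub>R fold T' (word_power n l) x)
        \<le> norm (exp (\<delta> * (real n * duration l)) *\<^sub>R fold T (word_power n l) x)"
      unfolding fold_Y[OF word_power_in[OF that(1)] that(3)] by (intro always_eventually allI) (simp add: P(4))
  qed
  ultimately show "stable_system ?Y T'" unfolding stable_system_def by simp
qed

text \<open>
  In the splitting \<open>w = P w + (w - P w)\<close> a word is block triangular. Both diagonal blocks of a
  long piece are small, and its off-diagonal block is only bounded. A norm that weights the quotient
  component by a large factor makes the off-diagonal block small as well.
\<close>

lemma decays_from_blocks:
  assumes sys: "stable_system W T" and X: "subspace X" "X \<subseteq> W" "\<And>g x. g \<in> G \<Longrightarrow> x \<in> X \<Longrightarrow> T g x \<in> X"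
    and P: "linear P" "\<And>x. P x \<in> X" "\<And>x. x \<in> X \<Longrightarrow> P x = x"
      "\<And>x. norm (P x) \<le> norm x" "\<And>x. norm (x - P x) \<le> norm x"
    and dX: "decays X T" and dY: "decays {y \<in> W. P y = 0} (\<lambda>g x. T g x - P (T g x))"
  shows "decays W T"
proof -
  let ?T' = "\<lambda>g x. T g x - P (T g x)" and ?Y = "{y \<in> W. P y = 0}"
  have W: "subspace W" by (rule stable_systemD(1)[OF sys])
  obtain K1 \<gamma>1 where K1: "0 \<le> K1" "0 < \<gamma>1"
    "\<And>l x. l \<in> lists G \<Longrightarrow> x \<in> X \<Longrightarrow> norm (fold T l x) \<le> K1 * exp (- \<gamma>1 * duration l) * norm x"
    using dX unfolding decays_def by blast
  obtain K2 \<gamma>2 where K2: "0 \<le> K2" "0 < \<gamma>2"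
    "\<And>l x. l \<in> lists G \<Longrightarrow> x \<in> ?Y \<Longrightarrow> norm (fold ?T' l x) \<le> K2 * exp (- \<gamma>2 * duration l) * norm x"
    using dY unfolding decays_def by blast
  have small: "\<exists>t0>0. \<forall>t\<ge>t0. K * exp (- \<gamma> * t) \<le> 1 / 4" if "0 \<le> K" "0 < \<gamma>" for K \<gamma> :: real
  proof -
    have "K * exp (- \<gamma> * t) \<le> 1 / 4" if "t \<ge> max 1 (ln (4 * K + 1) / \<gamma>)" for t
    proof -
      have "ln (4 * K + 1) \<le> \<gamma> * t" using that \<open>0 < \<gamma>\<close> by (simp add: field_simps)
      then have "exp (ln (4 * K + 1)) \<le> exp (\<gamma> * t)" by simp
      then have "4 * K \<le> exp (\<gamma> * t)" using \<open>0 \<le> K\<close> by simp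
      then have "4 * K * exp (- \<gamma> * t) \<le> exp (\<gamma> * t) * exp (- \<gamma> * t)" by (rule mult_right_mono) simp
      then show ?thesis unfolding mult_exp_exp by simp
    qed
    then show ?thesis by (intro exI[of _ "max 1 (ln (4 * K + 1) / \<gamma>)"]) auto
  qed
  obtain t1 where t1: "t1 > 0" "\<And>t. t \<ge> t1 \<Longrightarrow> K1 * exp (- \<gamma>1 * t) \<le> 1 / 4"
    using small[OF K1(1,2)] by blast
  obtain t2 where t2: "t2 > 0" "\<And>t. t \<ge> t2 \<Longrightarrow> K2 * exp (- \<gamma>2 * t) \<le> 1 / 4"
    using small[OF K2(1,2)] by blast
  define T0 where "T0 = max t1 t2"
  have T0: "T0 > 0" using t1 by (simp add: T0_def)
  obtain A where "A > 0" and A: "\<And>l g x. \<lbrakk>l \<in> lists G; g \<in> G; duration l < T0; x \<in> W\<rbrakk>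
     \<Longrightarrow> norm (fold T (l @ [g]) x) \<le> A * exp (- \<delta> * duration (l @ [g])) * norm x"
    using piece_bound[OF sys T0] by blast
  define R where "R = 4 * A + 1"
  define N where "N x = norm (P x) + R * norm (x - P x)" for x
  have "R \<ge> 1" using \<open>A > 0\<close> by (simp add: R_def)
  show ?thesis
  proof (rule decays_if_pieces_contract[OF sys T0, where N = N and ?c1.0 = 1 and ?c2.0 = "1 + R"])
    show "0 < 1 + R" using \<open>R \<ge> 1\<close> by simp
    fix x
    have "norm x \<le> norm (P x) + norm (x - P x)" using norm_triangle_ineq[of "P x" "x - P x"] by simp
    also have "\<dots> \<le> norm (P x) + R * norm (x - P x)"
      using mult_right_mono[OF \<open>R \<ge> 1\<close>, of "norm (x - P x)"] by simp
    finally show "1 * norm x \<le> N x" by (simp add: N_def)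
    have "R * norm (x - P x) \<le> R * norm x" using P(5) \<open>R \<ge> 1\<close> by (intro mult_left_mono) auto
    then show "N x \<le> (1 + R) * norm x" using P(4)[of x] by (simp add: N_def algebra_simps)
  next
    fix l g w
    assume l: "l \<in> lists G" "g \<in> G" "duration l < T0" "T0 \<le> duration (l @ [g])" and w: "w \<in> W"
    define p where "p = l @ [g]"
    have p: "p \<in> lists G" and tp: "t1 \<le> duration p" "t2 \<le> duration p" using l by (auto simp: p_def T0_def)
    have lin: "linear (fold T p)" by (rule linear_fold[OF sys p])
    let ?u = "P w" and ?y = "w - P w"
    have u: "?u \<in> X" and y: "?y \<in> ?Y" "?y \<in> W"
      using P(2)[of w] X(2) w W by (auto intro!: subspace_diff simp: linear_diff[OF P(1)] P(3)[OF P(2)])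
    have pu: "fold T p ?u \<in> X" by (rule fold_in[OF stable_system_subspace[OF sys X] p u])
    have "P (fold T p w) = fold T p ?u + P (fold T p ?y)"
    proof -
      have "fold T p w = fold T p ?u + fold T p ?y" by (simp flip: linear_add[OF lin])
      then show ?thesis by (simp add: linear_add[OF P(1)] P(3)[OF pu])
    qed
    then have "norm (P (fold T p w)) \<le> norm (fold T p ?u) + norm (fold T p ?y)"
      using norm_triangle_ineq[of "fold T p ?u" "P (fold T p ?y)"] P(4)[of "fold T p ?y"] by simp
    moreover have "norm (fold T p ?u) \<le> 1 / 4 * norm ?u"
      using K1(3)[OF p u] mult_right_mono[OF t1(2)[OF tp(1)] norm_ge_zero[of ?u]] by (rule order_trans)
    moreover have "norm (fold T p ?y) \<le> A * norm ?y"
    proof -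
      have "exp (- \<delta> * duration p) \<le> 1" using \<delta>_pos duration_nonneg[OF p] by simp
      then have "A * exp (- \<delta> * duration p) * norm ?y \<le> A * 1 * norm ?y"
        using \<open>A > 0\<close> by (intro mult_right_mono mult_left_mono) auto
      then show ?thesis using A[OF l(1-3) y(2)] by (simp add: p_def)
    qed
    moreover have "norm (fold T p w - P (fold T p w)) \<le> 1 / 4 * norm ?y"
    proof -
      have "fold T p w - P (fold T p w) = fold ?T' p ?y"
        using fold_quotient[OF sys X P(1,2,3,5) p w] by simp
      then show ?thesis
        using order_trans[OF K2(3)[OF p y(1)] mult_right_mono[OF t2(2)[OF tp(2)] norm_ge_zero[of ?y]]] by simp
    qed
    then have "R * norm (fold T p w - P (fold T p w)) \<le> R * (1 / 4 * norm ?y)"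
      using \<open>R \<ge> 1\<close> by (intro mult_left_mono) auto
    ultimately have NA: "N (fold T p w) \<le> 1 / 4 * norm ?u + A * norm ?y + R * (1 / 4 * norm ?y)"
      unfolding N_def by linarith
    have nu: "0 \<le> norm ?u" by simp
    have "A * norm ?y \<le> R * (1 / 4 * norm ?y)"
      using mult_right_mono[of A "R / 4" "norm ?y"] by (simp add: R_def)
    moreover have "R * (1 / 4 * norm ?y) = R * norm ?y / 4" by simp
    ultimately have "N (fold T p w) \<le> (norm ?u + R * norm ?y) / 2"
      using NA nu by argo
    then have "N (fold T p w) \<le> N w / 2" unfolding N_def[of w] .
    then show "N (fold T (l @ [g]) w) \<le> N w / 2" by (simp only: p_def)
  qed auto
qed

section \<open>Unbounded and bounded orbits\<close>

text \<open>
  If every nonzero orbit is unbounded, then every unit vector is doubled by some word, and by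
  compactness of the sphere finitely many words suffice. Hence vectors can be doubled again and again
  within a bounded time each, which is exponential growth.
\<close>

lemma unbounded_orbits_imp_trivial:
  assumes sys: "stable_system W T"
    and subexp: "\<And>\<epsilon>. \<epsilon> > 0 \<Longrightarrow> \<exists>K. \<forall>l\<in>lists G. \<forall>x\<in>W. norm (fold T l x) \<le> K * exp (\<epsilon> * duration l) * norm x"
    and unbdd: "\<And>x b. x \<in> W \<Longrightarrow> x \<noteq> 0 \<Longrightarrow> \<exists>l\<in>lists G. norm (fold T l x) > b"
    and "x0 \<in> W"
  shows "x0 = 0"
proof (rule ccontr)
  assume "x0 \<noteq> 0"
  have W: "subspace W" by (rule stable_systemD(1)[OF sys])
  define S where "S = sphere 0 1 \<inter> W"
  have "compact S" unfolding S_def using W by (intro compact_Int_closed closed_subspace) auto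
  define U where "U l = {x. norm (fold T l x) > 2}" for l
  have "open (U l)" if "l \<in> lists G" for l
  proof -
    have "continuous_on UNIV (fold T l)"
      by (intro linear_continuous_on linear_linear[THEN iffD1] linear_fold[OF sys that, unfolded linear_conv_bounded_linear])
    then show ?thesis unfolding U_def by (intro open_Collect_less continuous_intros)
  qed
  moreover have "S \<subseteq> (\<Union>l\<in>lists G. U l)"
  proof
    fix x assume "x \<in> S"
    then have "x \<in> W" "x \<noteq> 0" by (auto simp: S_def)
    then show "x \<in> (\<Union>l\<in>lists G. U l)" using unbdd[of x 2] by (auto simp: U_def)
  qed
  ultimately obtain F where F: "F \<subseteq> lists G" "finite F" "S \<subseteq> (\<Union>l\<in>F. U l)"
    using compactE_image[OF \<open>compact S\<close>, of "lists G" U] by metis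
  define D where "D = Max (insert 0 (duration ` F))"
  have D: "0 \<le> D" "\<And>l. l \<in> F \<Longrightarrow> duration l \<le> D" unfolding D_def using F(2) by auto
  have double: "\<exists>l\<in>F. 2 * norm x \<le> norm (fold T l x)" if x: "x \<in> W" "x \<noteq> 0" for x
  proof -
    have "x /\<^sub>R norm x \<in> S" using x W by (simp add: S_def subspace_scale)
    then obtain l where l: "l \<in> F" "norm (fold T l (x /\<^sub>R norm x)) > 2" using F(3) by (auto simp: U_def)
    have "linear (fold T l)" using l F linear_fold[OF sys] by blast
    then have "norm (fold T l (x /\<^sub>R norm x)) = norm (fold T l x) / norm x"
      by (simp add: linear_cmul divide_inverse mult.commute)
    then have "2 < norm (fold T l x) / norm x" using l(2) by simp
    then have "2 * norm x < norm (fold T l x)" using x by (simp add: less_divide_eq)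
    with l(1) show ?thesis by (intro bexI[of _ l]) auto
  qed
  have grow: "\<exists>l\<in>lists G. duration l \<le> real n * D \<and> 2 ^ n * norm x0 \<le> norm (fold T l x0)" for n
  proof (induction n)
    case 0
    then show ?case by (intro bexI[of _ "[]"]) auto
  next
    case (Suc n)
    then obtain l where l: "l \<in> lists G" "duration l \<le> real n * D" "2 ^ n * norm x0 \<le> norm (fold T l x0)" by blast
    have "0 < 2 ^ n * norm x0" using \<open>x0 \<noteq> 0\<close> by simp
    then have "fold T l x0 \<noteq> 0" using l(3) by auto
    with double[OF fold_in[OF sys l(1) \<open>x0 \<in> W\<close>]] obtain l' where l': "l' \<in> F"
      "2 * norm (fold T l x0) \<le> norm (fold T l' (fold T l x0))" by blast
    have "duration (l @ l') \<le> real (Suc n) * D" using D(2)[OF l'(1)] l(2) by (simp add: algebra_simps)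
    moreover have "2 ^ Suc n * norm x0 \<le> norm (fold T (l @ l') x0)" using l(3) l'(2) by simp
    moreover have "l @ l' \<in> lists G" using l(1) l'(1) F(1) by auto
    ultimately show ?case by blast
  qed
  \<comment> \<open>Any base strictly between 1 and 2 in place of \<open>3 / 2\<close> contradicts the doubling.\<close>
  define \<epsilon> where "\<epsilon> = ln (3 / 2) / (D + 1)"
  have \<epsilon>: "\<epsilon> > 0" "\<epsilon> * D \<le> ln (3 / 2)" using D(1) by (auto simp: \<epsilon>_def field_simps)
  obtain K where K: "\<And>l x. l \<in> lists G \<Longrightarrow> x \<in> W \<Longrightarrow> norm (fold T l x) \<le> K * exp (\<epsilon> * duration l) * norm x"
    using subexp[OF \<epsilon>(1)] by blast
  have "norm x0 > 0" using \<open>x0 \<noteq> 0\<close> by simp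
  have "K \<ge> 0" using K[of "[]" x0] \<open>x0 \<in> W\<close> \<open>norm x0 > 0\<close> by simp
  have "2 ^ n \<le> K * (3 / 2) ^ n" for n
  proof -
    obtain l where l: "l \<in> lists G" "duration l \<le> real n * D" "2 ^ n * norm x0 \<le> norm (fold T l x0)"
      using grow by blast
    have "\<epsilon> * duration l \<le> \<epsilon> * (real n * D)" using l(2) \<epsilon>(1) by simp
    also have "\<dots> = real n * (\<epsilon> * D)" by simp
    also have "\<dots> \<le> real n * ln (3 / 2)" using \<epsilon>(2) by (rule mult_left_mono) simp
    finally have "exp (\<epsilon> * duration l) \<le> exp (real n * ln (3 / 2))" by simp
    also have "\<dots> = (3 / 2) ^ n" by (simp add: exp_of_nat_mult)
    finally have e: "exp (\<epsilon> * duration l) \<le> (3 / 2) ^ n" .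
    have "2 ^ n * norm x0 \<le> K * exp (\<epsilon> * duration l) * norm x0"
      using l(3) K[OF l(1) \<open>x0 \<in> W\<close>] by (rule order_trans)
    also have "\<dots> \<le> K * (3 / 2) ^ n * norm x0"
      using e \<open>K \<ge> 0\<close> by (intro mult_right_mono mult_left_mono) auto
    finally show ?thesis using \<open>norm x0 > 0\<close> by simp
  qed
  then have "(4 / 3) ^ n * (3 / 2) ^ n \<le> K * (3 / 2) ^ n" for n
    by (simp flip: power_mult_distrib)
  then have *: "(4 / 3) ^ n \<le> K" for n
    by (rule mult_right_le_imp_le) simp
  obtain n where "K < (4 / 3) ^ n" using real_arch_pow[of "4 / 3" K] by auto
  with *[of n] show False by simp
qed

text \<open>
  Without decay there are arbitrarily long words along which some orbit stays in a fixed annulus.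
  Steps in such a word have bounded duration, so the orbit is sampled at many times that are at
  least 1 apart, and by the pigeonhole principle two samples are close: a word \<open>p\<close> of duration at
  least 1 almost fixes a vector. Iterating \<open>p\<close> a fixed number \<open>n\<close> of times still almost fixes
  it, since all words are uniformly bounded. But \<open>exp \<delta>\<close> times \<open>p\<close> is stable, so its powers
  obey a growth bound of rate \<open>exp (\<delta> / 2)\<close> whose constant does not depend on \<open>p\<close>. For large
  \<open>n\<close> this is incompatible with growth at rate \<open>exp \<delta>\<close> on the almost fixed vector.
\<close>

lemma bounded_imp_decays:
  fixes T :: "'g \<Rightarrow> real ^ 'n \<Rightarrow> real ^ 'n"
  assumes sys: "stable_system W T"
    and bdd: "\<And>l x. l \<in> lists G \<Longrightarrow> x \<in> W \<Longrightarrow> norm (fold T l x) \<le> B * norm x"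
  shows "decays W T"
proof (rule ccontr)
  assume not_decays: "\<not> decays W T"
  have W: "subspace W" by (rule stable_systemD(1)[OF sys])
  define Kb where "Kb = max 1 B"
  have Kb: "1 \<le> Kb" "\<And>l x. l \<in> lists G \<Longrightarrow> x \<in> W \<Longrightarrow> norm (fold T l x) \<le> Kb * norm x"
  proof -
    show "norm (fold T l x) \<le> Kb * norm x" if "l \<in> lists G" "x \<in> W" for l x
      using bdd[OF that] mult_right_mono[of B Kb "norm x"] by (simp add: Kb_def)
  qed (simp add: Kb_def)
  have long: "\<exists>l\<in>lists G. t \<le> duration l \<and> (\<exists>x\<in>W. norm x = 1 \<and> 1 / 2 \<le> norm (fold T l x))" if "t > 0" for t
  proof -
    have "\<exists>l g x. l \<in> lists G \<and> g \<in> G \<and> t \<le> duration (l @ [g]) \<and> x \<in> W \<and> \<not> norm (fold T (l @ [g]) x) \<le> norm x / 2"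
      using decays_if_pieces_contract[OF sys \<open>t > 0\<close>, where N = norm and ?c1.0 = 1 and ?c2.0 = 1] not_decays
      by (metis mult_1 order_refl zero_less_one)
    then obtain l g x where l: "l \<in> lists G" "g \<in> G" "t \<le> duration (l @ [g])" and x: "x \<in> W"
      "norm x / 2 < norm (fold T (l @ [g]) x)" by (auto simp only: not_le)
    have lg: "l @ [g] \<in> lists G" using l by simp
    have lin: "linear (fold T (l @ [g]))" by (rule linear_fold[OF sys lg])
    have "x \<noteq> 0" using x(2) linear_0[OF lin] by auto
    have "norm (fold T (l @ [g]) (x /\<^sub>R norm x)) = norm (fold T (l @ [g]) x) / norm x"
      by (simp only: linear_cmul[OF lin] norm_scaleR) (simp add: divide_inverse mult.commute)
    moreover have "1 / 2 \<le> norm (fold T (l @ [g]) x) / norm x"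
      using x(2) \<open>x \<noteq> 0\<close> by (simp add: field_simps)
    moreover have "x /\<^sub>R norm x \<in> W" "norm (x /\<^sub>R norm x) = 1"
      using x(1) W \<open>x \<noteq> 0\<close> by (auto simp: subspace_scale)
    ultimately show ?thesis using lg l(3) by metis
  qed
  obtain Cg where "0 \<le> Cg" and Cg: "\<And>g x. g \<in> G \<Longrightarrow> x \<in> W \<Longrightarrow> norm (T g x) \<le> Cg * exp (- \<delta> * len g) * norm x"
    using stable_systemD(4)[OF sys] by blast
  obtain P where P: "linear P" "\<And>x. P x \<in> W" "\<And>x. x \<in> W \<Longrightarrow> P x = x" "\<And>x. norm (P x) \<le> norm x"
    using subspace_orthogonal_projection[OF W] by metis
  \<comment> \<open>Stable matrices of norm at most \<open>exp \<delta> * Kb\<close> have powers growing at most like \<open>exp (\<delta> / 2)\<^sup>n\<close>.\<close>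
  have "0 \<le> exp \<delta> * Kb" "1 < exp (\<delta> / 2)" using Kb(1) \<delta>_pos by auto
  then obtain C where "0 \<le> C" and C: "\<And>(M :: real ^ 'n ^ 'n) n x.
     \<lbrakk>\<And>x. norm (M *v x) \<le> exp \<delta> * Kb * norm x; \<And>\<mu>. \<mu> \<in> eigenvalues M \<Longrightarrow> cmod \<mu> \<le> 1\<rbrakk>
     \<Longrightarrow> norm (((*v) M ^^ n) x) \<le> C * exp (\<delta> / 2) ^ n * norm x"
    using uniform_power_bound[of "exp \<delta> * Kb" 1 "exp (\<delta> / 2)"] by (metis zero_le_one)
  obtain n where n: "2 * C < exp (\<delta> / 2) ^ n"
    using real_arch_pow[OF \<open>1 < exp (\<delta> / 2)\<close>] by blast
  \<comment> \<open>\<open>c\<close> bounds the orbit below, and \<open>\<eta>\<close> makes \<open>n\<close> returns move a vector by at most half of that.\<close>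
  define c where "c = 1 / (2 * Kb)"
  have "c > 0" using Kb(1) by (simp add: c_def)
  define \<eta> where "\<eta> = c / (2 * (real n + 1) * Kb)"
  have "\<eta> > 0" using \<open>c > 0\<close> Kb(1) by (simp add: \<eta>_def)
  have "2 * (real n + 1) * Kb \<noteq> 0" using Kb(1) by simp
  then have \<eta>_mult: "\<eta> * (2 * (real n + 1) * Kb) = c" unfolding \<eta>_def by (metis nonzero_eq_divide_eq)
  have \<eta>: "real n * Kb * \<eta> \<le> c / 2"
  proof -
    have "real n * Kb * \<eta> \<le> (real n + 1) * Kb * \<eta>"
      using Kb(1) \<open>\<eta> > 0\<close> by (intro mult_right_mono) auto
    also have "\<dots> = c / 2" unfolding \<eta>_mult[symmetric] by simp
    finally show ?thesis .
  qed
  obtain F where F: "finite F" "cball 0 Kb \<subseteq> (\<Union>y\<in>F. ball (y :: real ^ 'n) (\<eta> / 2))"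
    using compact_cball[of "0 :: real ^ 'n" Kb] \<open>\<eta> > 0\<close> unfolding compact_eq_totally_bounded
    by (metis half_gt_zero)
  \<comment> \<open>\<open>L\<close> bounds the steps that keep the orbit above \<open>c\<close>. In windows of length \<open>L + 1\<close> the first
     sampling times of different windows are at least 1 apart.\<close>
  define L where "L = max 0 (ln (2 * Cg * Kb\<^sup>2) / \<delta>)"
  have "L \<ge> 0" by (simp add: L_def)
  define m0 where "m0 = card F"
  obtain l x where l: "l \<in> lists G" "real (m0 + 1) * (L + 1) \<le> duration l" and x: "x \<in> W" "norm x = 1"
    "1 / 2 \<le> norm (fold T l x)"
    using long[of "real (m0 + 1) * (L + 1)"] \<open>L \<ge> 0\<close> by (metis add_nonneg_pos mult_pos_pos of_nat_0_less_iff zero_less_one add_gr_0)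
  define a where "a i = fold T (take i l) x" for i
  define \<theta> where "\<theta> i = duration (take i l)" for i
  have tG: "take i l \<in> lists G" "drop i l \<in> lists G" for i
    using l(1) by (auto dest!: in_set_takeD in_set_dropD)
  have aW: "a i \<in> W" for i unfolding a_def by (rule fold_in[OF sys tG(1) x(1)])
  have a_le: "norm (a i) \<le> Kb" for i using Kb(2)[OF tG(1) x(1), of i] x(2) by (simp add: a_def)
  have a_ge: "c \<le> norm (a i)" for i
  proof -
    have "fold T l x = fold T (drop i l) (a i)"
      unfolding a_def by (metis append_take_drop_id comp_apply fold_append)
    then have "1 / 2 \<le> Kb * norm (a i)" using x(3) Kb(2)[OF tG(2) aW] by (metis order_trans)
    then show ?thesis using Kb(1) by (simp add: c_def field_simps)
  qed
  have \<theta>_split: "\<theta> j = \<theta> i + duration (drop i (take j l))" if "i \<le> j" for i j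
  proof -
    have "take j l = take i l @ drop i (take j l)"
      using append_take_drop_id[of i "take j l"] that by (simp add: min_absorb1)
    then have "duration (take j l) = duration (take i l @ drop i (take j l))" by simp
    then show ?thesis by (simp add: \<theta>_def)
  qed
  have dG: "drop i (take j l) \<in> lists G" for i j
    using l(1) by (auto dest!: in_set_takeD in_set_dropD)
  have \<theta>_mono: "\<theta> i \<le> \<theta> j" if "i \<le> j" for i j
    using \<theta>_split[OF that] duration_nonneg[OF dG] by simp
  \<comment> \<open>A step longer than \<open>L\<close> would contract the orbit below the lower bound \<open>c\<close>.\<close>
  have short: "len (l ! i) \<le> L" if "i < length l" for i
  proof -
    have g: "l ! i \<in> G" using l(1) that by auto
    have "a (Suc i) = T (l ! i) (a i)" using that by (simp add: a_def take_Suc_conv_app_nth)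
    then have "c \<le> Cg * exp (- \<delta> * len (l ! i)) * norm (a i)" using a_ge[of "Suc i"] Cg[OF g aW[of i]] by simp
    also have "\<dots> \<le> Cg * exp (- \<delta> * len (l ! i)) * Kb" using a_le[of i] \<open>0 \<le> Cg\<close> by (intro mult_left_mono) auto
    finally have "exp (\<delta> * len (l ! i)) * c \<le> exp (\<delta> * len (l ! i)) * (Cg * exp (- \<delta> * len (l ! i)) * Kb)"
      by (intro mult_left_mono) auto
    also have "\<dots> = (exp (\<delta> * len (l ! i)) * exp (- \<delta> * len (l ! i))) * (Cg * Kb)" by simp
    also have "\<dots> = Cg * Kb" unfolding mult_exp_exp by simp
    finally have e: "exp (\<delta> * len (l ! i)) \<le> 2 * Cg * Kb\<^sup>2"
      using Kb(1) by (simp add: c_def field_simps power2_eq_square)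
    then have "2 * Cg * Kb\<^sup>2 > 0" using exp_gt_zero[of "\<delta> * len (l ! i)"] by linarith
    then have "\<delta> * len (l ! i) \<le> ln (2 * Cg * Kb\<^sup>2)" using e by (simp add: ln_ge_iff)
    then show ?thesis using \<delta>_pos by (simp add: L_def field_simps le_max_iff_disj)
  qed
  define idx where "idx m = (LEAST i. real m * (L + 1) \<le> \<theta> i)" for m
  have idx_ex: "real m * (L + 1) \<le> \<theta> (length l)" if "m \<le> m0" for m
  proof -
    have "real m * (L + 1) \<le> real (m0 + 1) * (L + 1)" using that \<open>L \<ge> 0\<close> by (intro mult_right_mono) auto
    then show ?thesis using l(2) by (simp add: \<theta>_def)
  qed
  have idx_ge: "real m * (L + 1) \<le> \<theta> (idx m)" if "m \<le> m0" for m
    unfolding idx_def by (rule LeastI[of _ "length l"]) (rule idx_ex[OF that])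
  have idx_le: "\<theta> (idx m) \<le> real m * (L + 1) + L" if "m \<le> m0" for m
  proof (cases "idx m")
    case 0
    then show ?thesis using \<open>L \<ge> 0\<close> by (simp add: \<theta>_def)
  next
    case (Suc i)
    have "idx m \<le> length l" unfolding idx_def by (rule Least_le) (rule idx_ex[OF that])
    then have i: "i < length l" using Suc by simp
    have "\<not> real m * (L + 1) \<le> \<theta> i"
      using not_less_Least[of i "\<lambda>i. real m * (L + 1) \<le> \<theta> i"] Suc by (simp add: idx_def)
    moreover have "\<theta> (Suc i) = \<theta> i + len (l ! i)" using i by (simp add: \<theta>_def take_Suc_conv_app_nth)
    ultimately show ?thesis using short[OF i] Suc by simp
  qed
  have "\<exists>y\<in>F. a (idx m) \<in> ball y (\<eta> / 2)" for m
  proof -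
    have "a (idx m) \<in> cball 0 Kb" using a_le[of "idx m"] by simp
    then show ?thesis using F(2) by blast
  qed
  then obtain h where h: "\<And>m. h m \<in> F" "\<And>m. a (idx m) \<in> ball (h m) (\<eta> / 2)" by metis
  have "\<not> inj_on h {..m0}"
  proof
    assume "inj_on h {..m0}"
    then have "card {..m0} \<le> card F" using h(1) F(1) by (intro card_inj_on_le) auto
    then show False by (simp add: m0_def)
  qed
  then obtain m m' where m: "m < m'" "m' \<le> m0" "h m = h m'"
    unfolding inj_on_def by (metis atMost_iff linorder_neqE_nat)
  define i j where "i = idx m" and "j = idx m'"
  have gap: "\<theta> i + 1 \<le> \<theta> j"
  proof -
    have "real m * (L + 1) + (L + 1) \<le> real m' * (L + 1)"
      using m(1) \<open>L \<ge> 0\<close> mult_right_mono[of "real m + 1" "real m'" "L + 1"] by (simp add: algebra_simps)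
    then show ?thesis using idx_le[of m] idx_ge[OF m(2)] m by (simp add: i_def j_def)
  qed
  then have "i \<le> j" using \<theta>_mono[of j i] by (cases "i \<le> j") auto
  define p where "p = drop i (take j l)"
  have pG: "p \<in> lists G" unfolding p_def by (rule dG)
  have dur_p: "1 \<le> duration p" using gap \<theta>_split[OF \<open>i \<le> j\<close>] by (simp add: p_def)
  have ap: "fold T p (a i) = a j"
  proof -
    have "take j l = take i l @ p"
      unfolding p_def using append_take_drop_id[of i "take j l"] \<open>i \<le> j\<close> by (simp add: min_absorb1)
    then show ?thesis by (simp add: a_def)
  qed
  have close: "norm (fold T p (a i) - a i) \<le> \<eta>"
  proof -
    have "dist (h m) (a i) < \<eta> / 2" "dist (h m) (a j) < \<eta> / 2"
      using h(2)[of m] h(2)[of m'] m(3) by (auto simp: i_def j_def)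
    then have "dist (a j) (a i) < \<eta>" using dist_triangle_half_r by blast
    then show ?thesis by (simp add: ap dist_norm)
  qed
  \<comment> \<open>Iterating the almost-return \<open>n\<close> times still almost returns.\<close>
  have ret: "norm (fold T (word_power k p) (a i) - a i) \<le> real k * Kb * \<eta>" for k
  proof (induction k)
    case (Suc k)
    let ?A = "fold T (word_power k p)"
    have lin: "linear ?A" by (rule linear_fold[OF sys word_power_in[OF pG]])
    have "fold T (word_power (Suc k) p) (a i) - a i = ?A (fold T p (a i) - a i) + (?A (a i) - a i)"
      by (simp add: linear_diff[OF lin])
    also have "norm \<dots> \<le> norm (?A (fold T p (a i) - a i)) + norm (?A (a i) - a i)" by (rule norm_triangle_ineq)
    also have "\<dots> \<le> Kb * \<eta> + real k * Kb * \<eta>"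
    proof (rule add_mono[OF _ Suc])
      have "norm (?A (fold T p (a i) - a i)) \<le> Kb * norm (fold T p (a i) - a i)"
        by (rule Kb(2)[OF word_power_in[OF pG] subspace_diff[OF W fold_in[OF sys pG aW] aW]])
      also have "\<dots> \<le> Kb * \<eta>" using close Kb(1) by (intro mult_left_mono) auto
      finally show "norm (?A (fold T p (a i) - a i)) \<le> Kb * \<eta>" .
    qed
    finally show ?case by (simp add: algebra_simps)
  qed simp
  \<comment> \<open>Composing with the projection turns the operator on \<open>W\<close> into a matrix on the whole space.\<close>
  define f where "f y = exp \<delta> *\<^sub>R fold T p (P y)" for y
  have lin_f: "linear f"
    unfolding f_def
    using linear_compose_scale_right[OF linear_compose[OF P(1) linear_fold[OF sys pG]], of "exp \<delta>"]
    by (simp add: o_def)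
  have fW: "f y \<in> W" for y
    unfolding f_def by (intro subspace_scale[OF W] fold_in[OF sys pG] P(2))
  have f_pow: "(f ^^ Suc k) y = exp \<delta> ^ Suc k *\<^sub>R fold T (word_power (Suc k) p) (P y)" for k y
  proof (induction k arbitrary: y)
    case 0
    then show ?case by (simp add: f_def)
  next
    case (Suc k)
    have lin: "linear (fold T (word_power (Suc k) p))" by (rule linear_fold[OF sys word_power_in[OF pG]])
    have "(f ^^ Suc (Suc k)) y = (f ^^ Suc k) (f y)" by (simp only: funpow_Suc_right comp_apply)
    also have "\<dots> = exp \<delta> ^ Suc k *\<^sub>R fold T (word_power (Suc k) p) (f y)"
      unfolding Suc P(3)[OF fW] ..
    also have "\<dots> = exp \<delta> ^ Suc (Suc k) *\<^sub>R fold T (word_power (Suc k) p) (fold T p (P y))"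
      unfolding f_def linear_cmul[OF lin] by simp
    finally show ?case by simp
  qed
  define M where "M = matrix f"
  have M: "(*v) M = f" unfolding M_def by (rule matrix_vector_mul(2)[OF lin_f])
  have M_bound: "norm (M *v y) \<le> exp \<delta> * Kb * norm y" for y
  proof -
    have "norm (fold T p (P y)) \<le> Kb * norm y"
      by (rule order_trans[OF Kb(2)[OF pG P(2)] mult_left_mono[OF P(4)]]) (use Kb(1) in simp)
    then show ?thesis unfolding M f_def by simp
  qed
  have "p \<noteq> []" using dur_p by auto
  have M_stable: "(\<lambda>k. ((*v) M ^^ k) y) \<longlonglongrightarrow> 0" for y
  proof (rule LIMSEQ_imp_Suc, rule Lim_null_comparison)
    show "(\<lambda>k. norm (exp (\<delta> * (real (Suc k) * duration p)) *\<^sub>R fold T (word_power (Suc k) p) (P y))) \<longlonglongrightarrow> 0"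
      by (rule LIMSEQ_Suc[OF tendsto_norm_zero[OF stable_systemD(6)[OF sys pG \<open>p \<noteq> []\<close> P(2)]]])
    have "exp \<delta> ^ Suc k \<le> exp (\<delta> * (real (Suc k) * duration p))" for k
    proof -
      have "\<delta> * (real (Suc k) * 1) \<le> \<delta> * (real (Suc k) * duration p)"
        using dur_p \<delta>_pos by (intro mult_left_mono) auto
      then have "exp (real (Suc k) * \<delta>) \<le> exp (\<delta> * (real (Suc k) * duration p))" by (simp add: mult.commute)
      then show ?thesis by (simp only: exp_of_nat_mult)
    qed
    then show "\<forall>\<^sub>F k in sequentially. norm (((*v) M ^^ Suc k) y)
        \<le> norm (exp (\<delta> * (real (Suc k) * duration p)) *\<^sub>R fold T (word_power (Suc k) p) (P y))"
      unfolding M f_pow norm_scaleR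
      by (intro always_eventually allI mult_right_mono) (auto simp del: power_Suc of_nat_Suc)
  qed
  have "(f ^^ n) (a i) = exp \<delta> ^ n *\<^sub>R fold T (word_power n p) (a i)"
  proof (cases n)
    case (Suc k)
    show ?thesis unfolding Suc f_pow P(3)[OF aW] ..
  qed simp
  moreover have "norm ((f ^^ n) (a i)) \<le> C * exp (\<delta> / 2) ^ n * norm (a i)"
    using C[OF M_bound stable_imp_eigenvalues_le_1[OF M_stable]] unfolding M .
  ultimately have upper: "exp \<delta> ^ n * norm (fold T (word_power n p) (a i)) \<le> C * exp (\<delta> / 2) ^ n * norm (a i)"
    by simp
  have "norm (a i) / 2 \<le> norm (fold T (word_power n p) (a i))"
    using ret[of n] \<eta> a_ge[of i] norm_triangle_ineq2[of "a i" "fold T (word_power n p) (a i)"]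
    by (simp add: norm_minus_commute)
  then have "exp \<delta> ^ n * (norm (a i) / 2) \<le> exp \<delta> ^ n * norm (fold T (word_power n p) (a i))"
    by (rule mult_left_mono) simp
  also note upper
  also have "exp \<delta> ^ n = exp (\<delta> / 2) ^ n * exp (\<delta> / 2) ^ n"
    by (simp add: mult_exp_exp flip: power_mult_distrib)
  finally have "exp (\<delta> / 2) ^ n * exp (\<delta> / 2) ^ n * norm (a i) \<le> 2 * C * exp (\<delta> / 2) ^ n * norm (a i)"
    by simp
  moreover have "0 < norm (a i)" using a_ge[of i] \<open>c > 0\<close> by linarith
  ultimately have "exp (\<delta> / 2) ^ n * exp (\<delta> / 2) ^ n \<le> 2 * C * exp (\<delta> / 2) ^ n"
    by (rule mult_right_le_imp_le)
  then have "exp (\<delta> / 2) ^ n \<le> 2 * C" by (rule mult_right_le_imp_le) simp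
  with n show False by simp
qed

section \<open>The bounded subspace and rescaling\<close>

text \<open>The bounds on the finitely many vectors of an orthonormal basis add up to a uniform one.\<close>

lemma uniformly_bounded_if_orbits_bounded:
  assumes sys: "stable_system W T" and orb: "\<And>x. x \<in> W \<Longrightarrow> \<exists>b. \<forall>l\<in>lists G. norm (fold T l x) \<le> b"
  obtains B where "\<And>l x. l \<in> lists G \<Longrightarrow> x \<in> W \<Longrightarrow> norm (fold T l x) \<le> B * norm x"
proof -
  have W: "subspace W" by (rule stable_systemD(1)[OF sys])
  obtain E where E: "E \<subseteq> W" "pairwise orthogonal E" "\<And>x. x \<in> E \<Longrightarrow> norm x = 1"
    "independent E" "span E = W"
    using orthonormal_basis_subspace[OF W] by metis
  have fin: "finite E" using E(4) by (rule independent_imp_finite)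
  obtain b where b: "\<And>e l. e \<in> E \<Longrightarrow> l \<in> lists G \<Longrightarrow> norm (fold T l e) \<le> b e"
    using orb E(1) by (metis subsetD)
  have "norm (fold T l x) \<le> (\<Sum>e\<in>E. b e) * norm x" if l: "l \<in> lists G" and x: "x \<in> W" for l x
  proof -
    have lin: "linear (fold T l)" by (rule linear_fold[OF sys l])
    have "x = (\<Sum>e\<in>E. (e \<bullet> x) *\<^sub>R e)"
      using orthonormal_basis_expand[OF E(2) E(3) _ fin, of x] x E(5) by (simp add: inner_commute)
    then have "fold T l x = (\<Sum>e\<in>E. (e \<bullet> x) *\<^sub>R fold T l e)"
      using linear_sum[OF lin, of "\<lambda>e. (e \<bullet> x) *\<^sub>R e" E] by (simp add: linear_cmul[OF lin])
    then have "norm (fold T l x) \<le> (\<Sum>e\<in>E. norm ((e \<bullet> x) *\<^sub>R fold T l e))" by (simp only: norm_sum)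
    also have "\<dots> \<le> (\<Sum>e\<in>E. norm x * b e)"
    proof (rule sum_mono)
      fix e assume e: "e \<in> E"
      have "\<bar>e \<bullet> x\<bar> \<le> norm x" using Cauchy_Schwarz_ineq2[of e x] E(3)[OF e] by simp
      then show "norm ((e \<bullet> x) *\<^sub>R fold T l e) \<le> norm x * b e"
        using b[OF e l] by (simp add: mult_mono)
    qed
    finally show ?thesis by (simp add: sum_distrib_left mult.commute)
  qed
  then show thesis by (rule that)
qed

lemma bounded_orbits_subspace:
  assumes sys: "stable_system W T"
  defines "X \<equiv> {x \<in> W. \<exists>b. \<forall>l\<in>lists G. norm (fold T l x) \<le> b}"
  shows "subspace X" "\<And>g x. g \<in> G \<Longrightarrow> x \<in> X \<Longrightarrow> T g x \<in> X"
proof -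
  have W: "subspace W" by (rule stable_systemD(1)[OF sys])
  show "subspace X"
  proof (rule subspaceI)
    show "0 \<in> X"
      using subspace_0[OF W] linear_0[OF linear_fold[OF sys]] by (auto simp: X_def intro!: exI[of _ 0])
    fix x y assume "x \<in> X" "y \<in> X"
    then obtain b c where b: "x \<in> W" "y \<in> W" "\<And>l. l \<in> lists G \<Longrightarrow> norm (fold T l x) \<le> b"
      "\<And>l. l \<in> lists G \<Longrightarrow> norm (fold T l y) \<le> c" unfolding X_def by blast
    have "norm (fold T l (x + y)) \<le> b + c" if "l \<in> lists G" for l
      unfolding linear_add[OF linear_fold[OF sys that]]
      using norm_triangle_ineq[of "fold T l x" "fold T l y"] b(3,4)[OF that] by linarith
    then show "x + y \<in> X" using b(1,2) subspace_add[OF W] by (auto simp: X_def)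
  next
    fix a x assume "x \<in> X"
    then obtain b where b: "x \<in> W" "\<And>l. l \<in> lists G \<Longrightarrow> norm (fold T l x) \<le> b" by (auto simp: X_def)
    have "norm (fold T l (a *\<^sub>R x)) \<le> \<bar>a\<bar> * b" if "l \<in> lists G" for l
      unfolding linear_cmul[OF linear_fold[OF sys that]] using b(2)[OF that] by (simp add: mult_left_mono)
    then show "a *\<^sub>R x \<in> X" using b(1) subspace_scale[OF W] by (auto simp: X_def)
  qed
  fix g x assume g: "g \<in> G" and "x \<in> X"
  then obtain b where b: "x \<in> W" "\<And>l. l \<in> lists G \<Longrightarrow> norm (fold T l x) \<le> b" by (auto simp: X_def)
  have "norm (fold T l (T g x)) \<le> b" if "l \<in> lists G" for l
    using b(2)[of "g # l"] g that by simp
  then show "T g x \<in> X" using stable_systemD(3)[OF sys g b(1)] by (auto simp: X_def)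
qed

lemma fold_rescale:
  assumes lin: "\<forall>g\<in>G. linear (T g)" and "l \<in> lists G"
  shows "fold (\<lambda>g x. exp (- c * len g) *\<^sub>R T g x) l x = exp (- c * duration l) *\<^sub>R fold T l x"
  using assms(2)
proof (induction l arbitrary: x)
  case (Cons g l)
  then have l: "l \<in> lists G" by simp
  have "fold (\<lambda>g x. exp (- c * len g) *\<^sub>R T g x) (g # l) x = (exp (- c * duration l) * exp (- c * len g)) *\<^sub>R fold T l (T g x)"
    using Cons.IH by (simp add: linear_cmul[OF linear_fold_words[OF lin l]])
  also have "exp (- c * duration l) * exp (- c * len g) = exp (- c * duration (g # l))"
    unfolding mult_exp_exp by (simp add: algebra_simps)
  finally show ?case by simp
qed simp

lemma stable_system_rescale:
  assumes sys: "stable_system W T" and "0 \<le> c"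
  shows "stable_system W (\<lambda>g x. exp (- c * len g) *\<^sub>R T g x)" (is "stable_system W ?T")
proof -
  have W: "subspace W" by (rule stable_systemD(1)[OF sys])
  have le: "norm (exp (- c * duration l) *\<^sub>R y) \<le> norm y" if "l \<in> lists G" for l and y :: "real ^ 'a"
    using duration_nonneg[OF that] \<open>0 \<le> c\<close> by (simp add: mult_left_le_one_le)
  have "linear (?T g)" if "g \<in> G" for g
    using linear_compose_scale_right[OF stable_systemD(2)[OF sys that]] by blast
  moreover have "?T g ` W \<subseteq> W" if "g \<in> G" for g
    using stable_systemD(3)[OF sys that] subspace_scale[OF W] by auto
  moreover have "\<exists>C\<ge>0. \<forall>g\<in>G. \<forall>x\<in>W. norm (?T g x) \<le> C * exp (- \<delta> * len g) * norm x"
  proof -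
    obtain C where "0 \<le> C" and C: "\<And>g x. g \<in> G \<Longrightarrow> x \<in> W \<Longrightarrow> norm (T g x) \<le> C * exp (- \<delta> * len g) * norm x"
      using stable_systemD(4)[OF sys] by blast
    have "norm (?T g x) \<le> C * exp (- \<delta> * len g) * norm x" if "g \<in> G" "x \<in> W" for g x
      using order_trans[OF le[of "[g]" "T g x"] C[OF that]] that(1) by simp
    with \<open>0 \<le> C\<close> show ?thesis by blast
  qed
  moreover have "\<exists>K\<ge>0. \<exists>c\<ge>0. \<forall>l\<in>lists G. \<forall>x\<in>W. norm (fold ?T l x) \<le> K * exp (c * duration l) * norm x"
  proof -
    obtain K c' where "0 \<le> K" "0 \<le> c'"
      and K: "\<And>l x. l \<in> lists G \<Longrightarrow> x \<in> W \<Longrightarrow> norm (fold T l x) \<le> K * exp (c' * duration l) * norm x"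
      using stable_systemD(5)[OF sys] by blast
    have "norm (fold ?T l x) \<le> K * exp (c' * duration l) * norm x" if "l \<in> lists G" "x \<in> W" for l x
      unfolding fold_rescale[OF stable_system_linear[OF sys] that(1)] by (rule order_trans[OF le[OF that(1)] K[OF that]])
    with \<open>0 \<le> K\<close> \<open>0 \<le> c'\<close> show ?thesis by blast
  qed
  moreover have "(\<lambda>n. exp (\<delta> * (real n * duration l)) *\<^sub>R fold ?T (word_power n l) x) \<longlonglongrightarrow> 0"
    if "l \<in> lists G" "l \<noteq> []" "x \<in> W" for l x
  proof (rule Lim_null_comparison)
    show "(\<lambda>n. norm (exp (\<delta> * (real n * duration l)) *\<^sub>R fold T (word_power n l) x)) \<longlonglongrightarrow> 0"
      by (rule tendsto_norm_zero[OF stable_systemD(6)[OF sys that]])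
    have "norm (fold ?T (word_power n l) x) \<le> norm (fold T (word_power n l) x)" for n
      unfolding fold_rescale[OF stable_system_linear[OF sys] word_power_in[OF that(1)]] by (rule le[OF word_power_in[OF that(1)]])
    then show "\<forall>\<^sub>F n in sequentially. norm (exp (\<delta> * (real n * duration l)) *\<^sub>R fold ?T (word_power n l) x)
        \<le> norm (exp (\<delta> * (real n * duration l)) *\<^sub>R fold T (word_power n l) x)"
      by (intro always_eventually allI) simp
  qed
  ultimately show ?thesis unfolding stable_system_def using W by simp
qed

section \<open>Stable systems decay uniformly\<close>

text \<open>
  Let \<open>c0\<close> be the infimum of the nonnegative growth exponents. If the system rescaled by \<open>c0\<close> decays
  at rate \<open>\<gamma>\<close>, then \<open>c0 - \<gamma>\<close> is a growth exponent as well, so it is negative by minimality and the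
  system itself decays. The rescaled system grows subexponentially, and its vectors with bounded orbits form an invariant subspace \<open>X\<close>. The case
  \<open>X = W\<close> uses stability, the case \<open>X = 0\<close> contradicts subexponential growth, and otherwise
  both \<open>X\<close> and the quotient by \<open>X\<close> have smaller dimension. The exponent \<open>c0\<close> is taken
  nonnegative because only shrinking by a factor preserves the hypotheses.
\<close>

theorem stable_system_imp_decays:
  assumes "stable_system W T"
  shows "decays W T"
  using assms
proof (induction "dim W" arbitrary: W T rule: less_induct)
  case less
  note sys = less.prems
  have W: "subspace W" by (rule stable_systemD(1)[OF sys])
  define adm where "adm c \<longleftrightarrow> 0 \<le> c \<and> (\<exists>K\<ge>0. \<forall>l\<in>lists G. \<forall>x\<in>W. norm (fold T l x) \<le> K * exp (c * duration l) * norm x)" for c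
  define c0 where "c0 = Inf (Collect adm)"
  have adm_ex: "\<exists>c. adm c" using stable_systemD(5)[OF sys] unfolding adm_def by blast
  have bdd: "bdd_below (Collect adm)" by (rule bdd_belowI[of _ 0]) (simp add: adm_def)
  have "0 \<le> c0" unfolding c0_def using adm_ex by (intro cInf_greatest) (auto simp: adm_def)
  define T' where "T' = (\<lambda>g x. exp (- c0 * len g) *\<^sub>R T g x)"
  have sys': "stable_system W T'" unfolding T'_def by (rule stable_system_rescale[OF sys \<open>0 \<le> c0\<close>])
  have fold': "fold T' l x = exp (- c0 * duration l) *\<^sub>R fold T l x" if "l \<in> lists G" for l x
    unfolding T'_def by (rule fold_rescale[OF stable_system_linear[OF sys] that])
  have subexp: "\<exists>K. \<forall>l\<in>lists G. \<forall>x\<in>W. norm (fold T' l x) \<le> K * exp (\<epsilon> * duration l) * norm x" if "\<epsilon> > 0" for \<epsilon>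
  proof -
    have "\<exists>c\<in>Collect adm. c < c0 + \<epsilon>"
      unfolding c0_def using adm_ex bdd that by (subst cInf_less_iff[symmetric]) auto
    then obtain c K where c: "c < c0 + \<epsilon>" and "0 \<le> K"
      and K: "\<And>l x. l \<in> lists G \<Longrightarrow> x \<in> W \<Longrightarrow> norm (fold T l x) \<le> K * exp (c * duration l) * norm x"
      unfolding adm_def by blast
    have "norm (fold T' l x) \<le> K * exp (\<epsilon> * duration l) * norm x" if l: "l \<in> lists G" and x: "x \<in> W" for l x
    proof -
      have "norm (fold T' l x) \<le> exp (- c0 * duration l) * (K * exp (c * duration l) * norm x)"
        unfolding fold'[OF l] using K[OF l x] by simp
      also have "\<dots> = K * (exp (- c0 * duration l) * exp (c * duration l)) * norm x" by simp
      also have "exp (- c0 * duration l) * exp (c * duration l) = exp ((c - c0) * duration l)"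
        unfolding mult_exp_exp by (simp add: algebra_simps)
      also have "K * exp ((c - c0) * duration l) * norm x \<le> K * exp (\<epsilon> * duration l) * norm x"
      proof -
        have "(c - c0) * duration l \<le> \<epsilon> * duration l" using c duration_nonneg[OF l] by (intro mult_right_mono) auto
        then show ?thesis using \<open>0 \<le> K\<close> by (intro mult_right_mono mult_left_mono) auto
      qed
      finally show ?thesis .
    qed
    then show ?thesis by blast
  qed
  define X where "X = {x \<in> W. \<exists>b. \<forall>l\<in>lists G. norm (fold T' l x) \<le> b}"
  have X: "subspace X" "\<And>g x. g \<in> G \<Longrightarrow> x \<in> X \<Longrightarrow> T' g x \<in> X" "X \<subseteq> W"
    using bounded_orbits_subspace[OF sys'] by (auto simp: X_def)
  have "decays W T'"
  proof -
    consider "X = W" | "X = {0}" | "X \<noteq> W" "X \<noteq> {0}" by blast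
    then show ?thesis
    proof cases
      case 1
      then have "\<And>x. x \<in> W \<Longrightarrow> \<exists>b. \<forall>l\<in>lists G. norm (fold T' l x) \<le> b" by (auto simp: X_def)
      then obtain B where "\<And>l x. l \<in> lists G \<Longrightarrow> x \<in> W \<Longrightarrow> norm (fold T' l x) \<le> B * norm x"
        using uniformly_bounded_if_orbits_bounded[OF sys'] by blast
      then show ?thesis by (rule bounded_imp_decays[OF sys'])
    next
      case 2
      have "x = 0" if "x \<in> W" for x
      proof (rule unbounded_orbits_imp_trivial[OF sys' subexp _ that])
        fix y b assume y: "y \<in> W" "y \<noteq> 0"
        then have "y \<notin> X" using 2 by auto
        then show "\<exists>l\<in>lists G. norm (fold T' l y) > b" using y(1) by (auto simp: X_def not_le)
      qed
      then have "\<forall>l\<in>lists G. \<forall>x\<in>W. norm (fold T' l x) \<le> 0 * exp (- 1 * duration l) * norm x"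
        using linear_0[OF linear_fold[OF sys']] by auto
      then show ?thesis unfolding decays_def by (metis order_refl zero_less_one)
    next
      case 3
      obtain P where P: "linear P" "\<And>x. P x \<in> X" "\<And>x. x \<in> X \<Longrightarrow> P x = x"
        "\<And>x. norm (P x) \<le> norm x" "\<And>x. norm (x - P x) \<le> norm x"
        using subspace_orthogonal_projection[OF X(1)] by metis
      let ?Y = "{y \<in> W. P y = 0}" and ?TY = "\<lambda>g x. T' g x - P (T' g x)"
      have sysY: "stable_system ?Y ?TY" by (rule stable_system_quotient[OF sys' X(1,3,2) P(1,2,3,5)])
      have Y: "subspace ?Y" by (rule stable_systemD(1)[OF sysY])
      have "dim X < dim W"
        using X(1,3) W 3(1) by (intro dim_psubset) (auto simp: span_eq_iff[THEN iffD2])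
      moreover have "dim ?Y < dim W"
      proof (intro dim_psubset)
        obtain x where "x \<in> X" "x \<noteq> 0" using 3(2) subspace_0[OF X(1)] by auto
        then have "x \<in> W" "P x \<noteq> 0" using X(3) P(3) by auto
        then show "span ?Y \<subset> span W" using W Y by (auto simp: span_eq_iff[THEN iffD2])
      qed
      ultimately have "decays X T'" "decays ?Y ?TY"
        using less.hyps stable_system_subspace[OF sys' X(1,3,2)] sysY by blast+
      then show ?thesis using decays_from_blocks[OF sys' X(1,3,2) P(1,2,3,4,5)] by blast
    qed
  qed
  then obtain K \<gamma> where "0 \<le> K" "0 < \<gamma>"
    and K: "\<And>l x. l \<in> lists G \<Longrightarrow> x \<in> W \<Longrightarrow> norm (fold T' l x) \<le> K * exp (- \<gamma> * duration l) * norm x"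
    unfolding decays_def by blast
  have TK: "norm (fold T l x) \<le> K * exp ((c0 - \<gamma>) * duration l) * norm x" if l: "l \<in> lists G" and x: "x \<in> W" for l x
  proof -
    have "norm (fold T l x) = exp (c0 * duration l) * norm (fold T' l x)"
      unfolding fold'[OF l] by (simp add: exp_minus)
    also have "\<dots> \<le> exp (c0 * duration l) * (K * exp (- \<gamma> * duration l) * norm x)"
      using K[OF l x] by (intro mult_left_mono) auto
    also have "\<dots> = K * (exp (c0 * duration l) * exp (- \<gamma> * duration l)) * norm x" by simp
    also have "exp (c0 * duration l) * exp (- \<gamma> * duration l) = exp ((c0 - \<gamma>) * duration l)"
      unfolding mult_exp_exp by (simp add: algebra_simps)
    finally show ?thesis .
  qed
  have "c0 < \<gamma>"
  proof (rule ccontr)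
    assume "\<not> c0 < \<gamma>"
    then have "adm (c0 - \<gamma>)" unfolding adm_def using TK \<open>0 \<le> K\<close> by auto
    then have "c0 \<le> c0 - \<gamma>" unfolding c0_def using bdd by (intro cInf_lower) auto
    then show False using \<open>0 < \<gamma>\<close> by simp
  qed
  then show ?case
    unfolding decays_def using TK \<open>0 \<le> K\<close> by (intro exI[of _ K] conjI exI[of _ "\<gamma> - c0"]) auto
qed

end

section \<open>Signals and words\<close>

definition jump_flow :: "((real ^ 'n ^ 'n) \<times> (real ^ 'n ^ 'n)) \<times> real \<Rightarrow> real ^ 'n \<Rightarrow> real ^ 'n" where
  "jump_flow g x = snd (fst g) *v mexp (fst (fst g)) (snd g) x"

lemma linear_jump_flow: "linear (jump_flow g)"
  unfolding jump_flow_def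
  using linear_compose[OF linear_mexp[of "fst (fst g)" "snd g"] matrix_vector_mul_linear[of "snd (fst g)"]]
  by (simp add: o_def)

lemma linear_fold_jump_flow: "linear (fold jump_flow l)"
proof (induction l)
  case (Cons g l)
  then show ?case using linear_compose[OF linear_jump_flow[of g] Cons] by (simp add: o_def)
qed (simp add: linear_iff)

definition signal_word :: "'a switching_signal \<Rightarrow> nat \<Rightarrow> ('a \<times> real) list" where
  "signal_word Z k = map (\<lambda>j. (signal_at Z (switch_time Z j), switch_time Z (Suc j) - switch_time Z j)) [0..<k]"

lemma signal_word_Suc:
  "signal_word Z (Suc k) = signal_word Z k @ [(signal_at Z (switch_time Z k), switch_time Z (Suc k) - switch_time Z k)]"
  by (simp add: signal_word_def)

lemma sum_signal_word: "switch_time Z 0 = 0 \<Longrightarrow> sum_list (map snd (signal_word Z k)) = switch_time Z k"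
  by (induction k) (auto simp: signal_word_Suc, simp add: signal_word_def)

text \<open>
  The candidate for the solution on the interval number \<open>k\<close>: all steps completed at time \<open>t\<^sub>k\<close>,
  and then free flow.
\<close>

definition trajectory ::
  "((real ^ 'n ^ 'n) \<times> (real ^ 'n ^ 'n)) switching_signal \<Rightarrow> nat \<Rightarrow> real \<Rightarrow> real ^ 'n \<Rightarrow> real ^ 'n" where
  "trajectory Z k t x =
     mexp (fst (signal_at Z (switch_time Z k))) (t - switch_time Z k) (fold jump_flow (signal_word Z k) x)"

lemma linear_trajectory: "linear (trajectory Z k t)"
  unfolding trajectory_def[abs_def]
  using linear_compose[OF linear_fold_jump_flow linear_mexp] by (simp add: o_def)

lemma trajectory_switch [simp]: "trajectory Z k (switch_time Z k) x = fold jump_flow (signal_word Z k) x"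
  by (simp add: trajectory_def)

lemma fold_signal_word_Suc:
  "fold jump_flow (signal_word Z (Suc k)) x =
     snd (signal_at Z (switch_time Z k)) *v trajectory Z k (switch_time Z (Suc k)) x"
  by (simp add: signal_word_Suc jump_flow_def trajectory_def)

lemma trajectory_deriv:
  "((\<lambda>t. trajectory Z k t x) has_vector_derivative
     fst (signal_at Z (switch_time Z k)) *v trajectory Z k t x) (at t within S)"
proof -
  let ?A = "fst (signal_at Z (switch_time Z k))" and ?y = "fold jump_flow (signal_word Z k) x"
  have "((\<lambda>t. mexp ?A (t - switch_time Z k) ?y) has_vector_derivative
      1 *\<^sub>R (?A *v mexp ?A (t - switch_time Z k) ?y)) (at t within S)"
    by (rule vector_diff_chain_within[where f = "\<lambda>t. t - switch_time Z k" and g = "\<lambda>r. mexp ?A r ?y",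
          unfolded o_def mexp_has_vector_derivative])
      (auto intro!: derivative_eq_intros mexp_has_vector_derivative)
  then show ?thesis by (simp add: trajectory_def)
qed

lemma trajectory_continuous: "isCont (\<lambda>t. trajectory Z k t x) t"
  using has_vector_derivative_continuous[OF trajectory_deriv[of Z k x t UNIV]] by simp

context
  fixes \<Z> :: "'a set" and Z :: "'a switching_signal"
  assumes Z: "Z \<in> signals \<Z>"
begin

lemma switch_time_0: "switch_time Z 0 = 0"
  using Z by (simp add: signals_def)

lemma Theta_prev: "Suc k \<in> Theta_star Z \<Longrightarrow> k \<in> Theta Z"
  by (cases "num_switches Z"; cases k) (auto simp: Theta_def Theta_star_def)

lemma Theta_down: "k \<in> Theta Z \<Longrightarrow> j \<le> k \<Longrightarrow> j \<in> Theta Z"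
  by (cases "num_switches Z") (auto simp: Theta_def Theta_star_def)

lemma switch_time_less_Suc: "Suc k \<in> Theta_star Z \<Longrightarrow> switch_time Z k < switch_time Z (Suc k)"
  using Z Theta_prev[of k] by (force simp: signals_def next_time_def)

lemma Suc_Theta: "Suc k \<in> Theta Z \<longleftrightarrow> Suc k \<in> Theta_star Z"
  by (simp add: Theta_def)

lemma switch_time_strict_mono: "j < k \<Longrightarrow> k \<in> Theta Z \<Longrightarrow> switch_time Z j < switch_time Z k"
proof (induction k)
  case (Suc k)
  then have k: "Suc k \<in> Theta_star Z" by (simp add: Suc_Theta)
  have "switch_time Z j \<le> switch_time Z k"
    using Suc.IH Theta_prev[OF k] Suc.prems(1) by (cases "j = k") auto
  then show ?case using switch_time_less_Suc[OF k] by simp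
qed simp

lemma switch_time_nonneg: "k \<in> Theta Z \<Longrightarrow> 0 \<le> switch_time Z k"
  using switch_time_strict_mono[of 0 k] switch_time_0 by (cases "k = 0") auto

lemma switch_interval_Suc: "Suc k \<in> Theta_star Z \<Longrightarrow> switch_interval Z k = {switch_time Z k..<switch_time Z (Suc k)}"
  and switch_interval_last: "Suc k \<notin> Theta_star Z \<Longrightarrow> switch_interval Z k = {switch_time Z k..}"
  by (auto simp: switch_interval_def next_time_def)

lemma convex_switch_interval: "convex (switch_interval Z k)"
  by (cases "Suc k \<in> Theta_star Z") (simp_all add: switch_interval_Suc switch_interval_last)

lemma switch_time_in_interval: "k \<in> Theta Z \<Longrightarrow> switch_time Z k \<in> switch_interval Z k"
  using Z by (auto simp: switch_interval_def signals_def)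

lemma switch_interval_unique:
  assumes "j \<in> Theta Z" "k \<in> Theta Z" "t \<in> switch_interval Z j" "t \<in> switch_interval Z k"
  shows "j = k"
proof -
  have False if "j < k" "k \<in> Theta Z" "t \<in> switch_interval Z j" "t \<in> switch_interval Z k" for j k
  proof -
    have "Suc j \<in> Theta Z" using Theta_down[OF that(2)] that(1) by simp
    then have j: "Suc j \<in> Theta_star Z" by (simp add: Suc_Theta)
    have "switch_time Z (Suc j) \<le> switch_time Z k"
      using switch_time_strict_mono[of "Suc j" k] that(1,2) by (cases "Suc j = k") auto
    moreover have "t < switch_time Z (Suc j)" using that(3) by (simp add: switch_interval_Suc[OF j])
    moreover have "switch_time Z k \<le> t" using that(4) by (simp add: switch_interval_def)
    ultimately show False by simp
  qed
  with assms show ?thesis by (metis linorder_neqE_nat)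
qed

text \<open>Infinitely many switching times before \<open>t\<close> would accumulate.\<close>

lemma switch_interval_exists:
  assumes "0 \<le> t"
  shows "\<exists>k\<in>Theta Z. t \<in> switch_interval Z k"
proof (rule ccontr)
  assume none: "\<not> ?thesis"
  have step: "Suc k \<in> Theta_star Z \<and> switch_time Z (Suc k) \<le> t" if "k \<in> Theta Z" "switch_time Z k \<le> t" for k
  proof -
    have "t \<notin> switch_interval Z k" using none that by blast
    then show ?thesis
      using that by (cases "Suc k \<in> Theta_star Z") (auto simp: switch_interval_Suc switch_interval_last)
  qed
  have all: "k \<in> Theta Z \<and> switch_time Z k \<le> t" for k
  proof (induction k)
    case 0
    then show ?case using assms switch_time_0 by (simp add: Theta_def)
  next
    case (Suc k)
    then show ?case using step[of k] by (simp add: Suc_Theta)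
  qed
  have inj: "inj (switch_time Z)"
  proof (rule linorder_injI)
    fix i j :: nat assume "i < j"
    then have "switch_time Z i < switch_time Z j" using switch_time_strict_mono all by blast
    then show "switch_time Z i \<noteq> switch_time Z j" by simp
  qed
  have star: "Theta_star Z = {1..}"
  proof
    show "Theta_star Z \<subseteq> {1..}" by (auto simp: Theta_star_def)
    show "{1..} \<subseteq> Theta_star Z"
    proof
      fix k :: nat assume "k \<in> {1..}"
      then show "k \<in> Theta_star Z" using conjunct1[OF all[of k]] by (simp add: Theta_def)
    qed
  qed
  have "infinite (switch_time Z ` Theta_star Z)"
    unfolding star finite_image_iff[OF inj_on_subset[OF inj subset_UNIV]] by (rule infinite_Ici)
  moreover have "switch_time Z ` Theta_star Z \<subseteq> {0..t}"
    using all switch_time_nonneg by auto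
  ultimately obtain x where "x islimpt (switch_time Z ` Theta_star Z)"
    using compact_Icc[of 0 t] unfolding compact_eq_Bolzano_Weierstrass by blast
  then show False using Z by (simp add: signals_def)
qed

lemma signal_at_in: "k \<in> Theta Z \<Longrightarrow> signal_at Z (switch_time Z k) \<in> \<Z>"
  using Z switch_time_nonneg by (simp add: signals_def)

end

lemma is_solution_imp_trajectory:
  assumes Z: "Z \<in> signals \<Z>" and x: "is_solution Z x" and "k \<in> Theta Z" "t \<in> switch_interval Z k"
  shows "x t = trajectory Z k t (x 0)"
proof -
  have *: "x t = mexp (fst (signal_at Z (switch_time Z k))) (t - switch_time Z k) (x (switch_time Z k))"
    if "k \<in> Theta Z" "t \<in> switch_interval Z k" for k t
    using x that
    by (intro linear_ode_unique[OF convex_switch_interval[OF Z] switch_time_in_interval[OF Z]])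
      (auto simp: is_solution_def)
  have start: "k \<in> Theta Z \<Longrightarrow> x (switch_time Z k) = fold jump_flow (signal_word Z k) (x 0)" for k
  proof (induction k)
    case 0
    show ?case by (simp add: signal_word_def switch_time_0[OF Z])
  next
    case (Suc k)
    then have k: "Suc k \<in> Theta_star Z" by (simp add: Theta_def)
    then have kT: "k \<in> Theta Z" by (rule Theta_prev[OF Z])
    obtain l where l: "(x \<longlongrightarrow> l) (at_left (switch_time Z (Suc k)))"
      "x (switch_time Z (Suc k)) = snd (signal_at Z (switch_time Z k)) *v l"
      using x k by (auto simp: is_solution_def)
    have "eventually (\<lambda>t. t \<in> {switch_time Z k<..<switch_time Z (Suc k)}) (at_left (switch_time Z (Suc k)))"
      by (rule eventually_at_leftI[OF _ switch_time_less_Suc[OF Z k]]) simp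
    then have "eventually (\<lambda>t. trajectory Z k t (x 0) = x t) (at_left (switch_time Z (Suc k)))"
    proof eventually_elim
      case (elim t)
      then have "t \<in> switch_interval Z k" by (simp add: switch_interval_Suc[OF Z k])
      from *[OF kT this] show ?case by (simp add: trajectory_def Suc.IH[OF kT])
    qed
    moreover have "((\<lambda>t. trajectory Z k t (x 0)) \<longlongrightarrow> trajectory Z k (switch_time Z (Suc k)) (x 0))
        (at_left (switch_time Z (Suc k)))"
      using trajectory_continuous[where Z = Z and k = k and x = "x 0" and t = "switch_time Z (Suc k)"]
      by (simp add: isCont_def filterlim_at_split)
    ultimately have "(x \<longlongrightarrow> trajectory Z k (switch_time Z (Suc k)) (x 0)) (at_left (switch_time Z (Suc k)))"
      using Lim_transform_eventually by blast
    with l(1) have "l = trajectory Z k (switch_time Z (Suc k)) (x 0)"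
      by (rule tendsto_unique[OF trivial_limit_at_left_real])
    then show ?case unfolding fold_signal_word_Suc l(2) by simp
  qed
  show ?thesis using *[OF assms(3,4)] by (simp add: trajectory_def start[OF assms(3)])
qed

lemma solution_exists:
  assumes Z: "Z \<in> signals \<Z>"
  obtains x where "is_solution Z x" "x 0 = x0"
proof -
  define idx where "idx t = (THE k. k \<in> Theta Z \<and> t \<in> switch_interval Z k)" for t
  have idx: "idx t = k" if "k \<in> Theta Z" "t \<in> switch_interval Z k" for t k
    unfolding idx_def using that switch_interval_unique[OF Z] by blast
  define x where "x t = trajectory Z (idx t) t x0" for t
  have x: "x t = trajectory Z k t x0" if "k \<in> Theta Z" "t \<in> switch_interval Z k" for t k
    by (simp add: x_def idx[OF that])
  have "is_solution Z x"
    unfolding is_solution_def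
  proof (intro conjI ballI)
    fix k t assume k: "k \<in> Theta Z" and t: "t \<in> switch_interval Z k"
    have "((\<lambda>t. trajectory Z k t x0) has_vector_derivative
        fst (signal_at Z (switch_time Z k)) *v x t) (at t within switch_interval Z k)"
      unfolding x[OF k t] by (rule trajectory_deriv)
    then show "(x has_vector_derivative fst (signal_at Z (switch_time Z k)) *v x t)
        (at t within switch_interval Z k)"
      by (rule has_vector_derivative_transform[OF t x[OF k], rotated])
  next
    fix k assume "k \<in> Theta_star Z"
    then obtain j where j: "k = Suc j" "Suc j \<in> Theta_star Z" by (cases k) (auto simp: Theta_star_def)
    have jT: "j \<in> Theta Z" by (rule Theta_prev[OF Z j(2)])
    have "eventually (\<lambda>t. t \<in> {switch_time Z j<..<switch_time Z (Suc j)}) (at_left (switch_time Z (Suc j)))"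
      by (rule eventually_at_leftI[OF _ switch_time_less_Suc[OF Z j(2)]]) simp
    then have "eventually (\<lambda>t. trajectory Z j t x0 = x t) (at_left (switch_time Z (Suc j)))"
      by eventually_elim (simp add: x[OF jT] switch_interval_Suc[OF Z j(2)])
    moreover have "((\<lambda>t. trajectory Z j t x0) \<longlongrightarrow> trajectory Z j (switch_time Z (Suc j)) x0)
        (at_left (switch_time Z (Suc j)))"
      using trajectory_continuous[where Z = Z and k = j and x = x0 and t = "switch_time Z (Suc j)"]
      by (simp add: isCont_def filterlim_at_split)
    ultimately have lim: "(x \<longlongrightarrow> trajectory Z j (switch_time Z (Suc j)) x0) (at_left (switch_time Z (Suc j)))"
      using Lim_transform_eventually by blast
    have "Suc j \<in> Theta Z" using j(2) by (simp add: Theta_def)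
    then have "x (switch_time Z (Suc j)) = fold jump_flow (signal_word Z (Suc j)) x0"
      using x[OF _ switch_time_in_interval[OF Z]] by simp
    then show "\<exists>l. (x \<longlongrightarrow> l) (at_left (switch_time Z k)) \<and>
        x (switch_time Z k) = snd (signal_at Z (switch_time Z (k - 1))) *v l"
      using lim fold_signal_word_Suc by (auto simp: j(1))
  qed
  moreover have "x 0 = x0"
  proof -
    have 0: "0 \<in> Theta Z" by (simp add: Theta_def)
    have "x (switch_time Z 0) = x0"
      using x[OF 0 switch_time_in_interval[OF Z 0]] by (simp add: signal_word_def)
    then show ?thesis by (simp add: switch_time_0[OF Z])
  qed
  ultimately show thesis by (rule that)
qed

text \<open>
  Solutions exist for every initial value, so the matrix in the definite description is unique, and
  each solution is the trajectory of its initial value, so the description is met.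
\<close>

lemma flow_matrix_eq_trajectory:
  assumes Z: "Z \<in> signals \<Z>" and k: "k \<in> Theta Z" and t: "t \<in> switch_interval Z k"
  shows "flow_matrix Z t *v v = trajectory Z k t v"
proof -
  let ?M = "matrix (trajectory Z k t)"
  have M: "?M *v v = trajectory Z k t v" for v
    using matrix_vector_mul(2)[OF linear_trajectory[of Z k t]] by metis
  have "flow_matrix Z t = ?M"
    unfolding flow_matrix_def
  proof (rule the_equality)
    show "\<forall>x. is_solution Z x \<longrightarrow> x t = ?M *v x 0"
      using is_solution_imp_trajectory[OF Z _ k t] by (simp add: M)
    fix M' assume M': "\<forall>x. is_solution Z x \<longrightarrow> x t = M' *v x 0"
    have "M' *v v = ?M *v v" for v
    proof -
      obtain x where x: "is_solution Z x" "x 0 = v" by (rule solution_exists[OF Z])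
      have "M' *v v = x t" using M'[rule_format, OF x(1)] x(2) by simp
      also have "\<dots> = trajectory Z k t v" using is_solution_imp_trajectory[OF Z x(1) k t] by (simp add: x(2))
      finally show ?thesis by (simp add: M)
    qed
    then show "M' = ?M" by (simp add: matrix_eq)
  qed
  then show ?thesis by (simp add: M)
qed

definition dwell_steps :: "'a set \<Rightarrow> real \<Rightarrow> ('a \<times> real) set" where
  "dwell_steps \<Z> \<tau> = {(z, s). z \<in> \<Z> \<and> 0 < s \<and> \<tau> \<le> s}"

lemma dwell_steps_duration_nonneg: "l \<in> lists (dwell_steps \<Z> \<tau>) \<Longrightarrow> 0 \<le> sum_list (map snd l)"
  by (induction l) (auto simp: dwell_steps_def)

lemma signal_word_in_dwell_steps:
  assumes "Z \<in> dwell_signals \<Z> \<tau>"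
  shows "k \<in> Theta Z \<Longrightarrow> signal_word Z k \<in> lists (dwell_steps \<Z> \<tau>)"
proof (induction k)
  case (Suc k)
  have Z: "Z \<in> signals \<Z>" using assms by (simp add: dwell_signals_def)
  have k: "Suc k \<in> Theta_star Z" using Suc.prems by (simp add: Theta_def)
  have kT: "k \<in> Theta Z" by (rule Theta_prev[OF Z k])
  have "next_time Z k \<ge> ereal (switch_time Z k) + ereal \<tau>"
    using assms kT by (simp add: dwell_signals_def)
  then have "\<tau> \<le> switch_time Z (Suc k) - switch_time Z k" using k by (simp add: next_time_def)
  with switch_time_less_Suc[OF Z k] signal_at_in[OF Z kT] Suc.IH[OF kT] show ?case
    by (simp add: signal_word_Suc dwell_steps_def)
qed (simp add: signal_word_def)

lemma flow_matrix_word: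
  assumes "Z \<in> dwell_signals \<Z> \<tau>" "0 \<le> t"
  shows "\<exists>l\<in>lists (dwell_steps \<Z> \<tau>). \<exists>z\<in>\<Z>. \<exists>r\<ge>0. sum_list (map snd l) + r = t \<and>
    (\<forall>v. flow_matrix Z t *v v = mexp (fst z) r (fold jump_flow l v))"
proof -
  have Z: "Z \<in> signals \<Z>" using assms by (simp add: dwell_signals_def)
  obtain k where k: "k \<in> Theta Z" "t \<in> switch_interval Z k" using switch_interval_exists[OF Z assms(2)] by blast
  show ?thesis
  proof (intro bexI exI conjI allI)
    show "signal_word Z k \<in> lists (dwell_steps \<Z> \<tau>)" by (rule signal_word_in_dwell_steps[OF assms(1) k(1)])
    show "signal_at Z (switch_time Z k) \<in> \<Z>" by (rule signal_at_in[OF Z k(1)])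
    show "0 \<le> t - switch_time Z k" using k(2) by (simp add: switch_interval_def)
    show "sum_list (map snd (signal_word Z k)) + (t - switch_time Z k) = t"
      by (simp add: sum_signal_word[OF switch_time_0[OF Z]])
    show "flow_matrix Z t *v v = mexp (fst (signal_at Z (switch_time Z k))) (t - switch_time Z k)
        (fold jump_flow (signal_word Z k) v)" for v
      using flow_matrix_eq_trajectory[OF Z k] by (simp add: trajectory_def)
  qed
qed

lemma flow_matrix_switch_word:
  assumes "Z \<in> dwell_signals \<Z> \<tau>" "k \<in> Theta_star Z"
  shows "\<exists>l\<in>lists (dwell_steps \<Z> \<tau>). l \<noteq> [] \<and> sum_list (map snd l) = switch_time Z k \<and>
    (\<forall>v. flow_matrix Z (switch_time Z k) *v v = fold jump_flow l v)"
proof -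
  have Z: "Z \<in> signals \<Z>" using assms by (simp add: dwell_signals_def)
  have k: "k \<in> Theta Z" "k \<noteq> 0" using assms(2) by (auto simp: Theta_def Theta_star_def)
  show ?thesis
    using signal_word_in_dwell_steps[OF assms(1) k(1)] k(2) sum_signal_word[OF switch_time_0[OF Z], of k]
      flow_matrix_eq_trajectory[OF Z k(1) switch_time_in_interval[OF Z k(1)]]
    by (intro bexI[of _ "signal_word Z k"]) (auto simp: signal_word_def)
qed

text \<open>
  A word determines a signal that performs its steps and then stays at \<open>z\<close> without switching. The
  last interval is infinite, so the final value is free of any dwell time constraint.
\<close>

fun word_value :: "('a \<times> real) list \<Rightarrow> 'a \<Rightarrow> real \<Rightarrow> 'a" where
  "word_value [] z t = z"
| "word_value (g # l) z t = (if t < snd g then fst g else word_value l z (t - snd g))"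

definition word_signal :: "('a \<times> real) list \<Rightarrow> 'a \<Rightarrow> 'a switching_signal" where
  "word_signal l z = \<lparr>signal_at = word_value l z, num_switches = enat (length l),
     switch_time = (\<lambda>k. sum_list (map snd (take k l)))\<rparr>"

lemma word_value_in: "z \<in> \<Z> \<Longrightarrow> l \<in> lists (dwell_steps \<Z> \<tau>) \<Longrightarrow> word_value l z t \<in> \<Z>"
  by (induction l arbitrary: t) (auto simp: dwell_steps_def)

lemma word_value_before:
  assumes "k < length l" "l \<in> lists (dwell_steps \<Z> \<tau>)"
    "sum_list (map snd (take k l)) \<le> t" "t < sum_list (map snd (take (Suc k) l))"
  shows "word_value l z t = fst (l ! k)"
  using assms
proof (induction l arbitrary: k t)
  case (Cons g l)
  show ?case
  proof (cases k)
    case (Suc j)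
    have "0 \<le> sum_list (map snd (take j l))"
      using Cons.prems(2) by (intro dwell_steps_duration_nonneg[of _ \<Z> \<tau>]) (auto dest!: in_set_takeD)
    then have "\<not> t < snd g" using Cons.prems(3) Suc by simp
    then show ?thesis using Cons.prems Cons.IH[of j "t - snd g"] Suc by simp
  qed (use Cons.prems in auto)
qed simp

lemma word_value_after:
  assumes "l \<in> lists (dwell_steps \<Z> \<tau>)" "sum_list (map snd l) \<le> t"
  shows "word_value l z t = z"
  using assms
proof (induction l arbitrary: t)
  case (Cons g l)
  have "0 \<le> sum_list (map snd l)"
    by (rule dwell_steps_duration_nonneg[OF Cons.hyps(2)])
  with Cons show ?case by simp
qed simp

lemma word_signal_facts:
  assumes l: "l \<in> lists (dwell_steps \<Z> \<tau>)" and z: "z \<in> \<Z>" and "0 \<le> \<tau>"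
  defines "Z \<equiv> word_signal l z"
  shows "Z \<in> dwell_signals \<Z> \<tau>"
    "signal_word Z (length l) = l"
    "length l \<in> Theta Z" "switch_time Z (length l) = sum_list (map snd l)"
      "switch_interval Z (length l) = {sum_list (map snd l)..}"
      "signal_at Z (switch_time Z (length l)) = z"
proof -
  have star: "Theta_star Z = {1..length l}" by (auto simp: Z_def word_signal_def Theta_star_def)
  have Theta: "Theta Z = {0..length l}" by (auto simp: Theta_def star)
  have time: "switch_time Z k = sum_list (map snd (take k l))" for k by (simp add: Z_def word_signal_def)
  have at: "signal_at Z = word_value l z" by (simp add: Z_def word_signal_def)
  have Suc: "switch_time Z (Suc k) = switch_time Z k + snd (l ! k)" if "k < length l" for k
    using that by (simp add: time take_Suc_conv_app_nth)
  have g: "l ! k \<in> dwell_steps \<Z> \<tau>" if "k < length l" for k using l that by auto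
  have next_last: "next_time Z k = \<infinity>" if "length l \<le> k" for k using that by (simp add: next_time_def star)
  have "next": "next_time Z k = ereal (switch_time Z k + snd (l ! k))" if "k < length l" for k
    using that Suc[OF that] by (simp add: next_time_def star)
  have lt: "ereal (switch_time Z k) < next_time Z k \<and> ereal (switch_time Z k) + ereal \<tau> \<le> next_time Z k" for k
  proof (cases "k < length l")
    case True
    then show ?thesis using g[OF True] by (auto simp: "next" dwell_steps_def)
  qed (simp add: next_last)
  have val: "signal_at Z t = fst ((l @ [(z, 0)]) ! k)" if "k \<in> Theta Z" "t \<in> switch_interval Z k" for k t
  proof (cases "k < length l")
    case True
    then have "switch_time Z k \<le> t" "t < switch_time Z (Suc k)"
      using that(2) by (auto simp: switch_interval_def "next" Suc)
    then show ?thesis using word_value_before[OF True l] True by (simp add: at time nth_append)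
  next
    case False
    then have "k = length l" using that(1) by (simp add: Theta)
    then show ?thesis using that(2) word_value_after[OF l] by (simp add: at switch_interval_def time)
  qed
  have start: "switch_time Z k \<in> switch_interval Z k" for k using lt[of k] by (simp add: switch_interval_def)
  have fin: "finite (switch_time Z ` Theta_star Z)" by (simp add: star)
  have const: "signal_at Z constant_on switch_interval Z k" if "k \<in> Theta Z" for k
    unfolding constant_on_def using val[OF that] by blast
  show "Z \<in> dwell_signals \<Z> \<tau>"
    unfolding dwell_signals_def signals_def
    using lt fin const word_value_in[OF z l] by (auto simp: time at islimpt_finite)
  have "signal_word Z k = take k l" if "k \<le> length l" for k
    using that
  proof (induction k)
    case (Suc k)
    then have k: "k < length l" by simp
    have "signal_at Z (switch_time Z k) = fst (l ! k)"
      using val[OF _ start[of k]] k by (simp add: Theta nth_append)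
    then show ?case using Suc k by (simp add: signal_word_Suc \<open>\<And>k. k < length l \<Longrightarrow> switch_time Z (Suc k) = _\<close> take_Suc_conv_app_nth)
  qed (simp add: signal_word_def)
  then show "signal_word Z (length l) = l" by simp
  show "length l \<in> Theta Z" by (simp add: Theta)
  then show "signal_at Z (switch_time Z (length l)) = z" using val[OF _ start] by simp
  show "switch_time Z (length l) = sum_list (map snd l)" by (simp add: time)
  then show "switch_interval Z (length l) = {sum_list (map snd l)..}"
    by (auto simp: switch_interval_def next_last)
qed

lemma word_flow_matrix:
  assumes l: "l \<in> lists (dwell_steps \<Z> \<tau>)" and z: "z \<in> \<Z>" and "0 \<le> \<tau>" "0 \<le> r"
  shows "\<exists>Z\<in>dwell_signals \<Z> \<tau>. \<forall>v.
    flow_matrix Z (sum_list (map snd l) + r) *v v = mexp (fst z) r (fold jump_flow l v)"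
proof -
  note f = word_signal_facts[OF assms(1-3)]
  have Z: "word_signal l z \<in> signals \<Z>" using f(1) by (simp add: dwell_signals_def)
  have t: "sum_list (map snd l) + r \<in> switch_interval (word_signal l z) (length l)"
    using assms(4) by (simp add: f(5))
  show ?thesis
    using f(1) flow_matrix_eq_trajectory[OF Z f(3) t]
    by (intro bexI[of _ "word_signal l z"]) (auto simp: trajectory_def f(2,4) f(6)[unfolded f(4)])
qed

lemma word_flow_matrix_switch:
  assumes l: "l \<in> lists (dwell_steps \<Z> \<tau>)" "l \<noteq> []" and "0 \<le> \<tau>"
  shows "\<exists>Z\<in>dwell_signals \<Z> \<tau>. \<exists>k\<in>Theta_star Z. switch_time Z k = sum_list (map snd l) \<and>
    (\<forall>v. flow_matrix Z (switch_time Z k) *v v = fold jump_flow l v)"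
proof -
  obtain z where z: "z \<in> \<Z>" using l by (cases l) (auto simp: dwell_steps_def)
  note f = word_signal_facts[OF l(1) z assms(3)]
  have Z: "word_signal l z \<in> signals \<Z>" using f(1) by (simp add: dwell_signals_def)
  have "length l \<in> Theta_star (word_signal l z)" using f(3) l(2) by (simp add: Theta_def)
  moreover have "flow_matrix (word_signal l z) (switch_time (word_signal l z) (length l)) *v v = fold jump_flow l v" for v
    unfolding flow_matrix_eq_trajectory[OF Z f(3) switch_time_in_interval[OF Z f(3)]] trajectory_switch f(2) ..
  ultimately show ?thesis using f(1,4) by blast
qed

section \<open>The maximal Lyapunov exponent\<close>

lemma elog_le:
  assumes "0 \<le> x" "x \<le> exp y"
  shows "elog x \<le> ereal y"
proof (cases "x = 0")
  case False
  then have "ln x \<le> ln (exp y)" using assms by (intro ln_mono) auto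
  with False show ?thesis by (simp add: elog_def)
qed (simp add: elog_def)

lemma elog_ge:
  assumes "exp y \<le> x"
  shows "ereal y \<le> elog x"
proof -
  have "0 < x" using assms exp_gt_zero[of y] by linarith
  moreover have "ln (exp y) \<le> ln x" using assms \<open>0 < x\<close> by (intro ln_mono) auto
  ultimately show ?thesis by (simp add: elog_def)
qed

lemma le_onorm_mult: "norm ((M :: real ^ 'n ^ 'n) *v x) \<le> onorm ((*v) M) * norm x"
  by (rule onorm[OF matrix_vector_mul_bounded_linear])

lemma onorm_matrix_nonneg: "0 \<le> onorm ((*v) (M :: real ^ 'n ^ 'n))"
  by (rule onorm_pos_le[OF matrix_vector_mul_bounded_linear])

lemma lyapunov_le:
  assumes "0 < K" and le: "\<And>t Z. 0 \<le> t \<Longrightarrow> Z \<in> dwell_signals \<Z> \<tau> \<Longrightarrow> onorm ((*v) (flow_matrix Z t)) \<le> K * exp (\<beta> * t)"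
  shows "max_lyapunov_exponent \<Z> \<tau> \<le> ereal \<beta>"
proof -
  let ?f = "\<lambda>t. ereal (1 / t) * (SUP Z\<in>dwell_signals \<Z> \<tau>. elog (onorm ((*v) (flow_matrix Z t))))"
  have ev: "eventually (\<lambda>t. ?f t \<le> ereal (ln K / t + \<beta>)) at_top"
    using eventually_gt_at_top[of 0]
  proof eventually_elim
    case (elim t)
    have "elog (onorm ((*v) (flow_matrix Z t))) \<le> ereal (ln K + \<beta> * t)" if "Z \<in> dwell_signals \<Z> \<tau>" for Z
    proof (rule elog_le[OF onorm_matrix_nonneg])
      show "onorm ((*v) (flow_matrix Z t)) \<le> exp (ln K + \<beta> * t)"
        using le[OF _ that, of t] elim \<open>0 < K\<close> by (simp add: exp_add)
    qed
    then have "(SUP Z\<in>dwell_signals \<Z> \<tau>. elog (onorm ((*v) (flow_matrix Z t)))) \<le> ereal (ln K + \<beta> * t)"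
      by (rule SUP_least)
    then have "?f t \<le> ereal (1 / t) * ereal (ln K + \<beta> * t)"
      using elim by (intro ereal_mult_left_mono) auto
    also have "\<dots> = ereal (ln K / t + \<beta>)" using elim by (simp add: field_simps)
    finally show ?case .
  qed
  have "((\<lambda>t. ln K / t + \<beta>) \<longlongrightarrow> 0 + \<beta>) at_top"
    by (rule tendsto_add[OF real_tendsto_divide_at_top[OF tendsto_const filterlim_ident] tendsto_const])
  then have "((\<lambda>t. ereal (ln K / t + \<beta>)) \<longlongrightarrow> ereal \<beta>) at_top" by simp
  then have "Limsup at_top (\<lambda>t. ereal (ln K / t + \<beta>)) = ereal \<beta>"
    by (intro lim_imp_Limsup) auto
  with Limsup_mono[OF ev] show ?thesis unfolding max_lyapunov_exponent_def by simp
qed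

lemma lyapunov_less_imp_bound:
  assumes "max_lyapunov_exponent \<Z> \<tau> < ereal c"
  obtains t0 where "0 < t0" "\<And>t Z. t0 \<le> t \<Longrightarrow> Z \<in> dwell_signals \<Z> \<tau> \<Longrightarrow> onorm ((*v) (flow_matrix Z t)) < exp (c * t)"
proof -
  let ?S = "\<lambda>t. SUP Z\<in>dwell_signals \<Z> \<tau>. elog (onorm ((*v) (flow_matrix Z t)))"
  have "eventually (\<lambda>t. ereal (1 / t) * ?S t < ereal c) at_top"
    using assms unfolding max_lyapunov_exponent_def by (rule Limsup_lessD)
  then obtain t1 where t1: "\<And>t. t1 \<le> t \<Longrightarrow> ereal (1 / t) * ?S t < ereal c"
    by (auto simp: eventually_at_top_linorder)
  have "onorm ((*v) (flow_matrix Z t)) < exp (c * t)" if t: "max t1 1 \<le> t" and Z: "Z \<in> dwell_signals \<Z> \<tau>" for t Z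
  proof (rule ccontr)
    assume "\<not> ?thesis"
    then have "ereal (c * t) \<le> elog (onorm ((*v) (flow_matrix Z t)))" by (intro elog_ge) simp
    also have "\<dots> \<le> ?S t" by (rule SUP_upper[OF Z])
    finally have "ereal (1 / t) * ereal (c * t) \<le> ereal (1 / t) * ?S t"
      using t by (intro ereal_mult_left_mono) auto
    also have "\<dots> < ereal c" using t by (intro t1) simp
    finally show False using t by simp
  qed
  then show thesis using that[of "max t1 1"] by auto
qed

lemma eigenvector_le_onorm:
  fixes M :: "real ^ 'n ^ 'n"
  assumes "complexify ((*v) M) v = c *s v" "v \<noteq> 0"
  shows "cmod c \<le> onorm ((*v) M)"
proof -
  have "cmod c * norm v = norm (complexify ((*v) M) v)" by (simp add: assms(1) norm_vec_scale)
  also have "\<dots> \<le> onorm ((*v) M) * norm v"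
    by (rule complexify_bound[OF le_onorm_mult onorm_matrix_nonneg])
  finally show ?thesis using assms(2) by simp
qed

text \<open>The signal without switchings has flow \<open>exp (t Z1)\<close>, which grows like \<open>exp (t Re a)\<close> on an eigenvector.\<close>

lemma spectral_abscissa_le_lyapunov:
  assumes "(Z1, Z2) \<in> \<Z>" "0 \<le> \<tau>"
  shows "ereal (spectral_abscissa Z1) \<le> max_lyapunov_exponent \<Z> \<tau>"
proof (rule ccontr)
  assume "\<not> ?thesis"
  then have "max_lyapunov_exponent \<Z> \<tau> < ereal (spectral_abscissa Z1)" by simp
  then obtain t0 where t0: "0 < t0" "\<And>t Z. t0 \<le> t \<Longrightarrow> Z \<in> dwell_signals \<Z> \<tau> \<Longrightarrow>
      onorm ((*v) (flow_matrix Z t)) < exp (spectral_abscissa Z1 * t)"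
    using lyapunov_less_imp_bound by metis
  obtain a where a: "a \<in> eigenvalues Z1" "Re a = spectral_abscissa Z1" by (rule spectral_abscissa_attained)
  then obtain v where v: "v \<noteq> 0" "complexify ((*v) Z1) v = a *s v" by (auto simp: eigenvalues_iff)
  have "\<exists>Z\<in>dwell_signals \<Z> \<tau>. \<forall>v. flow_matrix Z t0 *v v = mexp Z1 t0 v"
    using word_flow_matrix[of "[]" \<Z> \<tau> "(Z1, Z2)" t0] assms t0(1) by simp
  then obtain Z where Z: "Z \<in> dwell_signals \<Z> \<tau>" "(*v) (flow_matrix Z t0) = mexp Z1 t0" by auto
  have "complexify ((*v) (flow_matrix Z t0)) v = exp (of_real t0 * a) *s v"
    unfolding Z(2) by (rule complexify_mexp_eigenvector[OF v(2)])
  from eigenvector_le_onorm[OF this v(1)] t0(2)[OF order_refl Z(1)]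
  show False by (simp add: a(2) mult.commute)
qed

lemma word_power_flow:
  assumes "l \<in> lists (dwell_steps \<Z> \<tau>)" "l \<noteq> []" "0 \<le> \<tau>"
  shows "\<exists>Z\<in>dwell_signals \<Z> \<tau>. (*v) (flow_matrix Z (real n * sum_list (map snd l))) = fold jump_flow l ^^ n"
proof -
  obtain z where z: "z \<in> \<Z>" using assms by (cases l) (auto simp: dwell_steps_def)
  let ?w = "concat (replicate n l)"
  have w: "?w \<in> lists (dwell_steps \<Z> \<tau>)" using assms(1) by auto
  have "sum_list (map snd ?w) = real n * sum_list (map snd l)"
    by (induction n) (auto simp: algebra_simps)
  moreover have "fold jump_flow ?w = fold jump_flow l ^^ n"
    by (induction n) (auto simp: fun_eq_iff funpow_swap1)
  moreover obtain Z where "Z \<in> dwell_signals \<Z> \<tau>" "\<And>v. flow_matrix Z (sum_list (map snd ?w) + 0) *v v = mexp (fst z) 0 (fold jump_flow ?w v)"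
    using word_flow_matrix[OF w z assms(3) order_refl] by blast
  ultimately show ?thesis by (intro bexI[of _ Z]) auto
qed

text \<open>
  Repeating the word of a signal up to \<open>t\<^sub>k\<close> respects the dwell time, and its flow at time
  \<open>n t\<^sub>k\<close> is the \<open>n\<close>-th power, whose norm is at least \<open>\<rho>\<^sup>n\<close>.
\<close>

lemma spectral_radius_le_lyapunov:
  assumes Z: "Z \<in> dwell_signals \<Z> \<tau>" and k: "k \<in> Theta_star Z" and "0 \<le> \<tau>"
  shows "elog (spectral_radius (flow_matrix Z (switch_time Z k))) / ereal (switch_time Z k)
    \<le> max_lyapunov_exponent \<Z> \<tau>"
proof -
  define M where "M = flow_matrix Z (switch_time Z k)"
  obtain l where l: "l \<in> lists (dwell_steps \<Z> \<tau>)" "l \<noteq> []" "sum_list (map snd l) = switch_time Z k"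
    and M: "(*v) M = fold jump_flow l"
    using flow_matrix_switch_word[OF Z k] unfolding M_def by (auto simp: fun_eq_iff)
  define t where "t = switch_time Z k"
  have sig: "Z \<in> signals \<Z>" using Z by (simp add: dwell_signals_def)
  have t: "0 < t"
    using switch_time_strict_mono[OF sig, of 0 k] switch_time_0[OF sig] k
    by (auto simp: t_def Theta_def Theta_star_def)
  have goal_eq: "elog (spectral_radius (flow_matrix Z (switch_time Z k))) / ereal (switch_time Z k)
      = elog (spectral_radius M) / ereal t" by (simp only: M_def t_def)
  obtain \<mu> where \<mu>: "\<mu> \<in> eigenvalues M" "cmod \<mu> = spectral_radius M" by (rule spectral_radius_attained)
  then obtain v where v: "v \<noteq> 0" "complexify ((*v) M) v = \<mu> *s v" by (auto simp: eigenvalues_iff)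
  show ?thesis
  proof (cases "spectral_radius M = 0")
    case True
    then show ?thesis unfolding goal_eq using t by (simp add: elog_def)
  next
    case False
    then have pos: "0 < cmod \<mu>" using \<mu>(2) norm_ge_zero[of \<mu>] by linarith
    define \<beta> where "\<beta> = ln (cmod \<mu>) / t"
    have "ereal \<beta> \<le> max_lyapunov_exponent \<Z> \<tau>"
    proof (rule ccontr)
      assume "\<not> ?thesis"
      then have "max_lyapunov_exponent \<Z> \<tau> < ereal \<beta>" by simp
      then obtain t0 where t0: "0 < t0" "\<And>t Z. t0 \<le> t \<Longrightarrow> Z \<in> dwell_signals \<Z> \<tau> \<Longrightarrow>
          onorm ((*v) (flow_matrix Z t)) < exp (\<beta> * t)"
        using lyapunov_less_imp_bound by metis
      obtain n where n: "t0 \<le> real n * t" using reals_Archimedean3[OF t] by (metis less_imp_le)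
      obtain Z' where Z': "Z' \<in> dwell_signals \<Z> \<tau>" "(*v) (flow_matrix Z' (real n * t)) = (*v) M ^^ n"
        using word_power_flow[OF l(1,2) assms(3), of n] unfolding l(3) t_def[symmetric] M by blast
      have "complexify ((*v) (flow_matrix Z' (real n * t))) v = \<mu> ^ n *s v"
        unfolding Z'(2) complexify_funpow[symmetric]
        by (induction n) (auto simp: v complexify_scale matrix_vector_mul_linear mult.commute)
      then have "cmod (\<mu> ^ n) \<le> onorm ((*v) (flow_matrix Z' (real n * t)))"
        by (rule eigenvector_le_onorm[OF _ v(1)])
      moreover have "cmod (\<mu> ^ n) = exp (\<beta> * (real n * t))"
      proof -
        have e: "\<beta> * (real n * t) = real n * ln (cmod \<mu>)" using t by (simp add: \<beta>_def)
        show ?thesis unfolding e exp_of_nat_mult norm_power using pos by simp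
      qed
      ultimately show False using t0(2)[OF n Z'(1)] by simp
    qed
    then show ?thesis
      unfolding goal_eq using False t by (simp add: elog_def \<beta>_def \<mu>(2))
  qed
qed

lemma matrix_norm_bound: "norm ((A :: real ^ 'n ^ 'n) *v x) \<le> (real CARD('n) * real CARD('n) * norm A) * norm x"
proof -
  have "onorm ((*v) A) \<le> (\<Sum>i\<in>UNIV. \<Sum>j\<in>UNIV. \<bar>A $ i $ j\<bar>)" by (rule onorm_le_matrix_component_sum)
  also have "\<dots> \<le> (\<Sum>i\<in>(UNIV::'n set). \<Sum>j\<in>(UNIV::'n set). norm A)"
    by (intro sum_mono order_trans[OF component_le_norm_cart Finite_Cartesian_Product.norm_nth_le])
  finally have "onorm ((*v) A) \<le> real CARD('n) * real CARD('n) * norm A" by simp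
  then show ?thesis by (meson le_onorm_mult mult_right_mono norm_ge_zero order_trans)
qed

lemma bounded_modes:
  assumes "bounded (\<Z> :: ((real ^ 'n ^ 'n) \<times> (real ^ 'n ^ 'n)) set)"
  obtains b where "0 \<le> b" "\<And>z x. z \<in> \<Z> \<Longrightarrow> norm (fst z *v x) \<le> b * norm x"
    "\<And>z x. z \<in> \<Z> \<Longrightarrow> norm (snd z *v x) \<le> b * norm x"
proof -
  obtain B where B: "\<And>z. z \<in> \<Z> \<Longrightarrow> norm z \<le> B" using assms by (auto simp: bounded_iff)
  define b where "b = real CARD('n) * real CARD('n) * max 0 B"
  have le: "norm (A *v x) \<le> b * norm x" if "norm A \<le> max 0 B" for A :: "real ^ 'n ^ 'n" and x
    unfolding b_def
    by (rule order_trans[OF matrix_norm_bound]) (intro mult_right_mono mult_left_mono that; simp)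
  have "norm (fst z) \<le> max 0 B" "norm (snd z) \<le> max 0 B" if "z \<in> \<Z>" for z
    using B[OF that] norm_fst_le[of "fst z" "snd z"] norm_snd_le[of "snd z" "fst z"]
    by (simp_all add: le_max_iff_disj)
  then show thesis using that[of b] le by (auto simp: b_def)
qed

text \<open>
  A finite exponent controls long times only. A word of short duration is prolonged by free flow
  up to a time where the bound applies, and the flow is undone at a bounded cost.
\<close>

lemma word_growth:
  assumes b: "0 \<le> b" "\<And>z x. z \<in> \<Z> \<Longrightarrow> norm (fst z *v x) \<le> b * norm x"
    and "0 \<le> \<tau>" "z0 \<in> \<Z>" "max_lyapunov_exponent \<Z> \<tau> < \<infinity>"
  obtains K c where "0 \<le> K" "0 \<le> c" "\<And>l x. l \<in> lists (dwell_steps \<Z> \<tau>) \<Longrightarrow>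
    norm (fold jump_flow l x) \<le> K * exp (c * sum_list (map snd l)) * norm x"
proof -
  obtain c1 :: real where "max_lyapunov_exponent \<Z> \<tau> < ereal c1"
    using assms(5) by (metis ereal_dense2 less_ereal.simps(1) order_less_trans ereal_less_PInfty)
  then obtain t0 where t0: "0 < t0" "\<And>t Z. t0 \<le> t \<Longrightarrow> Z \<in> dwell_signals \<Z> \<tau> \<Longrightarrow>
      onorm ((*v) (flow_matrix Z t)) < exp (c1 * t)"
    using lyapunov_less_imp_bound by metis
  define c where "c = max 0 c1"
  have late: "norm (mexp (fst z0) r (fold jump_flow l x)) \<le> exp (c * (sum_list (map snd l) + r)) * norm x"
    if l: "l \<in> lists (dwell_steps \<Z> \<tau>)" and r: "0 \<le> r" "t0 \<le> sum_list (map snd l) + r" for l r x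
  proof -
    let ?t = "sum_list (map snd l) + r"
    obtain Z where Z: "Z \<in> dwell_signals \<Z> \<tau>" "flow_matrix Z ?t *v x = mexp (fst z0) r (fold jump_flow l x)"
      using word_flow_matrix[OF l assms(4,3) r(1)] by blast
    have "norm (flow_matrix Z ?t *v x) \<le> onorm ((*v) (flow_matrix Z ?t)) * norm x" by (rule le_onorm_mult)
    also have "\<dots> \<le> exp (c * ?t) * norm x"
    proof (rule mult_right_mono)
      have "c1 * ?t \<le> c * ?t" using r t0(1) by (intro mult_right_mono) (auto simp: c_def)
      then have "exp (c1 * ?t) \<le> exp (c * ?t)" by (simp only: exp_le_cancel_iff)
      then show "onorm ((*v) (flow_matrix Z ?t)) \<le> exp (c * ?t)"
        using t0(2)[OF r(2) Z(1)] by linarith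
    qed simp
    finally show ?thesis by (simp add: Z(2))
  qed
  define K where "K = exp (b * t0) * exp (c * t0)"
  have "norm (fold jump_flow l x) \<le> K * exp (c * sum_list (map snd l)) * norm x"
    if l: "l \<in> lists (dwell_steps \<Z> \<tau>)" for l x
  proof -
    let ?t = "sum_list (map snd l)"
    have t: "0 \<le> ?t" by (rule dwell_steps_duration_nonneg[OF l])
    have "0 \<le> b * t0" "0 \<le> c * t0" "0 \<le> c" using b(1) t0(1) by (auto simp: c_def)
    then have K1: "1 \<le> K" unfolding K_def mult_exp_exp by simp
    show ?thesis
    proof (cases "t0 \<le> ?t")
      case True
      have "norm (fold jump_flow l x) \<le> 1 * (exp (c * ?t) * norm x)" using late[OF l order_refl] True by simp
      also have "\<dots> \<le> K * (exp (c * ?t) * norm x)" using K1 by (rule mult_right_mono) simp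
      finally show ?thesis by (simp only: mult.assoc)
    next
      case False
      define r where "r = t0 - ?t"
      have r: "0 \<le> r" "r \<le> t0" using False t by (auto simp: r_def)
      have "norm (fold jump_flow l x) = norm (mexp (fst z0) (- r) (mexp (fst z0) r (fold jump_flow l x)))" by simp
      also have "\<dots> \<le> exp (b * \<bar>- r\<bar>) * norm (mexp (fst z0) r (fold jump_flow l x))"
        by (rule norm_mexp_le[OF b(2)[OF assms(4)] b(1)])
      also have "\<dots> \<le> exp (b * t0) * (exp (c * t0) * norm x)"
      proof (intro mult_mono)
        show "exp (b * \<bar>- r\<bar>) \<le> exp (b * t0)" using r b(1) by (simp add: mult_left_mono)
        show "norm (mexp (fst z0) r (fold jump_flow l x)) \<le> exp (c * t0) * norm x"
          using late[OF l r(1), of x] by (simp add: r_def)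
      qed auto
      also have "\<dots> = K * 1 * norm x" by (simp add: K_def)
      also have "\<dots> \<le> K * exp (c * ?t) * norm x"
        using K1 \<open>0 \<le> c\<close> t by (intro mult_right_mono mult_left_mono) auto
      finally show ?thesis .
    qed
  qed
  moreover have "0 \<le> K" "0 \<le> c" by (auto simp: K_def c_def)
  ultimately show thesis using that by blast
qed

text \<open>
  Steps are rescaled by \<open>exp (- (m + \<epsilon>) s)\<close>. Half of \<open>\<epsilon>\<close> is the rate \<open>\<delta>\<close> to spare in the
  stability of words and in the decay of single steps; the other half absorbs the loss between
  spectral bounds and norm bounds.
\<close>

lemma lyapunov_le_spectral_bound:
  fixes \<Z> :: "((real ^ 'n ^ 'n) \<times> (real ^ 'n ^ 'n)) set"
  assumes "bounded \<Z>" "0 \<le> \<tau>" "max_lyapunov_exponent \<Z> \<tau> < \<infinity>" "z0 \<in> \<Z>"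
    and abscissa: "\<And>z a. z \<in> \<Z> \<Longrightarrow> a \<in> eigenvalues (fst z) \<Longrightarrow> Re a \<le> m"
    and radius: "\<And>l \<mu>. l \<in> lists (dwell_steps \<Z> \<tau>) \<Longrightarrow> l \<noteq> [] \<Longrightarrow> \<mu> \<in> eigenvalues (matrix (fold jump_flow l)) \<Longrightarrow>
      cmod \<mu> \<le> exp (m * sum_list (map snd l))"
    and "0 < \<epsilon>"
  shows "max_lyapunov_exponent \<Z> \<tau> \<le> ereal (m + \<epsilon>)"
proof -
  obtain b where b: "0 \<le> b" "\<And>z x. z \<in> \<Z> \<Longrightarrow> norm (fst z *v x) \<le> b * norm x"
    "\<And>z x. z \<in> \<Z> \<Longrightarrow> norm (snd z *v x) \<le> b * norm x"
    using bounded_modes[OF assms(1)] by metis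
  obtain K c where Kc: "0 \<le> K" "0 \<le> c" and K: "\<And>l x. l \<in> lists (dwell_steps \<Z> \<tau>) \<Longrightarrow>
      norm (fold jump_flow l x) \<le> K * exp (c * sum_list (map snd l)) * norm x"
    using word_growth[OF b(1,2) assms(2,4,3)] by blast
  define \<delta> where "\<delta> = \<epsilon> / 2"
  have "0 < \<delta>" using assms by (simp add: \<delta>_def)
  have "m < m + \<delta>" using \<open>0 < \<delta>\<close> by simp
  then obtain C where C: "0 \<le> C" and mexp_le: "\<And>(Z :: real ^ 'n ^ 'n) t x.
     \<lbrakk>\<And>x. norm (Z *v x) \<le> b * norm x; \<And>a. a \<in> eigenvalues Z \<Longrightarrow> Re a \<le> m; 0 \<le> t\<rbrakk>
     \<Longrightarrow> norm (mexp Z t x) \<le> C * exp ((m + \<delta>) * t) * norm x"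
    using uniform_mexp_bound[OF b(1), of m "m + \<delta>"] by metis
  have flow_le: "norm (mexp (fst z) t x) \<le> C * exp ((m + \<delta>) * t) * norm x" if "z \<in> \<Z>" "0 \<le> t" for z t x
    using mexp_le[OF b(2)[OF that(1)] abscissa[OF that(1)] that(2)] .
  interpret words: switched_words "dwell_steps \<Z> \<tau>" snd \<delta>
    by unfold_locales (auto simp: dwell_steps_def \<open>0 < \<delta>\<close>)
  let ?m = "m + \<epsilon>"
  define T where "T = (\<lambda>g x. exp (- ?m * snd g) *\<^sub>R (jump_flow g x :: real ^ 'n))"
  have duration: "words.duration l = sum_list (map snd l)" for l by (simp add: words.duration_def)
  have fold_T: "fold T l x = exp (- ?m * words.duration l) *\<^sub>R fold jump_flow l x" if "l \<in> lists (dwell_steps \<Z> \<tau>)" for l x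
    unfolding T_def by (rule words.fold_rescale[OF _ that]) (simp add: linear_jump_flow)
  have "words.stable_system UNIV T"
    unfolding words.stable_system_def
  proof (intro conjI ballI impI)
    show "linear (T g)" for g
      unfolding T_def by (rule linear_compose_scale_right[OF linear_jump_flow])
    have "norm (T g x) \<le> b * C * exp (- \<delta> * snd g) * norm x" if g: "g \<in> dwell_steps \<Z> \<tau>" for g x
    proof -
      have z: "fst g \<in> \<Z>" and s: "0 \<le> snd g" using g by (auto simp: dwell_steps_def)
      have "norm (jump_flow g x) \<le> b * norm (mexp (fst (fst g)) (snd g) x)"
        unfolding jump_flow_def by (rule b(3)[OF z])
      also have "\<dots> \<le> b * (C * exp ((m + \<delta>) * snd g) * norm x)"
        by (rule mult_left_mono[OF flow_le[OF z s] b(1)])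
      finally have "exp (- ?m * snd g) * norm (jump_flow g x) \<le> exp (- ?m * snd g) * (b * (C * exp ((m + \<delta>) * snd g) * norm x))"
        by (rule mult_left_mono) simp
      also have "\<dots> = b * C * (exp (- ?m * snd g) * exp ((m + \<delta>) * snd g)) * norm x" by simp
      also have "exp (- ?m * snd g) * exp ((m + \<delta>) * snd g) = exp (- \<delta> * snd g)"
        unfolding mult_exp_exp by (simp add: \<delta>_def algebra_simps)
      finally show ?thesis by (simp add: T_def)
    qed
    then show "\<exists>C\<ge>0. \<forall>g\<in>dwell_steps \<Z> \<tau>. \<forall>x\<in>UNIV. norm (T g x) \<le> C * exp (- \<delta> * snd g) * norm x"
      using b(1) C by (intro exI[of _ "b * C"]) auto
    have "norm (fold T l x) \<le> K * exp ((c + \<bar>?m\<bar>) * words.duration l) * norm x" if l: "l \<in> lists (dwell_steps \<Z> \<tau>)" for l x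
    proof -
      have "norm (fold T l x) \<le> exp (- ?m * words.duration l) * (K * exp (c * words.duration l) * norm x)"
        using mult_left_mono[OF K[OF l, of x], of "exp (- ?m * words.duration l)"] by (simp add: fold_T[OF l] duration)
      also have "\<dots> \<le> exp (\<bar>?m\<bar> * words.duration l) * (K * exp (c * words.duration l) * norm x)"
      proof (rule mult_right_mono)
        have "- ?m * words.duration l \<le> \<bar>?m\<bar> * words.duration l"
          using words.duration_nonneg[OF l] by (intro mult_right_mono) auto
        then show "exp (- ?m * words.duration l) \<le> exp (\<bar>?m\<bar> * words.duration l)" by simp
      qed (use Kc in simp)
      also have "\<dots> = K * (exp (\<bar>?m\<bar> * words.duration l) * exp (c * words.duration l)) * norm x" by simp
      also have "exp (\<bar>?m\<bar> * words.duration l) * exp (c * words.duration l) = exp ((c + \<bar>?m\<bar>) * words.duration l)"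
        unfolding mult_exp_exp by (simp add: algebra_simps)
      finally show ?thesis .
    qed
    then show "\<exists>K\<ge>0. \<exists>c\<ge>0. \<forall>l\<in>lists (dwell_steps \<Z> \<tau>). \<forall>x\<in>UNIV. norm (fold T l x) \<le> K * exp (c * words.duration l) * norm x"
      using Kc by (intro exI[of _ K] conjI exI[of _ "c + \<bar>?m\<bar>"]) auto
    fix l x assume l: "l \<in> lists (dwell_steps \<Z> \<tau>)" "l \<noteq> []"
    define t where "t = words.duration l"
    obtain g l' where "l = g # l'" using l(2) by (cases l) auto
    then have t: "0 < t"
      using l(1) words.duration_nonneg[of l'] words.len_pos[of g] by (simp add: t_def)
    define M where "M = matrix (fold jump_flow l)"
    have M: "(*v) M = fold jump_flow l"
      unfolding M_def by (rule matrix_vector_mul(2)[OF linear_fold_jump_flow])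
    obtain D where "0 \<le> D" and D: "norm (((*v) M ^^ n) x) \<le> D * exp ((m + \<delta> / 2) * t) ^ n * norm x" for n x
    proof -
      have *: "0 \<le> K * exp (c * t)" "0 \<le> exp (m * t)" "exp (m * t) < exp ((m + \<delta> / 2) * t)"
        using Kc t \<open>0 < \<delta>\<close> by auto
      obtain D where D: "D \<ge> 0" "\<And>(M :: real ^ 'n ^ 'n) n x.
         \<lbrakk>\<And>x. norm (M *v x) \<le> K * exp (c * t) * norm x; \<And>\<mu>. \<mu> \<in> eigenvalues M \<Longrightarrow> cmod \<mu> \<le> exp (m * t)\<rbrakk>
         \<Longrightarrow> norm (((*v) M ^^ n) x) \<le> D * exp ((m + \<delta> / 2) * t) ^ n * norm x"
        using uniform_power_bound[OF *] by blast
      have "norm (M *v x) \<le> K * exp (c * t) * norm x" for x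
        using K[OF l(1), of x] by (simp add: M t_def duration)
      moreover have "cmod \<mu> \<le> exp (m * t)" if "\<mu> \<in> eigenvalues M" for \<mu>
        using radius[OF l that[unfolded M_def]] by (simp add: t_def duration)
      ultimately show thesis using that[OF D(1)] D(2) by blast
    qed
    show "(\<lambda>n. exp (\<delta> * (real n * words.duration l)) *\<^sub>R fold T (words.word_power n l) x) \<longlonglongrightarrow> 0"
    proof (rule Lim_null_comparison)
      show "(\<lambda>n. D * norm x * exp (- (\<delta> / 2 * t)) ^ n) \<longlonglongrightarrow> 0"
        using t \<open>0 < \<delta>\<close> by (intro tendsto_mult_right_zero LIMSEQ_realpow_zero) auto
      have "norm (exp (\<delta> * (real n * words.duration l)) *\<^sub>R fold T (words.word_power n l) x)
          \<le> D * norm x * exp (- (\<delta> / 2 * t)) ^ n" for n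
      proof -
        have "fold T (words.word_power n l) x = exp (- ?m * (real n * t)) *\<^sub>R ((*v) M ^^ n) x"
          using fold_T[OF words.word_power_in[OF l(1)], of n x]
          by (simp only: words.duration_word_power words.fold_word_power M t_def)
        then have "norm (exp (\<delta> * (real n * words.duration l)) *\<^sub>R fold T (words.word_power n l) x)
          = exp (\<delta> * (real n * t)) * exp (- ?m * (real n * t)) * norm (((*v) M ^^ n) x)"
          by (simp only: norm_scaleR t_def) simp
        also have "\<dots> \<le> exp (\<delta> * (real n * t)) * exp (- ?m * (real n * t)) * (D * exp ((m + \<delta> / 2) * t) ^ n * norm x)"
          by (rule mult_left_mono[OF D]) simp
        also have "\<dots> = D * norm x * (exp (\<delta> * (real n * t)) * exp (- ?m * (real n * t)) * exp ((m + \<delta> / 2) * t) ^ n)"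
          by simp
        also have "exp (\<delta> * (real n * t)) * exp (- ?m * (real n * t)) * exp ((m + \<delta> / 2) * t) ^ n
            = exp (- (\<delta> / 2 * t)) ^ n"
          unfolding exp_of_nat_mult[symmetric] mult_exp_exp by (simp add: \<delta>_def algebra_simps)
        finally show ?thesis .
      qed
      then show "\<forall>\<^sub>F n in sequentially. norm (exp (\<delta> * (real n * words.duration l)) *\<^sub>R fold T (words.word_power n l) x)
          \<le> D * norm x * exp (- (\<delta> / 2 * t)) ^ n" by (intro always_eventually allI)
    qed
  qed auto
  then have "words.decays UNIV T" by (rule words.stable_system_imp_decays)
  then obtain B \<gamma> where "0 \<le> B" "0 < \<gamma>" and B: "\<And>l x. l \<in> lists (dwell_steps \<Z> \<tau>) \<Longrightarrow>
      norm (fold T l x) \<le> B * exp (- \<gamma> * words.duration l) * norm x"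
    unfolding words.decays_def by blast
  have word_le: "norm (fold jump_flow l x) \<le> B * exp (?m * words.duration l) * norm x" if l: "l \<in> lists (dwell_steps \<Z> \<tau>)" for l x
  proof -
    have "norm (fold jump_flow l x) = exp (?m * words.duration l) * norm (fold T l x)"
    proof -
      have e: "exp (?m * words.duration l) * exp (- ?m * words.duration l) = 1"
        unfolding mult_exp_exp by (simp add: algebra_simps)
      have "exp (?m * words.duration l) * norm (fold T l x)
          = exp (?m * words.duration l) * exp (- ?m * words.duration l) * norm (fold jump_flow l x)"
        unfolding fold_T[OF l] by (simp only: norm_scaleR abs_exp_cancel mult.assoc)
      then show ?thesis unfolding e by simp
    qed
    also have "\<dots> \<le> exp (?m * words.duration l) * (B * 1 * norm x)"
    proof (intro mult_left_mono order_trans[OF B[OF l]] mult_right_mono)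
      show "exp (- \<gamma> * words.duration l) \<le> 1" using \<open>0 < \<gamma>\<close> words.duration_nonneg[OF l] by simp
    qed (use \<open>0 \<le> B\<close> in auto)
    finally show ?thesis by (simp add: mult_ac)
  qed
  show ?thesis
  proof (rule lyapunov_le)
    show "0 < C * B + 1" using C \<open>0 \<le> B\<close> by (simp add: add_nonneg_pos)
    fix t :: real and Z assume t: "0 \<le> t" and Z: "Z \<in> dwell_signals \<Z> \<tau>"
    obtain l z r where l: "l \<in> lists (dwell_steps \<Z> \<tau>)" and z: "z \<in> \<Z>" and r: "0 \<le> r" "words.duration l + r = t"
      and flow: "\<And>v. flow_matrix Z t *v v = mexp (fst z) r (fold jump_flow l v)"
      using flow_matrix_word[OF Z t] unfolding duration by blast
    show "onorm ((*v) (flow_matrix Z t)) \<le> (C * B + 1) * exp (?m * t)"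
    proof (rule onorm_le)
      fix x
      have "norm (flow_matrix Z t *v x) \<le> C * exp ((m + \<delta>) * r) * norm (fold jump_flow l x)"
        unfolding flow by (rule flow_le[OF z r(1)])
      also have "\<dots> \<le> C * exp (?m * r) * (B * exp (?m * words.duration l) * norm x)"
      proof (intro mult_mono word_le[OF l])
        have "(m + \<delta>) * r \<le> ?m * r" using r(1) \<open>0 < \<epsilon>\<close> by (intro mult_right_mono) (auto simp: \<delta>_def)
        then show "exp ((m + \<delta>) * r) \<le> exp (?m * r)" by simp
      qed (use C in auto)
      also have "\<dots> = C * B * (exp (?m * r) * exp (?m * words.duration l)) * norm x" by simp
      also have "exp (?m * r) * exp (?m * words.duration l) = exp (?m * t)"
        unfolding mult_exp_exp r(2)[symmetric] by (simp add: algebra_simps)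
      also have "C * B * exp (?m * t) * norm x \<le> (C * B + 1) * exp (?m * t) * norm x"
        by (intro mult_right_mono) auto
      finally show "norm (flow_matrix Z t *v x) \<le> (C * B + 1) * exp (?m * t) * norm x" .
    qed
  qed
qed

theorem theorem1:
  fixes \<Z> :: "((real ^ 'n ^ 'n) \<times> (real ^ 'n ^ 'n)) set" and \<tau> :: real
  assumes "bounded \<Z>"
    and "\<tau> \<ge> 0"
    and "max_lyapunov_exponent \<Z> \<tau> < \<infinity>"
  shows "max_lyapunov_exponent \<Z> \<tau> =
    max (SUP (Z1, Z2)\<in>\<Z>. ereal (spectral_abscissa Z1))
        (SUP (Z, k)\<in>Sigma (dwell_signals \<Z> \<tau>) Theta_star.
           elog (spectral_radius (flow_matrix Z (switch_time Z k))) / ereal (switch_time Z k))"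
    (is "?L = max ?A ?R")
proof (rule antisym)
  have "?A \<le> ?L" using spectral_abscissa_le_lyapunov[OF _ assms(2)] by (auto intro!: SUP_least)
  moreover have "?R \<le> ?L" using spectral_radius_le_lyapunov[OF _ _ assms(2)] by (auto intro!: SUP_least)
  ultimately show "max ?A ?R \<le> ?L" by simp
  show "?L \<le> max ?A ?R"
  proof (cases "\<Z> = {}")
    case True
    then have "dwell_signals \<Z> \<tau> = {}" by (auto simp: dwell_signals_def signals_def)
    then have "?L \<le> ereal \<beta>" for \<beta> by (intro lyapunov_le[of 1]) auto
    then have "?L = -\<infinity>" by (rule ereal_bot)
    then show ?thesis by simp
  next
    case False
    then obtain z0 where z0: "z0 \<in> \<Z>" by auto
    have abscissa: "ereal (spectral_abscissa (fst z)) \<le> max ?A ?R" if "z \<in> \<Z>" for z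
    proof -
      have "(case z of (Z1, Z2) \<Rightarrow> ereal (spectral_abscissa Z1)) \<le> ?A" by (rule SUP_upper[OF that])
      then show ?thesis by (intro max.coboundedI1) (simp add: case_prod_beta)
    qed
    have finite_below: "max ?A ?R \<noteq> -\<infinity>"
    proof
      assume "max ?A ?R = -\<infinity>"
      with abscissa[OF z0] show False by (simp only: ereal_infty_less_eq) simp
    qed
    show ?thesis
    proof (cases "max ?A ?R")
      case (real m)
      have "Re a \<le> m" if "z \<in> \<Z>" "a \<in> eigenvalues (fst z)" for z a
        using abscissa[OF that(1)] spectral_abscissa_ge[OF that(2)] by (simp add: real)
      moreover have "cmod \<mu> \<le> exp (m * sum_list (map snd l))"
        if l: "l \<in> lists (dwell_steps \<Z> \<tau>)" "l \<noteq> []" and \<mu>: "\<mu> \<in> eigenvalues (matrix (fold jump_flow l))" for l \<mu>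
      proof -
        obtain Z k where Z: "Z \<in> dwell_signals \<Z> \<tau>" "k \<in> Theta_star Z" "switch_time Z k = sum_list (map snd l)"
          "\<And>v. flow_matrix Z (switch_time Z k) *v v = fold jump_flow l v"
          using word_flow_matrix_switch[OF l assms(2)] by blast
        have "(*v) (flow_matrix Z (switch_time Z k)) = fold jump_flow l" using Z(4) by auto
        then have "matrix (fold jump_flow l) = flow_matrix Z (switch_time Z k)"
          by (metis matrix_of_matrix_vector_mul)
        then have \<rho>: "cmod \<mu> \<le> spectral_radius (flow_matrix Z (switch_time Z k))"
          using spectral_radius_ge[OF \<mu>] by simp
        have "Z \<in> signals \<Z>" using Z(1) by (simp add: dwell_signals_def)
        then have t: "0 < switch_time Z k"
          using switch_time_strict_mono[of Z \<Z> 0 k] switch_time_0[of Z \<Z>] Z(2)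
          by (auto simp: Theta_def Theta_star_def)
        have "elog (spectral_radius (flow_matrix Z (switch_time Z k))) / ereal (switch_time Z k) \<le> ?R"
        proof -
          have "(Z, k) \<in> Sigma (dwell_signals \<Z> \<tau>) Theta_star" using Z(1,2) by simp
          from SUP_upper[OF this, where f = "\<lambda>(Z, k). elog (spectral_radius (flow_matrix Z (switch_time Z k))) / ereal (switch_time Z k)"]
          show ?thesis by simp
        qed
        also have "\<dots> \<le> ereal m" unfolding real[symmetric] by simp
        finally have le: "elog (spectral_radius (flow_matrix Z (switch_time Z k))) / ereal (switch_time Z k) \<le> ereal m" .
        show ?thesis
        proof (cases "\<mu> = 0")
          case False
          then have pos: "0 < spectral_radius (flow_matrix Z (switch_time Z k))"
            using \<rho> by (meson order_less_le_trans zero_less_norm_iff)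
          then have "ln (spectral_radius (flow_matrix Z (switch_time Z k))) \<le> m * switch_time Z k"
            using le t by (simp add: elog_def field_simps)
          then have "exp (ln (spectral_radius (flow_matrix Z (switch_time Z k)))) \<le> exp (m * switch_time Z k)"
            by simp
          then have "spectral_radius (flow_matrix Z (switch_time Z k)) \<le> exp (m * switch_time Z k)"
            using pos by simp
          with \<rho> show ?thesis by (simp add: Z(3))
        qed simp
      qed
      ultimately have "?L \<le> ereal (m + \<epsilon>)" if "0 < \<epsilon>" for \<epsilon>
        using lyapunov_le_spectral_bound[OF assms z0 _ _ that] by blast
      then have "?L \<le> ereal m + ereal \<epsilon>" if "0 < \<epsilon>" for \<epsilon>
        using that by (simp only: plus_ereal.simps)
      then have "?L \<le> ereal m" by (rule ereal_le_epsilon2)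
      then show ?thesis by (simp only: real)
    next
      case MInf
      with finite_below show ?thesis by simp
    qed simp
  qed
qed

end
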